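(* Let $(S_L)_L$ be a family of effective interactions satisfying the renormalization group equation $e^{S_L/\hbar}=e^{-\hbar\partial_{P_{\varepsilon,L}}}e^{S_\varepsilon/\hbar}$ and the scale $L$ quantum master equation $(Q+\hbar\Delta_L)e^{S_L/\hbar}=0$. Define $\tilde S_L$ by $e^{\tilde S_L/\hbar}:=e^{-\frac12LD}e^{S_L/\hbar}$, and let $\tilde\Delta:=e^{-\frac12LD}\Delta_Le^{\frac12LD}$ (which is independent of $L$). Then the change of $e^{\tilde S_L/\hbar}$ is exact, namely $$\frac{d}{dL}e^{\tilde S_L/\hbar}=-\frac12\,(Q+\hbar\tilde\Delta)\,Q^{\mathrm{GF}}\,e^{\tilde S_L/\hbar}.$$
   Context: All commutators $[\cdot,\cdot]$ are graded; $|\cdot|$ denotes degree. $V$ is the space of smooth sections of a $\mathbb Z$-graded vector bundle over a smooth manifold (the manifold is compact, or one uses rapidly decaying sections), with a $(-1)$-shifted symplectic pairing $\omega$ (antisymmetric, non-degenerate, of degree $-1$, i.e. vanishing on arguments of total degree different from $1$). A free BV theory is fixed: an operator $q:V\to V$ of degree $1$ with $q^2=0$, skew self-adjoint, $\omega(qv,w)+(-1)^{|v|}\omega(v,qw)=0$, making $V$ an elliptic complex. A gauge fixing operator $q^{\mathrm{GF}}:V\to V$ is fixed: a differential operator of order $\le 1$, of degree $-1$, self-adjoint, $\omega(q^{\mathrm{GF}}v,w)=(-1)^{|v|}\omega(v,q^{\mathrm{GF}}w)$, with $(q^{\mathrm{GF}})^2=0$, such that $D:=[q,q^{\mathrm{GF}}]=qq^{\mathrm{GF}}+q^{\mathrm{GF}}q$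 is a generalized Laplacian. For $P=\sum P'\otimes P''\in V\otimes V$ (suitably completed) put $P*v:=(-1)^{|v|}\sum P'\,\omega(P'',v)$. The heat kernel $\mathcal K_L\in V\otimes V$ is the element with $\mathcal K_L*=e^{-LD}$. For $0<\varepsilon\le L<\infty$ the propagator is $P_{\varepsilon,L}:=\int_\varepsilon^L (q^{\mathrm{GF}}\otimes 1)\mathcal K_l\,dl\in V\otimes V$. $\mathcal F V:=\widehat{\operatorname{Sym}}\,V^*[[\hbar]]$. $Q$ and $Q^{\mathrm{GF}}$ are the derivations of $\mathcal F V$ with $Q\phi=-(-1)^{|\phi|}\phi\circ q$ and $Q^{\mathrm{GF}}\phi=(-1)^{|\phi|}\phi\circ q^{\mathrm{GF}}$ for $\phi\in V^*$. On $\mathcal F V$ the symbol $D$ denotes the derivation $[Q,Q^{\mathrm{GF}}]$, which on $\phi\in V^*$ is $\phi\mapsto\phi\circ D$. For $v\in V$, $\partial_v$ is the derivation of $\mathcal F V$ with $\partial_v\phi=(-1)^{|v|}\phi(v)$ on $\phi\in V^*$; for graded symmetric $P=\sum P'\otimes P''\in\operatorname{Sym}^2V$, $\partial_P:=\tfrac12\sum\partial_{P'}\partial_{P''}$. The scale $L$ BV Laplacian is $\Delta_L:=-\partial_{\mathcal K_L}$. The effective interactions $S_L\in\mathcal F V$ are local action functionals of degree $0$, for $L\in(\varepsilon,\infty)$; exponentials $e^{S_L/\hbar}$ are formal series (completed with respect to weight = polynomial degree $+\,2\cdot$ power of $\hbar$), to which all operators above are extended $\hbar$-linearly. Functional-analytic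 subtleties are suppressed: the heat kernels are taken to exist, to be graded symmetric and to depend differentiably on $L$, and $e^{\pm\frac12LD}$ on $\mathcal F V$ are treated formally as mutually inverse operators commuting with $D,Q,Q^{\mathrm{GF}}$ and satisfying $\frac{d}{dL}e^{\pm\frac12LD}=\pm\frac12De^{\pm\frac12LD}$. *)

theory Defs
  imports "HOL-Analysis.Analysis"
begin

section \<open>Smooth and rapidly decaying functions\<close>

primrec iter_deriv ::
  "'a list \<Rightarrow> ('a::real_normed_vector \<Rightarrow> 'b::real_normed_vector) \<Rightarrow> 'a \<Rightarrow> 'b" where
  "iter_deriv [] f = f"
| "iter_deriv (e # es) f = (\<lambda>x. frechet_derivative (iter_deriv es f) (at x) e)"

definition smooth :: "('a::real_normed_vector \<Rightarrow> 'b::real_normed_vector) \<Rightarrow> bool" where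
  "smooth f \<longleftrightarrow> (\<forall>es x. iter_deriv es f differentiable (at x))"

definition schwartz :: "('m::euclidean_space \<Rightarrow> 'b::real_normed_vector) \<Rightarrow> bool" where
  "schwartz f \<longleftrightarrow> smooth f \<and>
     (\<forall>k es. bounded (range (\<lambda>x. (1 + norm x) ^ k *\<^sub>R iter_deriv es f x)))"

definition schwartz_norm :: "nat \<Rightarrow> ('m::euclidean_space \<Rightarrow> 'b::real_normed_vector) \<Rightarrow> real" where
  "schwartz_norm m f =
     (SUP (es, x) \<in> {es. set es \<subseteq> Basis \<and> length es \<le> m} \<times> UNIV.
        (1 + norm x) ^ m * norm (iter_deriv es f x))"

definition grad :: "('m::euclidean_space \<Rightarrow> real) \<Rightarrow> 'm \<Rightarrow> 'm" where
  "grad f x = (\<Sum>b\<in>Basis. frechet_derivative f (at x) b *\<^sub>R b)"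


section \<open>Manifolds, graded bundles and their sections\<close>

text \<open>
  Manifolds are closed submanifolds of a Euclidean space (no restriction, by Whitney's theorem):
  near each point a diffeomorphism of the ambient space, with inverse \<open>G\<close>, straightens the
  manifold to a linear subspace.  That \<open>F\<close> and \<open>G\<close> are defined and smooth on the whole
  space is no restriction either: shrink \<open>U\<close> and cut off.
\<close>

definition closed_submanifold :: "'m::euclidean_space set \<Rightarrow> bool" where
  "closed_submanifold M \<longleftrightarrow> closed M \<and>
     (\<exists>d. \<forall>x\<in>M. \<exists>U (F :: 'm \<Rightarrow> 'm) (G :: 'm \<Rightarrow> 'm) W.
        open U \<and> x \<in> U \<and> smooth F \<and> smooth G \<and> subspace W \<and> dim W = d \<and>
        open (F ` U) \<and> (\<forall>y\<in>U. G (F y) = y) \<and> F ` (M \<inter> U) = F ` U \<inter> W)"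

definition tangent :: "'m::euclidean_space set \<Rightarrow> 'm \<Rightarrow> 'm set" where
  "tangent M x = {u. \<exists>c :: real \<Rightarrow> 'm. smooth c \<and> range c \<subseteq> M \<and> c 0 = x \<and>
                        (c has_vector_derivative u) (at 0)}"

text \<open>
  A graded vector bundle over \<open>base\<close> is a graded subbundle of a trivial graded bundle (again no
  restriction): \<open>gdeg i\<close> is the degree of the \<open>i\<close>-th coordinate and the fibre over \<open>x\<close> is the
  range of the projection matrix \<open>bproj x\<close>.  The space \<open>V\<close> of sections is the type \<open>'v\<close>,
  identified with an honest space of functions by \<open>sect\<close>.
\<close>

record ('m, 'r::finite, 'v) bv =
  base :: "'m set"
  bproj :: "'m \<Rightarrow> real ^ 'r ^ 'r"
  gdeg :: "'r \<Rightarrow> int"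
  sect :: "'v \<Rightarrow> 'm \<Rightarrow> real ^ 'r"
  pairing :: "'v \<Rightarrow> 'v \<Rightarrow> real"
  dif :: "'v \<Rightarrow> 'v"
  gfix :: "'v \<Rightarrow> 'v"

definition graded_bundle :: "('m::euclidean_space, 'r::finite, 'v) bv \<Rightarrow> bool" where
  "graded_bundle B \<longleftrightarrow> closed_submanifold (base B) \<and> smooth (bproj B) \<and>
     (\<forall>x\<in>base B. bproj B x ** bproj B x = bproj B x \<and>
        (\<forall>i j. gdeg B i \<noteq> gdeg B j \<longrightarrow> bproj B x $ i $ j = 0))"

text \<open>
  Restrictions to the manifold of Schwartz functions on the ambient space.  If the manifold is
  compact these are all smooth sections; if it is the whole Euclidean space they are the rapidly
  decaying ones.  The quotient seminorms below define the usual Frechet topology in both cases.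
\<close>

definition section_set :: "('m::euclidean_space, 'r::finite, 'v) bv \<Rightarrow> ('m \<Rightarrow> real ^ 'r) set" where
  "section_set B =
     {s. \<exists>f. schwartz f \<and> (\<forall>x\<in>base B. s x = f x \<and> bproj B x *v f x = f x) \<and>
             (\<forall>x. x \<notin> base B \<longrightarrow> s x = 0)}"

definition section_space :: "('m::euclidean_space, 'r::finite, 'v::real_vector) bv \<Rightarrow> bool" where
  "section_space B \<longleftrightarrow>
     (\<forall>u v. sect B (u + v) = (\<lambda>x. sect B u x + sect B v x)) \<and>
     (\<forall>c v. sect B (c *\<^sub>R v) = (\<lambda>x. c *\<^sub>R sect B v x)) \<and>
     inj (sect B) \<and> range (sect B) = section_set B"

definition sn :: "('m::euclidean_space, 'r::finite, 'v) bv \<Rightarrow> nat \<Rightarrow> 'v \<Rightarrow> real" where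
  "sn B m v = Inf {schwartz_norm m f | f. schwartz f \<and> (\<forall>x\<in>base B. f x = sect B v x)}"

definition homog :: "('m, 'r::finite, 'v) bv \<Rightarrow> int \<Rightarrow> 'v set" where
  "homog B k = {v. \<forall>x i. gdeg B i \<noteq> k \<longrightarrow> sect B v x $ i = 0}"

definition hcomp :: "('m, 'r::finite, 'v) bv \<Rightarrow> int \<Rightarrow> 'v \<Rightarrow> 'v" where
  "hcomp B k v = inv (sect B) (\<lambda>x. \<chi> i. if gdeg B i = k then sect B v x $ i else 0)"

text \<open>The parity operator is \<open>v \<mapsto> (-1) ^ \<bar>v\<bar> v\<close>; all Koszul signs below are written with it.\<close>

definition parity :: "('m, 'r::finite, 'v) bv \<Rightarrow> 'v \<Rightarrow> 'v" where
  "parity B v = inv (sect B) (\<lambda>x. \<chi> i. (-1) powi gdeg B i * sect B v x $ i)"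

definition has_degree :: "('m, 'r::finite, 'v) bv \<Rightarrow> int \<Rightarrow> ('v \<Rightarrow> 'v) \<Rightarrow> bool" where
  "has_degree B d A \<longleftrightarrow> (\<forall>k. \<forall>v\<in>homog B k. A v \<in> homog B (k + d))"

definition cont_linear ::
  "('m::euclidean_space, 'r::finite, 'v::real_vector) bv \<Rightarrow> ('v \<Rightarrow> 'v) \<Rightarrow> bool" where
  "cont_linear B A \<longleftrightarrow> linear A \<and> (\<forall>m. \<exists>n C. \<forall>v. sn B m (A v) \<le> C * sn B n v)"


section \<open>Differential operators\<close>

definition fsmult ::
  "('m::euclidean_space, 'r::finite, 'v) bv \<Rightarrow> ('m \<Rightarrow> real) \<Rightarrow> 'v \<Rightarrow> 'v" where
  "fsmult B f v = inv (sect B) (\<lambda>x. f x *\<^sub>R sect B v x)"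

definition ad ::
  "('m::euclidean_space, 'r::finite, 'v::real_vector) bv \<Rightarrow> ('m \<Rightarrow> real) \<Rightarrow> ('v \<Rightarrow> 'v) \<Rightarrow> 'v \<Rightarrow> 'v" where
  "ad B f A = (\<lambda>v. A (fsmult B f v) - fsmult B f (A v))"

text \<open>
  Grothendieck's definition: \<open>A\<close> has order at most \<open>r\<close> if all \<open>r + 1\<close>-fold commutators with
  multiplication operators vanish.  The \<open>r\<close>-fold commutator \<open>ad f (\<dots> (ad f A))\<close> is then
  \<open>r!\<close> times the principal symbol at the covector \<open>df\<close> (without factors of the imaginary unit).
\<close>

definition order_le_on ::
  "('m::euclidean_space, 'r::finite, 'v::real_vector) bv \<Rightarrow> nat \<Rightarrow> 'v set \<Rightarrow> ('v \<Rightarrow> 'v) \<Rightarrow> bool" where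
  "order_le_on B r X A \<longleftrightarrow>
     (\<forall>fs. length fs = Suc r \<longrightarrow> (\<forall>f\<in>set fs. schwartz f) \<longrightarrow> (\<forall>v\<in>X. fold (ad B) fs A v = 0))"

definition diff_operator ::
  "('m::euclidean_space, 'r::finite, 'v::real_vector) bv \<Rightarrow> nat \<Rightarrow> ('v \<Rightarrow> 'v) \<Rightarrow> bool" where
  "diff_operator B r A \<longleftrightarrow> cont_linear B A \<and> order_le_on B r UNIV A"

text \<open>
  The order of the differential may depend on the degree, as in Yang--Mills theory.
  The last clause is exactness of the symbol sequence at every nonzero covector of the manifold.
\<close>

definition elliptic_complex ::
  "('m::euclidean_space, 'r::finite, 'v::real_vector) bv \<Rightarrow> bool" where
  "elliptic_complex B \<longleftrightarrow>
     cont_linear B (dif B) \<and> has_degree B 1 (dif B) \<and> (\<forall>v. dif B (dif B v) = 0) \<and>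
     (\<exists>r :: int \<Rightarrow> nat. (\<forall>k. order_le_on B (r k) (homog B k) (dif B)) \<and>
        (\<forall>x\<in>base B. \<forall>f. schwartz f \<longrightarrow> (\<exists>t\<in>tangent (base B) x. grad f x \<bullet> t \<noteq> 0) \<longrightarrow>
           (\<forall>k. \<forall>v\<in>homog B k.
              sect B ((ad B f ^^ r k) (dif B) v) x = 0 \<longleftrightarrow>
              (\<exists>w\<in>homog B (k - 1). sect B ((ad B f ^^ r (k - 1)) (dif B) w) x = sect B v x))))"

text \<open>
  \<open>g x\<close> is the dual Riemannian metric at \<open>x\<close>, pulled back along the restriction of ambient
  covectors (identified with vectors) to the tangent space.
\<close>

definition generalized_laplacian ::
  "('m::euclidean_space, 'r::finite, 'v::real_vector) bv \<Rightarrow> ('v \<Rightarrow> 'v) \<Rightarrow> bool" where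
  "generalized_laplacian B A \<longleftrightarrow> diff_operator B 2 A \<and>
     (\<exists>g :: 'm \<Rightarrow> 'm \<Rightarrow> 'm \<Rightarrow> real.
        (\<forall>u w. smooth (\<lambda>x. g x u w)) \<and>
        (\<forall>x\<in>base B. bilinear (g x) \<and> (\<forall>u w. g x u w = g x w u) \<and> (\<forall>u. 0 \<le> g x u u) \<and>
           (\<forall>u. g x u u = 0 \<longleftrightarrow> (\<forall>t\<in>tangent (base B) x. u \<bullet> t = 0))) \<and>
        (\<forall>f v. schwartz f \<longrightarrow> (\<forall>x\<in>base B.
           sect B (ad B f (ad B f A) v) x = (- 2 * g x (grad f x) (grad f x)) *\<^sub>R sect B v x)))"


section \<open>Free BV theories and gauge fixing\<close>

text \<open>
  Since \<open>\<omega>(v, w)\<close> vanishes unless \<open>\<bar>v\<bar> + \<bar>w\<bar> = 1\<close>, graded and plain antisymmetry agree.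
\<close>

definition symplectic_pairing ::
  "('m::euclidean_space, 'r::finite, 'v::real_vector) bv \<Rightarrow> bool" where
  "symplectic_pairing B \<longleftrightarrow> bilinear (pairing B) \<and>
     (\<exists>m C. \<forall>v w. \<bar>pairing B v w\<bar> \<le> C * sn B m v * sn B m w) \<and>
     (\<forall>v w. pairing B v w = - pairing B w v) \<and>
     (\<forall>v. (\<forall>w. pairing B v w = 0) \<longrightarrow> v = 0) \<and>
     (\<forall>k l. \<forall>v\<in>homog B k. \<forall>w\<in>homog B l. k + l \<noteq> 1 \<longrightarrow> pairing B v w = 0)"

definition free_bv_theory ::
  "('m::euclidean_space, 'r::finite, 'v::real_vector) bv \<Rightarrow> bool" where
  "free_bv_theory B \<longleftrightarrow>
     graded_bundle B \<and> section_space B \<and> symplectic_pairing B \<and> elliptic_complex B \<and>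
     (\<forall>k. \<forall>v\<in>homog B k. \<forall>w.
        pairing B (dif B v) w + (-1) powi k * pairing B v (dif B w) = 0)"

definition Dop :: "('m, 'r::finite, 'v::real_vector) bv \<Rightarrow> 'v \<Rightarrow> 'v" where
  "Dop B v = dif B (gfix B v) + gfix B (dif B v)"

definition gauge_fixing ::
  "('m::euclidean_space, 'r::finite, 'v::real_vector) bv \<Rightarrow> bool" where
  "gauge_fixing B \<longleftrightarrow> diff_operator B 1 (gfix B) \<and> has_degree B (-1) (gfix B) \<and>
     (\<forall>k. \<forall>v\<in>homog B k. \<forall>w. pairing B (gfix B v) w = (-1) powi k * pairing B v (gfix B w)) \<and>
     (\<forall>v. gfix B (gfix B v) = 0) \<and> generalized_laplacian B (Dop B)"


section \<open>The completed tensor square of V\<close>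

text \<open>
  An element \<open>P = \<Sum> P' \<otimes> P''\<close> of the completed projective tensor square of the Frechet space
  \<open>V\<close> is presented by an absolutely convergent series of elementary tensors (every element has
  such a presentation).  Two presentations are equal as tensors iff all continuous bilinear
  forms take the same value on them.
\<close>

type_synonym 'v tens = "nat \<Rightarrow> 'v \<times> 'v"

definition tensor :: "('m::euclidean_space, 'r::finite, 'v) bv \<Rightarrow> 'v tens \<Rightarrow> bool" where
  "tensor B P \<longleftrightarrow> (\<forall>m. summable (\<lambda>i. sn B m (fst (P i)) * sn B m (snd (P i))))"

definition bilinear_forms ::
  "('m::euclidean_space, 'r::finite, 'v::real_vector) bv \<Rightarrow> ('v \<Rightarrow> 'v \<Rightarrow> real) set" where
  "bilinear_forms B =
     {\<beta>. bilinear \<beta> \<and> (\<exists>m C. \<forall>x y. \<bar>\<beta> x y\<bar> \<le> C * sn B m x * sn B m y)}"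

definition tpair :: "'v tens \<Rightarrow> ('v \<Rightarrow> 'v \<Rightarrow> real) \<Rightarrow> real" where
  "tpair P \<beta> = (\<Sum>i. \<beta> (fst (P i)) (snd (P i)))"

definition tensor_eq ::
  "('m::euclidean_space, 'r::finite, 'v::real_vector) bv \<Rightarrow> 'v tens \<Rightarrow> 'v tens \<Rightarrow> bool" where
  "tensor_eq B P R \<longleftrightarrow> (\<forall>\<beta>\<in>bilinear_forms B. tpair P \<beta> = tpair R \<beta>)"

definition tmap :: "('v \<Rightarrow> 'v) \<Rightarrow> ('v \<Rightarrow> 'v) \<Rightarrow> 'v tens \<Rightarrow> 'v tens" where
  "tmap A C P = (\<lambda>i. (A (fst (P i)), C (snd (P i))))"

text \<open>Invariance under \<open>x \<otimes> y \<mapsto> (-1) ^ (\<bar>x\<bar> \<bar>y\<bar>) y \<otimes> x\<close>.\<close>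

definition graded_symmetric ::
  "('m::euclidean_space, 'r::finite, 'v::real_vector) bv \<Rightarrow> 'v tens \<Rightarrow> bool" where
  "graded_symmetric B P \<longleftrightarrow> (\<forall>\<beta>\<in>bilinear_forms B.
     tpair P \<beta> = tpair P (\<lambda>x y. \<Sum>k\<in>range (gdeg B). \<Sum>l\<in>range (gdeg B).
                              (-1) powi (k * l) * \<beta> (hcomp B l y) (hcomp B k x)))"

text \<open>
  \<open>star_eq B P v w\<close> states \<open>P * v = w\<close>, where \<open>P * v = (-1) ^ \<bar>v\<bar> \<Sum> P' \<omega>(P'', v)\<close> converges in
  \<open>V\<close>; the sign is absorbed in the parity operator.
\<close>

definition star_eq ::
  "('m::euclidean_space, 'r::finite, 'v::real_vector) bv \<Rightarrow> 'v tens \<Rightarrow> 'v \<Rightarrow> 'v \<Rightarrow> bool" where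
  "star_eq B P v w \<longleftrightarrow> (\<forall>m.
     (\<lambda>N. sn B m ((\<Sum>i<N. pairing B (snd (P i)) (parity B v) *\<^sub>R fst (P i)) - w)) \<longlonglongrightarrow> 0)"

text \<open>
  Differentiability on \<open>(0, \<infinity>)\<close> in the projective tensor topology: that topology is uniform
  convergence on the sets of bilinear forms bounded by a fixed seminorm.
\<close>

definition tensor_differentiable ::
  "('m::euclidean_space, 'r::finite, 'v::real_vector) bv \<Rightarrow> (real \<Rightarrow> 'v tens) \<Rightarrow> bool" where
  "tensor_differentiable B K \<longleftrightarrow> (\<forall>t>0. \<exists>R. tensor B R \<and>
     (\<forall>m. \<forall>e>0. \<exists>d>0. \<forall>s>0. 0 < \<bar>s - t\<bar> \<and> \<bar>s - t\<bar> < d \<longrightarrow>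
        (\<forall>\<beta>. bilinear \<beta> \<and> (\<forall>x y. \<bar>\<beta> x y\<bar> \<le> sn B m x * sn B m y) \<longrightarrow>
           \<bar>(tpair (K s) \<beta> - tpair (K t) \<beta>) / (s - t) - tpair R \<beta>\<bar> \<le> e)))"


section \<open>Heat kernels and propagators\<close>

text \<open>\<open>U t\<close> is \<open>e ^ (- t D)\<close>, the semigroup on \<open>V\<close> generated by \<open>- D\<close>.\<close>

definition heat_semigroup ::
  "('m::euclidean_space, 'r::finite, 'v::real_vector) bv \<Rightarrow> (real \<Rightarrow> 'v \<Rightarrow> 'v) \<Rightarrow> bool" where
  "heat_semigroup B U \<longleftrightarrow>
     (\<forall>t\<ge>0. cont_linear B (U t)) \<and> (\<forall>v. U 0 v = v) \<and>
     (\<forall>s\<ge>0. \<forall>t\<ge>0. \<forall>v. U (s + t) v = U s (U t v)) \<and>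
     (\<forall>t\<ge>0. \<forall>v m.
        ((\<lambda>s. sn B m ((1 / (s - t)) *\<^sub>R (U s v - U t v) + Dop B (U t v))) \<longlongrightarrow> 0)
          (at t within {0..}))"

text \<open>The heat kernel is the (unique) tensor \<open>K\<close> with \<open>K * v = e ^ (- L D) v\<close>.\<close>

definition is_heat_kernel ::
  "('m::euclidean_space, 'r::finite, 'v::real_vector) bv \<Rightarrow> (real \<Rightarrow> 'v \<Rightarrow> 'v) \<Rightarrow> real
     \<Rightarrow> 'v tens \<Rightarrow> bool" where
  "is_heat_kernel B U L K \<longleftrightarrow> tensor B K \<and> (\<forall>v. star_eq B K v (U L v)) \<and>
     (\<forall>R. tensor B R \<and> (\<forall>v. star_eq B R v (U L v)) \<longrightarrow> tensor_eq B R K)"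

text \<open>\<open>P\<close> is the (weak) integral of \<open>(gfix \<otimes> 1) (K l)\<close> over \<open>l\<close> from \<open>\<epsilon>\<close> to \<open>L\<close>.\<close>

definition is_propagator ::
  "('m::euclidean_space, 'r::finite, 'v::real_vector) bv \<Rightarrow> (real \<Rightarrow> 'v tens) \<Rightarrow> real \<Rightarrow> real
     \<Rightarrow> 'v tens \<Rightarrow> bool" where
  "is_propagator B K \<epsilon> L P \<longleftrightarrow> tensor B P \<and>
     (\<forall>\<beta>\<in>bilinear_forms B.
        ((\<lambda>l. tpair (tmap (gfix B) (\<lambda>v. v) (K l)) \<beta>) has_integral tpair P \<beta>) {\<epsilon>..L})"


section \<open>Functionals\<close>

text \<open>
  An element of the completed symmetric algebra of the continuous dual of \<open>V\<close> is a function
  on lists; its component in the \<open>n\<close>-th symmetric power is its restriction to lists of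
  length \<open>n\<close>, a continuous graded symmetric \<open>n\<close>-linear functional.
\<close>

type_synonym 'v fnl = "'v list \<Rightarrow> real"

definition sym_fnl ::
  "('m::euclidean_space, 'r::finite, 'v::real_vector) bv \<Rightarrow> 'v fnl set" where
  "sym_fnl B = {\<phi>.
     (\<forall>xs ys. linear (\<lambda>v. \<phi> (xs @ [v] @ ys))) \<and>
     (\<forall>n. \<exists>m C. \<forall>vs. length vs = n \<longrightarrow> \<bar>\<phi> vs\<bar> \<le> C * prod_list (map (sn B m) vs)) \<and>
     (\<forall>xs ys k l. \<forall>u\<in>homog B k. \<forall>w\<in>homog B l.
        \<phi> (xs @ [u, w] @ ys) = (-1) powi (k * l) * \<phi> (xs @ [w, u] @ ys))}"

text \<open>A linear functional of degree \<open>d\<close> is supported on vectors of degree \<open>- d\<close>.\<close>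

definition fnl_degree :: "('m, 'r::finite, 'v) bv \<Rightarrow> int \<Rightarrow> 'v fnl \<Rightarrow> bool" where
  "fnl_degree B d \<phi> \<longleftrightarrow>
     (\<forall>vs ks. list_all2 (\<lambda>v k. v \<in> homog B k) vs ks \<longrightarrow> \<phi> vs \<noteq> 0 \<longrightarrow> sum_list ks = - d)"

text \<open>
  The graded symmetric product, with parity operator \<open>g\<close>: \<open>(\<phi> \<psi>) [v1, \<dots>, vn]\<close> is the sum of
  \<open>\<plusminus> \<phi> vA * \<psi> vB\<close> over all splittings into complementary sublists, with one factor
  \<open>(-1) ^ (\<bar>a\<bar> \<bar>b\<bar>)\<close> for each \<open>a\<close> in \<open>vA\<close> standing before some \<open>b\<close> in \<open>vB\<close> (this combines the
  Koszul sign of the shuffle with that of \<open>(\<phi> \<otimes> \<psi>)(vA \<otimes> vB)\<close>).  In the recursion the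
  first vector goes to \<open>\<phi>\<close> (its even part and its odd part separately) or to \<open>\<psi>\<close>.
\<close>

fun fmult :: "('v::real_vector \<Rightarrow> 'v) \<Rightarrow> 'v fnl \<Rightarrow> 'v fnl \<Rightarrow> 'v fnl" where
  "fmult g \<phi> \<psi> [] = \<phi> [] * \<psi> []"
| "fmult g \<phi> \<psi> (v # vs) =
     fmult g (\<lambda>us. \<phi> ((1/2) *\<^sub>R (v + g v) # us)) \<psi> vs +
     fmult g (\<lambda>us. \<phi> ((1/2) *\<^sub>R (v - g v) # us)) (\<lambda>us. \<psi> (map g us)) vs +
     fmult g \<phi> (\<lambda>us. \<psi> (v # us)) vs"

text \<open>
  The derivation extending \<open>\<phi> \<mapsto> (v \<mapsto> (-1) ^ \<bar>v\<bar> \<phi>(A v))\<close> for an operator \<open>A\<close> of odd degree;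
  the derivation property is \<open>odd_der_fmult\<close> below.
\<close>

definition odd_der :: "('v \<Rightarrow> 'v) \<Rightarrow> ('v \<Rightarrow> 'v) \<Rightarrow> 'v fnl \<Rightarrow> 'v fnl" where
  "odd_der g A \<phi> vs =
     (\<Sum>i<length vs. \<phi> (take i vs @ [A (g (vs ! i))] @ map g (drop (Suc i) vs)))"

definition Qop :: "('m, 'r::finite, 'v) bv \<Rightarrow> 'v fnl \<Rightarrow> 'v fnl" where
  "Qop B \<phi> = odd_der (parity B) (dif B) \<phi>"

definition QGF :: "('m, 'r::finite, 'v) bv \<Rightarrow> 'v fnl \<Rightarrow> 'v fnl" where
  "QGF B \<phi> = (\<lambda>vs. - odd_der (parity B) (gfix B) \<phi> vs)"

definition partial :: "('v \<Rightarrow> 'v) \<Rightarrow> 'v \<Rightarrow> 'v fnl \<Rightarrow> 'v fnl" where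
  "partial g v \<phi> vs = \<phi> (vs @ [g v])"

definition partial2 :: "('m, 'r::finite, 'v) bv \<Rightarrow> 'v tens \<Rightarrow> 'v fnl \<Rightarrow> 'v fnl" where
  "partial2 B P \<phi> vs =
     (1/2) * (\<Sum>i. partial (parity B) (fst (P i)) (partial (parity B) (snd (P i)) \<phi>) vs)"

text \<open>The BV Laplacian with kernel \<open>K\<close>; the scale \<open>L\<close> one has the heat kernel at \<open>L\<close>.\<close>

definition BV_Laplacian :: "('m, 'r::finite, 'v) bv \<Rightarrow> 'v tens \<Rightarrow> 'v fnl \<Rightarrow> 'v fnl" where
  "BV_Laplacian B K \<phi> = (\<lambda>vs. - partial2 B K \<phi> vs)"

text \<open>
  \<open>e ^ (- L D / 2)\<close> on functionals, for the derivation \<open>D\<close> with \<open>D \<phi> = \<phi> \<circ> D\<close> on linear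
  functionals: the algebra automorphism induced by \<open>e ^ (- L D / 2)\<close> on \<open>V\<close>.
\<close>

definition heat_fnl :: "(real \<Rightarrow> 'v \<Rightarrow> 'v) \<Rightarrow> real \<Rightarrow> 'v fnl \<Rightarrow> 'v fnl" where
  "heat_fnl U L \<phi> vs = \<phi> (map (U (L / 2)) vs)"

text \<open>
  Conjugation of the scale \<open>L\<close> BV Laplacian by \<open>e ^ (- L D / 2)\<close>; \<open>Eplus L\<close> stands for the formal
  operator \<open>e ^ (L D / 2)\<close>.
\<close>

definition BV_Laplacian_tilde ::
  "('m, 'r::finite, 'v) bv \<Rightarrow> (real \<Rightarrow> 'v \<Rightarrow> 'v) \<Rightarrow> (real \<Rightarrow> 'v fnl \<Rightarrow> 'v fnl) \<Rightarrow> (real \<Rightarrow> 'v tens)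
     \<Rightarrow> real \<Rightarrow> 'v fnl \<Rightarrow> 'v fnl" where
  "BV_Laplacian_tilde B U Eplus K L \<phi> = heat_fnl U L (BV_Laplacian B (K L) (Eplus L \<phi>))"


section \<open>Formal series in h-bar\<close>

text \<open>
  Power series have coefficients indexed by \<open>nat\<close>; exponentials also contain negative powers and
  are indexed by \<open>int\<close>.
\<close>

definition hmult ::
  "('m, 'r::finite, 'v::real_vector) bv \<Rightarrow> (nat \<Rightarrow> 'v fnl) \<Rightarrow> (nat \<Rightarrow> 'v fnl) \<Rightarrow> nat \<Rightarrow> 'v fnl" where
  "hmult B F G k = (\<lambda>vs. \<Sum>i\<le>k. fmult (parity B) (F i) (G (k - i)) vs)"

primrec hpower ::
  "('m, 'r::finite, 'v::real_vector) bv \<Rightarrow> (nat \<Rightarrow> 'v fnl) \<Rightarrow> nat \<Rightarrow> nat \<Rightarrow> 'v fnl" where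
  "hpower B F 0 = (\<lambda>k vs. if k = 0 \<and> vs = [] then 1 else 0)"
| "hpower B F (Suc n) = hmult B F (hpower B F n)"

text \<open>
  The coefficient of the \<open>k\<close>-th power of h-bar in \<open>exp (S / \<hbar>)\<close>; when \<open>S\<close> has weight at least
  three, only finitely many terms are nonzero in each polynomial degree.
\<close>

definition exp_over_hbar ::
  "('m, 'r::finite, 'v::real_vector) bv \<Rightarrow> (nat \<Rightarrow> 'v fnl) \<Rightarrow> int \<Rightarrow> 'v fnl" where
  "exp_over_hbar B S k vs =
     (\<Sum>n. if 0 \<le> k + int n then hpower B S n (nat (k + int n)) vs / fact n else 0)"

text \<open>\<open>exp (- \<hbar> \<partial>_P)\<close>; on \<open>exp (S / \<hbar>)\<close> the sum is again finite in each polynomial degree.\<close>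

definition exp_contraction ::
  "('m, 'r::finite, 'v) bv \<Rightarrow> 'v tens \<Rightarrow> (int \<Rightarrow> 'v fnl) \<Rightarrow> int \<Rightarrow> 'v fnl" where
  "exp_contraction B P F k vs =
     (\<Sum>j. (-1) ^ j / fact j * (partial2 B P ^^ j) (F (k - int j)) vs)"

definition plus_hbar ::
  "('v fnl \<Rightarrow> 'v fnl) \<Rightarrow> ('v fnl \<Rightarrow> 'v fnl) \<Rightarrow> (int \<Rightarrow> 'v fnl) \<Rightarrow> int \<Rightarrow> 'v fnl" where
  "plus_hbar A C F k = (\<lambda>vs. A (F k) vs + C (F (k - 1)) vs)"

text \<open>
  Elements of \<open>\<F>V\<close> of degree \<open>0\<close> and of weight (polynomial degree plus twice the power of h-bar)
  at least three, so that \<open>S / \<hbar>\<close> has positive weight and its exponential makes sense.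
\<close>

definition interaction ::
  "('m::euclidean_space, 'r::finite, 'v::real_vector) bv \<Rightarrow> (nat \<Rightarrow> 'v fnl) \<Rightarrow> bool" where
  "interaction B S \<longleftrightarrow> (\<forall>k. S k \<in> sym_fnl B \<and> fnl_degree B 0 (S k)) \<and>
     (\<forall>k vs. length vs + 2 * k < 3 \<longrightarrow> S k vs = 0)"

section \<open>The derivation rules\<close>

definition multilinear :: "'v::real_vector fnl \<Rightarrow> bool" where
  "multilinear \<phi> \<longleftrightarrow> (\<forall>xs ys. linear (\<lambda>v. \<phi> (xs @ [v] @ ys)))"

lemma multilinearD:
  assumes "multilinear \<phi>"
  shows "\<phi> (xs @ (u + v) # ys) = \<phi> (xs @ u # ys) + \<phi> (xs @ v # ys)"
    and "\<phi> (xs @ (u - v) # ys) = \<phi> (xs @ u # ys) - \<phi> (xs @ v # ys)"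
    and "\<phi> (xs @ (c *\<^sub>R v) # ys) = c * \<phi> (xs @ v # ys)"
    and "\<phi> (xs @ (- v) # ys) = - \<phi> (xs @ v # ys)"
  using assms linear_add[of "\<lambda>v. \<phi> (xs @ [v] @ ys)" u v]
    linear_diff[of "\<lambda>v. \<phi> (xs @ [v] @ ys)" u v]
    linear_cmul[of "\<lambda>v. \<phi> (xs @ [v] @ ys)" c v]
    linear_neg[of "\<lambda>v. \<phi> (xs @ [v] @ ys)" v]
  unfolding multilinear_def by auto

lemmas multilinear_Cons = multilinearD[where xs = "[]", simplified]

lemma multilinear_tail: "multilinear \<phi> \<Longrightarrow> multilinear (\<lambda>us. \<phi> (v # us))"
  unfolding multilinear_def
proof (intro allI)
  fix xs ys assume "\<forall>xs ys. linear (\<lambda>v. \<phi> (xs @ [v] @ ys))"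
  then have "linear (\<lambda>u. \<phi> ((v # xs) @ [u] @ ys))"
    by blast
  then show "linear (\<lambda>u. \<phi> (v # (xs @ [u] @ ys)))"
    by simp
qed

lemma multilinear_map:
  assumes "multilinear \<phi>" "linear g"
  shows "multilinear (\<lambda>us. \<phi> (map g us))"
  using assms unfolding multilinear_def
  by (auto intro: linear_compose[OF assms(2), unfolded o_def])

lemma odd_der_Nil: "odd_der g A \<phi> [] = 0"
  by (simp add: odd_der_def)

lemma odd_der_Cons:
  "odd_der g A \<phi> (v # vs) = \<phi> (A (g v) # map g vs) + odd_der g A (\<lambda>us. \<phi> (v # us)) vs"
  unfolding odd_der_def by (simp add: sum.lessThan_Suc_shift del: sum.lessThan_Suc)

lemma fmult_add_left:
  "fmult g (\<lambda>us. \<phi> us + \<theta> us) \<psi> vs = fmult g \<phi> \<psi> vs + fmult g \<theta> \<psi> vs"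
proof (induction vs arbitrary: \<phi> \<theta> \<psi>)
  case (Cons v vs)
  show ?case by (simp add: Cons.IH)
qed (simp add: algebra_simps)

lemma fmult_add_right:
  "fmult g \<phi> (\<lambda>us. \<psi> us + \<theta> us) vs = fmult g \<phi> \<psi> vs + fmult g \<phi> \<theta> vs"
proof (induction vs arbitrary: \<phi> \<theta> \<psi>)
  case (Cons v vs)
  show ?case by (simp add: Cons.IH)
qed (simp add: algebra_simps)

lemma fmult_scale_left: "fmult g (\<lambda>us. c * \<phi> us) \<psi> vs = c * fmult g \<phi> \<psi> vs"
proof (induction vs arbitrary: \<phi> \<psi>)
  case (Cons v vs)
  show ?case by (simp add: Cons.IH algebra_simps)
qed (simp add: algebra_simps)

lemma fmult_scale_right: "fmult g \<phi> (\<lambda>us. c * \<psi> us) vs = c * fmult g \<phi> \<psi> vs"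
proof (induction vs arbitrary: \<phi> \<psi>)
  case (Cons v vs)
  show ?case by (simp add: Cons.IH algebra_simps)
qed (simp add: algebra_simps)

lemma fmult_neg_left: "fmult g (\<lambda>us. - \<phi> us) \<psi> vs = - fmult g \<phi> \<psi> vs"
  using fmult_scale_left[of g "-1" \<phi>] by simp

lemma fmult_neg_right: "fmult g \<phi> (\<lambda>us. - \<psi> us) vs = - fmult g \<phi> \<psi> vs"
  using fmult_scale_right[of g \<phi> "-1"] by simp

lemma fmult_diff_left:
  "fmult g (\<lambda>us. \<phi> us - \<theta> us) \<psi> vs = fmult g \<phi> \<psi> vs - fmult g \<theta> \<psi> vs"
  using fmult_add_left[of g \<phi> "\<lambda>us. - \<theta> us"] by (simp add: fmult_neg_left)

lemma fmult_diff_right: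
  "fmult g \<phi> (\<lambda>us. \<psi> us - \<theta> us) vs = fmult g \<phi> \<psi> vs - fmult g \<phi> \<theta> vs"
  using fmult_add_right[of g \<phi> \<psi> "\<lambda>us. - \<theta> us"] by (simp add: fmult_neg_right)

lemma fmult_zero: "fmult g (\<lambda>us. 0) \<psi> vs = 0" "fmult g \<phi> (\<lambda>us. 0) vs = 0"
  using fmult_scale_left[of g 0 "\<lambda>us. 0" \<psi> vs] fmult_scale_right[of g \<phi> 0 "\<lambda>us. 0" vs] by auto

lemma fmult_map:
  assumes "linear g" "\<And>v. g (g v) = v"
  shows "fmult g \<phi> \<psi> (map g vs) = fmult g (\<lambda>us. \<phi> (map g us)) (\<lambda>us. \<psi> (map g us)) vs"
proof (induction vs arbitrary: \<phi> \<psi>)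
  case (Cons v vs)
  have "g ((1/2) *\<^sub>R (v + g v)) = (1/2) *\<^sub>R (g v + g (g v))"
       "g ((1/2) *\<^sub>R (v - g v)) = (1/2) *\<^sub>R (g v - g (g v))"
    using assms by (simp_all add: linear_cmul linear_add linear_diff)
  then show ?case by (simp add: Cons.IH)
qed simp

lemma odd_der_add: "odd_der g A (\<lambda>us. \<phi> us + \<theta> us) vs = odd_der g A \<phi> vs + odd_der g A \<theta> vs"
  by (simp add: odd_der_def sum.distrib)

lemma odd_der_map:
  assumes g: "\<And>v. g (g v) = v" and A: "\<And>v. A (g v) = - g (A v)"
    and \<psi>: "multilinear \<psi>"
  shows "odd_der g A (\<lambda>us. \<psi> (map g us)) vs = - odd_der g A \<psi> (map g vs)"
proof -
  have *: "g (A (g x)) = - A x" for x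
    using A[of "g x"] g by simp
  show ?thesis
    unfolding odd_der_def sum_negf[symmetric]
    by (simp add: take_map drop_map g * multilinearD[OF \<psi>])
qed

text \<open>Here \<open>\<lambda>us. \<phi> (map g us)\<close> is \<open>(-1) ^ \<bar>\<phi>\<bar> \<phi>\<close>.\<close>

lemma odd_der_fmult:
  assumes g: "linear g" "\<And>v. g (g v) = v" and A: "linear A" "\<And>v. A (g v) = - g (A v)"
    and "multilinear \<phi>" "multilinear \<psi>"
  shows "odd_der g A (fmult g \<phi> \<psi>) vs =
         fmult g (odd_der g A \<phi>) \<psi> vs + fmult g (\<lambda>us. \<phi> (map g us)) (odd_der g A \<psi>) vs"
  using assms(5,6)
proof (induction vs arbitrary: \<phi> \<psi>)
  case Nil
  then show ?case by (simp add: odd_der_Nil)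
next
  case (Cons v vs)
  define e where "e = (1/2) *\<^sub>R (v + g v)"
  define o' where "o' = (1/2) *\<^sub>R (v - g v)"
  have ge: "g e = e" and go: "g o' = - o'"
    using g by (simp_all add: e_def o'_def linear_cmul linear_add linear_diff algebra_simps)
  have v: "v = e + o'"
    unfolding e_def o'_def scaleR_right_distrib[symmetric]
    using scaleR_half_double[of v] by simp
  define a where "a = A (g v)"
  have Ae: "A (g e) = A e" "g (A e) = - A e" and Ao: "A (g o') = - A o'" "g (A o') = A o'"
    using A(2)[of e] A(2)[of o'] linear_neg[OF A(1), of o'] unfolding ge go by (metis minus_minus)+
  have a: "a = A e - A o'"
    unfolding a_def using v ge go g(1) A(1) by (simp add: linear_add linear_neg linear_diff)
  have ga: "g a = - A e - A o'"
    unfolding a linear_diff[OF g(1)] Ae Ao ..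
  have "a + g a = - A o' + - A o'" "a - g a = A e + A e"
    unfolding ga unfolding a by simp_all
  then have a1: "(1/2) *\<^sub>R (a + g a) = - A o'" and a2: "(1/2) *\<^sub>R (a - g a) = A e"
    by (simp_all only: scaleR_half_double)
  note ml = Cons.prems
  let ?F = "\<lambda>\<phi> \<psi>. fmult g \<phi> \<psi> vs" and ?d = "odd_der g A"
  let ?g = "\<lambda>\<phi> us. \<phi> (map g us)" and ?i = "\<lambda>v \<phi> us. \<phi> (v # us)"
  have L1: "fmult g \<phi> \<psi> (a # map g vs) =
      - ?F (?g (?i (A o') \<phi>)) (?g \<psi>) + ?F (?g (?i (A e) \<phi>)) \<psi> + ?F (?g \<phi>) (?g (?i a \<psi>))"
    by (simp add: a1 a2 multilinear_Cons[OF ml(1)] fmult_map[OF g] fmult_neg_left g o_def)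
  have L2: "?d (\<lambda>us. fmult g \<phi> \<psi> (v # us)) vs =
      ?F (?d (?i e \<phi>)) \<psi> + ?F (?g (?i e \<phi>)) (?d \<psi>) +
      (?F (?d (?i o' \<phi>)) (?g \<psi>) + ?F (?g (?i o' \<phi>)) (?d (?g \<psi>))) +
      (?F (?d \<phi>) (?i v \<psi>) + ?F (?g \<phi>) (?d (?i v \<psi>)))"
    using Cons.IH[of "?i e \<phi>" \<psi>] Cons.IH[of "?i o' \<phi>" "?g \<psi>"] Cons.IH[of \<phi> "?i v \<psi>"] ml g
    by (simp add: odd_der_add multilinear_tail multilinear_map e_def o'_def)
  have R1: "fmult g (?d \<phi>) \<psi> (v # vs) =
      (?F (?g (?i (A e) \<phi>)) \<psi> + ?F (?d (?i e \<phi>)) \<psi>) +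
      (- ?F (?g (?i (A o') \<phi>)) (?g \<psi>) + ?F (?d (?i o' \<phi>)) (?g \<psi>)) + ?F (?d \<phi>) (?i v \<psi>)"
    by (simp add: odd_der_Cons Ae Ao multilinear_Cons[OF ml(1)] fmult_add_left fmult_diff_left
          fmult_neg_left           flip: e_def o'_def)
  have R2: "fmult g (?g \<phi>) (?d \<psi>) (v # vs) =
      ?F (?g (?i e \<phi>)) (?d \<psi>) + ?F (?g (?i o' \<phi>)) (?d (?g \<psi>)) +
      (?F (?g \<phi>) (?g (?i a \<psi>)) + ?F (?g \<phi>) (?d (?i v \<psi>)))"
    unfolding odd_der_map[of g A, OF g(2) A(2) ml(2)]
    by (simp add: odd_der_Cons ge go multilinear_Cons[OF ml(1)] fmult_add_right fmult_diff_right fmult_neg_left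
          fmult_neg_right flip: e_def o'_def a_def)
  show ?case
    unfolding odd_der_Cons[of g A "fmult g \<phi> \<psi>"] a_def[symmetric] L1 L2 R1 R2 by simp
qed

text \<open>\<open>\<partial>_v\<close> is a derivation of the parity of \<open>v\<close>, even in the first rule and odd in the second.\<close>

lemma partial_even_fmult:
  assumes g: "linear g" "\<And>v. g (g v) = v" and v: "g v = v"
    and "multilinear \<phi>" "multilinear \<psi>"
  shows "partial g v (fmult g \<phi> \<psi>) us =
         fmult g (partial g v \<phi>) \<psi> us + fmult g \<phi> (partial g v \<psi>) us"
  unfolding partial_def v using assms(4,5)
proof (induction us arbitrary: \<phi> \<psi>)
  case Nil
  have "(1/2) *\<^sub>R (v - v) = 0 *\<^sub>R v"
    by simp
  then show ?case
    unfolding append_Nil fmult.simps v scaleR_half_double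
    using multilinear_Cons(3)[OF Nil(1), of 0] by simp
next
  case (Cons u us)
  have t: "multilinear (\<lambda>us. \<phi> ((1/2) *\<^sub>R (u + g u) # us))"
    "multilinear (\<lambda>us. \<phi> ((1/2) *\<^sub>R (u - g u) # us))"
    "multilinear (\<lambda>us. \<psi> (u # us))" "multilinear (\<lambda>us. \<psi> (map g us))"
    using Cons.prems g(1) by (simp_all only: multilinear_tail multilinear_map)
  show ?case
    unfolding append_Cons fmult.simps
    unfolding Cons.IH[OF t(1) Cons.prems(2)] Cons.IH[OF t(2) t(4)] Cons.IH[OF Cons.prems(1) t(3)]
    unfolding list.map map_append v by simp
qed

lemma partial_odd_fmult:
  assumes g: "linear g" "\<And>v. g (g v) = v" and v: "g v = - v"
    and "multilinear \<phi>" "multilinear \<psi>"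
  shows "partial g v (fmult g \<phi> \<psi>) us =
         fmult g (partial g v \<phi>) \<psi> us + fmult g (\<lambda>us. \<phi> (map g us)) (partial g v \<psi>) us"
  unfolding partial_def using assms(4,5)
proof (induction us arbitrary: \<phi> \<psi>)
  case Nil
  have w: "g v = - v" "g (- v) = - (- v)"
    using g(2)[of v] unfolding v by simp_all
  have w': "(1/2) *\<^sub>R (- v + - (- v)) = 0 *\<^sub>R v" "(1/2) *\<^sub>R (- v - - (- v)) = - v"
    using scaleR_half_double[of "- v"] by (simp_all only: diff_conv_add_uminus minus_minus) simp
  show ?case
    unfolding append_Nil w(1) fmult.simps w(2) w'
    using multilinear_Cons(3)[OF Nil(1), of 0] by simp
next
  case (Cons u us)
  define e where "e = (1/2) *\<^sub>R (u + g u)"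
  define o' where "o' = (1/2) *\<^sub>R (u - g u)"
  have ge: "g e = e" and go: "g o' = - o'"
    using g by (simp_all add: e_def o'_def linear_cmul linear_add linear_diff algebra_simps)
  have IH: "fmult g \<phi>' \<psi>' (us @ [- v]) =
      fmult g (\<lambda>us. \<phi>' (us @ [- v])) \<psi>' us + fmult g (\<lambda>us. \<phi>' (map g us)) (\<lambda>us. \<psi>' (us @ [- v])) us"
    if "multilinear \<phi>'" "multilinear \<psi>'" for \<phi>' \<psi>'
    using Cons.IH[OF that] v by simp
  have gv: "g (- v) = v"
    using g(2)[of v] v by simp
  note ml = multilinear_Cons(4)[OF Cons.prems(1)] multilinearD(4)[OF Cons.prems(2)]
  have t: "multilinear (\<lambda>us. \<phi> (e # us))" "multilinear (\<lambda>us. \<phi> (o' # us))"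
    "multilinear (\<lambda>us. \<psi> (u # us))" "multilinear (\<lambda>us. \<psi> (map g us))"
    using Cons.prems g(1) by (simp_all add: multilinear_tail multilinear_map)
  show ?case
    unfolding append_Cons fmult.simps v e_def[symmetric] o'_def[symmetric]
    unfolding IH[OF t(1) Cons.prems(2)] IH[OF t(2) t(4)] IH[OF Cons.prems(1) t(3)]
    unfolding list.map map_append gv v ge go
    by (simp add: ml multilinearD(4)[OF Cons.prems(2)] fmult_neg_left fmult_neg_right
        del: fmult.simps)
qed

lemma parity_homog:
  assumes "section_space B" "v \<in> homog B k"
  shows "parity B v = (-1) powi k *\<^sub>R v"
proof -
  have "(\<lambda>x. \<chi> i. (-1) powi gdeg B i * sect B v x $ i) = sect B ((-1) powi k *\<^sub>R v)"
    using assms by (auto simp: section_space_def homog_def vec_eq_iff fun_eq_iff)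
  then have "parity B v = inv (sect B) (sect B ((-1) powi k *\<^sub>R v))"
    by (simp add: parity_def)
  then show ?thesis
    using assms(1) unfolding section_space_def by (metis inv_f_f)
qed

lemma on_linear_functionals:
  assumes B: "section_space B" and q: "has_degree B 1 (dif B)" "linear (dif B)"
    and qgf: "has_degree B (-1) (gfix B)" "linear (gfix B)"
    and \<phi>: "multilinear \<phi>" and v: "v \<in> homog B k"
  shows "fnl_degree B d \<phi> \<Longrightarrow> Qop B \<phi> [v] = - ((-1) powi d) * \<phi> [dif B v]"
    and "fnl_degree B d \<phi> \<Longrightarrow> QGF B \<phi> [v] = (-1) powi d * \<phi> [gfix B v]"
    and "partial (parity B) v \<phi> [] = (-1) powi k * \<phi> [v]"
proof -
  note p = parity_homog[OF B v] and ml = multilinear_Cons(3)[OF \<phi>]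
  have Q: "Qop B \<phi> [v] = (-1) powi k * \<phi> [dif B v]"
    and G: "QGF B \<phi> [v] = - ((-1) powi k) * \<phi> [gfix B v]"
    using q(2) qgf(2) by (simp_all add: Qop_def QGF_def odd_der_def p ml linear_cmul)
  have dv: "dif B v \<in> homog B (k + 1)" "gfix B v \<in> homog B (k + - 1)"
    using q(1) qgf(1) v unfolding has_degree_def by blast+
  show "partial (parity B) v \<phi> [] = (-1) powi k * \<phi> [v]"
    by (simp add: partial_def p ml)
  assume d: "fnl_degree B d \<phi>"
  have *: "w \<in> homog B l \<Longrightarrow> \<phi> [w] \<noteq> 0 \<Longrightarrow> l = - d" for w l
    using d[unfolded fnl_degree_def, rule_format, of "[w]" "[l]"] by simp
  have s: "(-1) powi (- d - 1) = - ((-1) powi d :: real)" "(-1) powi (- d + 1) = - ((-1) powi d :: real)"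
    by (simp_all add: power_int_minus_left)
  show "Qop B \<phi> [v] = - ((-1) powi d) * \<phi> [dif B v]"
    using *[OF dv(1)] s unfolding Q by (cases "\<phi> [dif B v] = 0") (auto simp: eq_diff_eq[symmetric])
  show "QGF B \<phi> [v] = (-1) powi d * \<phi> [gfix B v]"
    using *[OF dv(2)] s unfolding G by (cases "\<phi> [gfix B v] = 0") (auto simp: diff_eq_eq)
qed

end

theory Submission
  imports Defs
begin

text \<open>
  By the renormalization group equation the \<open>L\<close>-derivative of \<open>e ^ (S / \<hbar>)\<close> is
  \<open>- \<hbar> \<partial>\<^sub>R e ^ (S / \<hbar>)\<close> with \<open>R = (gfix \<otimes> 1) (K L)\<close>, and conjugation with the half-time heat flow
  adds \<open>- (1 / 2) D\<close>.  As \<open>D = [Q, QGF]\<close> and \<open>2 \<partial>\<^sub>R = [\<Delta>, QGF]\<close>, the derivative of the conjugated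
  exponential is \<open>- (1 / 2) [Q + \<hbar> \<Delta>, QGF]\<close> applied to it, and the quantum master equation kills one
  of the two terms of the commutator.

  The commutator with \<open>\<Delta>\<close> needs that the heat kernel is odd, and the \<open>L\<close>-independence of the
  conjugated Laplacian needs \<open>(U t \<otimes> U t) (K L) = K (L + 2 t)\<close>.  Both follow from the uniqueness of
  heat kernels, because the heat flow commutes with the parity operator and is self-adjoint.
\<close>

section \<open>Seminorms on sections\<close>

text \<open>Three obstacles shape the proof. Signs: degrees exist only for homogeneous sections,
  whereas the series that present tensors have inhomogeneous entries. All Koszul rules are therefore
  rewritten with the parity operator so that they hold for arbitrary vectors; they are checked on
  homogeneous ones and extended by linearity. Derivative: the conjugated exponential is evaluated at
  sections \<open>U (l / 2) v\<close>, so functional and arguments move together with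
  \<open>l\<close>. The product rule then needs error bounds uniform in the arguments, by one
  product of seminorms in each polynomial degree; this dictates the form of
  \<open>tensor_deriv\<close> and \<open>fnl_deriv\<close>. Sums: weight at least three makes the
  coefficient of \<open>\<hbar> ^ k\<close> vanish in polynomial degree d when d + 3 k < 0, so the
  contraction series is one finite sum for all \<open>l\<close> and can be differentiated termwise.
  The formal inverse \<open>Eplus\<close> is evaluated only on functionals
  \<open>heat_fnl U L \<phi>\<close> with symmetric \<phi>; the right-hand side has this form
  because \<open>QGF\<close> commutes with the flow.\<close>

lemma iter_deriv_bounded_linear:
  assumes G: "bounded_linear G" and f: "smooth f"
  shows "iter_deriv es (\<lambda>x. G (f x)) = (\<lambda>x. G (iter_deriv es f x))"
proof (induction es)
  case (Cons e es)
  have "frechet_derivative (\<lambda>x. G (iter_deriv es f x)) (at x) e =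
      G (frechet_derivative (iter_deriv es f) (at x) e)" for x
  proof -
    have "(iter_deriv es f has_derivative frechet_derivative (iter_deriv es f) (at x)) (at x)"
      using f unfolding smooth_def by (simp flip: frechet_derivative_works)
    from frechet_derivative_at[OF bounded_linear.has_derivative[OF G this]]
    show ?thesis by metis
  qed
  then show ?case by (simp add: Cons)
qed simp

lemma smooth_bounded_linear:
  assumes "bounded_linear G" "smooth f"
  shows "smooth (\<lambda>x. G (f x))"
  unfolding smooth_def iter_deriv_bounded_linear[OF assms]
  using assms unfolding smooth_def differentiable_def
  by (blast intro: bounded_linear.has_derivative)

lemma iter_deriv_add:
  assumes f: "smooth f" and h: "smooth h"
  shows "iter_deriv es (\<lambda>x. f x + h x) = (\<lambda>x. iter_deriv es f x + iter_deriv es h x)"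
proof (induction es)
  case (Cons e es)
  have "frechet_derivative (\<lambda>x. iter_deriv es f x + iter_deriv es h x) (at x) e =
      frechet_derivative (iter_deriv es f) (at x) e + frechet_derivative (iter_deriv es h) (at x) e"
    for x
  proof -
    have "(iter_deriv es f has_derivative frechet_derivative (iter_deriv es f) (at x)) (at x)"
         "(iter_deriv es h has_derivative frechet_derivative (iter_deriv es h) (at x)) (at x)"
      using f h unfolding smooth_def by (simp_all flip: frechet_derivative_works)
    from frechet_derivative_at[OF has_derivative_add[OF this]]
    show ?thesis by metis
  qed
  then show ?case by (simp add: Cons)
qed simp

lemma smooth_add:
  assumes "smooth f" "smooth h"
  shows "smooth (\<lambda>x. f x + h x)"
  using assms unfolding smooth_def iter_deriv_add[OF assms] by simp

lemma schwartz_bounded_linear: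
  assumes G: "bounded_linear G" and f: "schwartz f"
  shows "schwartz (\<lambda>x. G (f x))"
proof -
  have s: "smooth f" using f by (simp add: schwartz_def)
  have "bounded (range (\<lambda>x. (1 + norm x) ^ k *\<^sub>R G (iter_deriv es f x)))" for k es
  proof -
    have "bounded (G ` range (\<lambda>x. (1 + norm x) ^ k *\<^sub>R iter_deriv es f x))"
      using f by (intro bounded_linear_image[OF _ G]) (simp add: schwartz_def)
    then show ?thesis
      by (simp add: image_image linear_cmul[OF bounded_linear.linear[OF G]])
  qed
  then show ?thesis
    using smooth_bounded_linear[OF G s] by (simp add: schwartz_def iter_deriv_bounded_linear[OF G s])
qed

lemma schwartz_add:
  assumes f: "schwartz f" and h: "schwartz h"
  shows "schwartz (\<lambda>x. f x + h x)"
proof -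
  have s: "smooth f" "smooth h" using f h by (simp_all add: schwartz_def)
  have "bounded (range (\<lambda>x. (1 + norm x) ^ k *\<^sub>R (iter_deriv es f x + iter_deriv es h x)))" for k es
    using f h unfolding scaleR_add_right
    by (intro bounded_plus_comp) (auto simp: schwartz_def)
  then show ?thesis
    using smooth_add[OF s] by (simp add: schwartz_def iter_deriv_add[OF s])
qed

text \<open>The index pairs of the supremum in \<open>schwartz_norm\<close>, packed into one set
  that grows with \<open>m\<close>.\<close>

definition schwartz_index :: "nat \<Rightarrow> ('m::euclidean_space list \<times> 'm) set" where
  "schwartz_index m = {es. set es \<subseteq> Basis \<and> length es \<le> m} \<times> UNIV"

lemma schwartz_norm_eq:
  "schwartz_norm m f = (SUP p\<in>schwartz_index m. (1 + norm (snd p)) ^ m * norm (iter_deriv (fst p) f (snd p)))"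
  by (simp add: schwartz_norm_def schwartz_index_def case_prod_beta)

lemma schwartz_index_mono: "m \<le> n \<Longrightarrow> schwartz_index m \<subseteq> schwartz_index n"
  by (auto simp: schwartz_index_def)

lemma schwartz_index_nonempty: "schwartz_index m \<noteq> {}"
  unfolding schwartz_index_def by (auto intro: exI[of _ "[]"])

text \<open>Only basis directions and at most \<open>m\<close> of them are allowed, so finitely many
  derivatives occur and the sum of their individual bounds works. This is what makes the supremum a
  genuine upper bound in all later estimates.\<close>

lemma schwartz_norm_bdd:
  fixes f :: "'m::euclidean_space \<Rightarrow> 'b::real_normed_vector"
  assumes f: "schwartz f"
  shows "bdd_above ((\<lambda>p. (1 + norm (snd p)) ^ m * norm (iter_deriv (fst p) f (snd p))) ` schwartz_index m)"
proof -
  let ?S = "{es :: 'm list. set es \<subseteq> Basis \<and> length es \<le> m}"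
  have "\<exists>C. \<forall>x. (1 + norm x) ^ m * norm (iter_deriv es f x) \<le> C" for es
  proof -
    have "bounded (range (\<lambda>x. (1 + norm x) ^ m *\<^sub>R iter_deriv es f x))"
      using f by (auto simp: schwartz_def)
    then show ?thesis by (auto simp: bounded_iff)
  qed
  then obtain C where C: "\<And>es x. (1 + norm x) ^ m * norm (iter_deriv es f x) \<le> C es"
    by metis
  have fin: "finite ?S"
    using finite_lists_length_le[OF finite_Basis] .
  have "(1 + norm x) ^ m * norm (iter_deriv es f x) \<le> (\<Sum>es\<in>?S. \<bar>C es\<bar>)" if "es \<in> ?S" for es x
    using member_le_sum[OF that, of "\<lambda>es. \<bar>C es\<bar>"] fin C[of x es] by force
  then show ?thesis
    by (intro bdd_aboveI2[where M = "\<Sum>es\<in>?S. \<bar>C es\<bar>"]) (auto simp: schwartz_index_def)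
qed

lemma schwartz_norm_upper:
  fixes f :: "'m::euclidean_space \<Rightarrow> 'b::real_normed_vector"
  assumes "schwartz f" "p \<in> schwartz_index m"
  shows "(1 + norm (snd p)) ^ m * norm (iter_deriv (fst p) f (snd p)) \<le> schwartz_norm m f"
  unfolding schwartz_norm_eq by (intro cSUP_upper schwartz_norm_bdd assms)

lemma schwartz_norm_leI:
  fixes f :: "'m::euclidean_space \<Rightarrow> 'b::real_normed_vector"
  assumes "\<And>p :: 'm list \<times> 'm. p \<in> schwartz_index m \<Longrightarrow>
    (1 + norm (snd p)) ^ m * norm (iter_deriv (fst p) f (snd p)) \<le> C"
  shows "schwartz_norm m f \<le> C"
  unfolding schwartz_norm_eq by (intro cSUP_least schwartz_index_nonempty assms)

lemma schwartz_norm_nonneg: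
  fixes f :: "'m::euclidean_space \<Rightarrow> 'b::real_normed_vector"
  assumes "schwartz f"
  shows "0 \<le> schwartz_norm m f"
proof -
  obtain p :: "'m list \<times> 'm" where "p \<in> schwartz_index m"
    using schwartz_index_nonempty by blast
  have "0 \<le> (1 + norm (snd p)) ^ m * norm (iter_deriv (fst p) f (snd p))"
    by simp
  also have "\<dots> \<le> schwartz_norm m f"
    by (intro schwartz_norm_upper assms) fact
  finally show ?thesis .
qed

lemma schwartz_norm_mono:
  fixes f :: "'m::euclidean_space \<Rightarrow> 'b::real_normed_vector"
  assumes "schwartz f" "m \<le> n"
  shows "schwartz_norm m f \<le> schwartz_norm n f"
proof (rule schwartz_norm_leI)
  fix p :: "'m list \<times> 'm" assume p: "p \<in> schwartz_index m"
  have "(1 + norm (snd p)) ^ m * norm (iter_deriv (fst p) f (snd p)) \<le>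
      (1 + norm (snd p)) ^ n * norm (iter_deriv (fst p) f (snd p))"
    using assms(2) by (intro mult_right_mono power_increasing) auto
  also have "\<dots> \<le> schwartz_norm n f"
    using schwartz_index_mono[OF assms(2)] p by (intro schwartz_norm_upper assms(1)) blast
  finally show "(1 + norm (snd p)) ^ m * norm (iter_deriv (fst p) f (snd p)) \<le> schwartz_norm n f" .
qed

lemma schwartz_norm_add:
  fixes f :: "'m::euclidean_space \<Rightarrow> 'b::real_normed_vector"
  assumes f: "schwartz f" and h: "schwartz h"
  shows "schwartz_norm m (\<lambda>x. f x + h x) \<le> schwartz_norm m f + schwartz_norm m h"
proof (rule schwartz_norm_leI)
  fix p :: "'m list \<times> 'm" assume p: "p \<in> schwartz_index m"
  have s: "smooth f" "smooth h" using f h by (simp_all add: schwartz_def)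
  have "(1 + norm (snd p)) ^ m * norm (iter_deriv (fst p) f (snd p) + iter_deriv (fst p) h (snd p)) \<le>
    (1 + norm (snd p)) ^ m * (norm (iter_deriv (fst p) f (snd p)) + norm (iter_deriv (fst p) h (snd p)))"
    by (intro mult_left_mono norm_triangle_ineq) simp
  also have "\<dots> \<le> schwartz_norm m f + schwartz_norm m h"
    using schwartz_norm_upper[OF f p] schwartz_norm_upper[OF h p] by (simp add: distrib_left)
  finally show "(1 + norm (snd p)) ^ m * norm (iter_deriv (fst p) (\<lambda>x. f x + h x) (snd p)) \<le>
    schwartz_norm m f + schwartz_norm m h"
    by (simp add: iter_deriv_add[OF s])
qed

lemma schwartz_norm_bounded_linear:
  fixes f :: "'m::euclidean_space \<Rightarrow> 'b::real_normed_vector"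
  assumes G: "bounded_linear G" "\<And>x. norm (G x) \<le> c * norm x" and f: "schwartz f"
    and c: "0 \<le> c"
  shows "schwartz_norm m (\<lambda>x. G (f x)) \<le> c * schwartz_norm m f"
proof (rule schwartz_norm_leI)
  fix p :: "'m list \<times> 'm" assume p: "p \<in> schwartz_index m"
  have s: "smooth f" using f by (simp add: schwartz_def)
  have "(1 + norm (snd p)) ^ m * norm (G (iter_deriv (fst p) f (snd p))) \<le>
      (1 + norm (snd p)) ^ m * (c * norm (iter_deriv (fst p) f (snd p)))"
    by (intro mult_left_mono G) simp
  also have "\<dots> \<le> c * schwartz_norm m f"
    using mult_left_mono[OF schwartz_norm_upper[OF f p] c] by (simp add: mult_ac)
  finally show "(1 + norm (snd p)) ^ m * norm (iter_deriv (fst p) (\<lambda>x. G (f x)) (snd p)) \<le>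
      c * schwartz_norm m f"
    by (simp add: iter_deriv_bounded_linear[OF G(1) s])
qed

section \<open>The Frechet space of sections, its grading and its parity operator\<close>

locale graded_sections =
  fixes B :: "('m::euclidean_space, 'r::finite, 'v::real_vector) bv"
  assumes graded_bundle: "graded_bundle B" and section_space: "section_space B"
begin

lemma sect_add: "sect B (u + v) = (\<lambda>x. sect B u x + sect B v x)"
  and sect_scaleR: "sect B (c *\<^sub>R v) = (\<lambda>x. c *\<^sub>R sect B v x)"
  and sect_inj: "sect B u = sect B v \<longleftrightarrow> u = v"
  and range_sect: "range (sect B) = section_set B"
proof -
  note s = section_space[unfolded section_space_def]
  note s2 = s[THEN conjunct2] and s3 = s[THEN conjunct2, THEN conjunct2]
  show "sect B (u + v) = (\<lambda>x. sect B u x + sect B v x)"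
    by (rule s[THEN conjunct1, rule_format])
  show "sect B (c *\<^sub>R v) = (\<lambda>x. c *\<^sub>R sect B v x)"
    by (rule s2[THEN conjunct1, rule_format])
  show "sect B u = sect B v \<longleftrightarrow> u = v"
    by (rule inj_eq[OF s3[THEN conjunct1]])
  show "range (sect B) = section_set B"
    by (rule s3[THEN conjunct2])
qed

lemma sect_inv: "s \<in> section_set B \<Longrightarrow> sect B (inv (sect B) s) = s"
  using range_sect by (simp add: f_inv_into_f)

lemma section_extension: "\<exists>f. schwartz f \<and> (\<forall>x\<in>base B. f x = sect B v x)"
proof -
  have "sect B v \<in> section_set B"
    using range_sect by blast
  then show ?thesis
    unfolding section_set_def by (smt (verit, best) mem_Collect_eq)
qed

abbreviation "extension_norms m v \<equiv>
  {schwartz_norm m f | f. schwartz f \<and> (\<forall>x\<in>base B. f x = sect B v x)}"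

lemma extension_norms_nonempty: "extension_norms m v \<noteq> {}"
  using section_extension[of v] by blast

lemma extension_norms_bdd: "bdd_below (extension_norms m v)"
  by (rule bdd_belowI[of _ 0]) (auto intro: schwartz_norm_nonneg)

lemma sn_lower:
  assumes "schwartz f" "\<And>x. x \<in> base B \<Longrightarrow> f x = sect B v x"
  shows "sn B m v \<le> schwartz_norm m f"
  unfolding sn_def using assms by (intro cInf_lower extension_norms_bdd) blast

lemma sn_greatest:
  assumes "\<And>f. schwartz f \<Longrightarrow> (\<And>x. x \<in> base B \<Longrightarrow> f x = sect B v x) \<Longrightarrow> C \<le> schwartz_norm m f"
  shows "C \<le> sn B m v"
  unfolding sn_def using assms by (intro cInf_greatest extension_norms_nonempty) blast

lemma sn_nonneg [simp]: "0 \<le> sn B m v"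
  by (intro sn_greatest schwartz_norm_nonneg)

lemma sn_mono: "m \<le> n \<Longrightarrow> sn B m v \<le> sn B n v"
  by (intro sn_greatest order.trans[OF sn_lower schwartz_norm_mono])

text \<open>Both seminorms on the right are infima over extensions; they are treated one after the
  other by moving the remaining terms to the left-hand side.\<close>

lemma sn_triangle: "sn B m (u + v) \<le> sn B m u + sn B m v"
proof -
  have "sn B m (u + v) - sn B m v \<le> sn B m u"
  proof (rule sn_greatest)
    fix f assume f: "schwartz f" "\<And>x. x \<in> base B \<Longrightarrow> f x = sect B u x"
    have "sn B m (u + v) - schwartz_norm m f \<le> sn B m v"
    proof (rule sn_greatest)
      fix h assume h: "schwartz h" "\<And>x. x \<in> base B \<Longrightarrow> h x = sect B v x"
      have "sn B m (u + v) \<le> schwartz_norm m (\<lambda>x. f x + h x)"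
        using f(2) h(2) by (intro sn_lower schwartz_add[OF f(1) h(1)]) (auto simp: sect_add)
      then show "sn B m (u + v) - schwartz_norm m f \<le> schwartz_norm m h"
        using schwartz_norm_add[OF f(1) h(1), of m] by linarith
    qed
    then show "sn B m (u + v) - sn B m v \<le> schwartz_norm m f"
      by linarith
  qed
  then show ?thesis by linarith
qed

lemma sn_bounded_linear:
  assumes G: "bounded_linear G" "\<And>x. norm (G x) \<le> c * norm x" and c: "0 \<le> c"
    and u: "\<And>x. x \<in> base B \<Longrightarrow> sect B u x = G (sect B v x)"
  shows "sn B m u \<le> c * sn B m v"
proof (cases "c = 0")
  case False
  then have c': "c > 0" using c by simp
  \<comment> \<open>Dividing by \<open>c\<close> makes this a lower bound over all extensions of
    \<open>v\<close>. For \<open>c = 0\<close> a single extension is enough, since its image then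
    has norm at most zero.\<close>
  have "sn B m u / c \<le> sn B m v"
  proof (rule sn_greatest)
    fix f assume f: "schwartz f" "\<And>x. x \<in> base B \<Longrightarrow> f x = sect B v x"
    have "sn B m u \<le> schwartz_norm m (\<lambda>x. G (f x))"
      using f(2) u by (intro sn_lower schwartz_bounded_linear[OF G(1) f(1)]) auto
    also have "\<dots> \<le> c * schwartz_norm m f"
      by (intro schwartz_norm_bounded_linear G f(1) c)
    finally show "sn B m u / c \<le> schwartz_norm m f"
      using c' by (simp add: field_simps)
  qed
  then show ?thesis using c' by (simp add: field_simps)
next
  case True
  obtain f where f: "schwartz f" "\<And>x. x \<in> base B \<Longrightarrow> f x = sect B v x"
    using section_extension[of v] by blast
  have "sn B m u \<le> schwartz_norm m (\<lambda>x. G (f x))"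
    using f(2) u by (intro sn_lower schwartz_bounded_linear[OF G(1) f(1)]) auto
  also have "\<dots> \<le> c * schwartz_norm m f"
    by (intro schwartz_norm_bounded_linear G f(1) c)
  finally show ?thesis
    using True by simp
qed

lemma sn_scaleR_le: "sn B m (c *\<^sub>R v) \<le> \<bar>c\<bar> * sn B m v"
  by (rule sn_bounded_linear[of "\<lambda>x. c *\<^sub>R x"])
     (auto simp: sect_scaleR intro: bounded_linear_scaleR_right)

lemma sn_0 [simp]: "sn B m 0 = 0"
  using sn_scaleR_le[of m 0 0] sn_nonneg[of m 0] by simp

lemma sn_scaleR: "sn B m (c *\<^sub>R v) = \<bar>c\<bar> * sn B m v"
proof (cases "c = 0")
  case False
  have "sn B m v \<le> \<bar>inverse c\<bar> * sn B m (c *\<^sub>R v)"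
    using sn_scaleR_le[of m "inverse c" "c *\<^sub>R v"] False by simp
  then have "\<bar>c\<bar> * sn B m v \<le> sn B m (c *\<^sub>R v)"
    using False by (simp add: field_simps)
  then show ?thesis
    using sn_scaleR_le[of m c v] by simp
qed simp

lemma sn_minus [simp]: "sn B m (- v) = sn B m v"
  using sn_scaleR[of m "-1" v] by simp

lemma sn_triangle_diff: "sn B m (u - v) \<le> sn B m u + sn B m v"
  using sn_triangle[of m u "- v"] by simp

text \<open>The bundle is a graded subbundle, so a coordinatewise rescaling by a function of the degree
  preserves it.\<close>

lemma section_degree_rescale:
  fixes c :: "int \<Rightarrow> real"
  shows "(\<lambda>x. \<chi> i. c (gdeg B i) * sect B v x $ i) \<in> section_set B"
    and "bounded_linear (\<lambda>y. \<chi> i. c (gdeg B i) * y $ i :: real ^ 'r)"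
proof -
  let ?G = "\<lambda>y. \<chi> i. c (gdeg B i) * y $ i :: real ^ 'r"
  have "linear ?G"
    by (rule linearI) (auto simp: vec_eq_iff algebra_simps)
  then show G: "bounded_linear ?G"
    by (simp add: linear_conv_bounded_linear)
  have "sect B v \<in> section_set B"
    using range_sect by blast
  then obtain f where f: "schwartz f" "\<And>x. x \<in> base B \<Longrightarrow> sect B v x = f x \<and> bproj B x *v f x = f x"
    "\<And>x. x \<notin> base B \<Longrightarrow> sect B v x = 0"
    unfolding section_set_def by blast
  have "bproj B x *v ?G (f x) = ?G (f x)" if x: "x \<in> base B" for x
  proof -
    have *: "gdeg B i \<noteq> gdeg B j \<Longrightarrow> bproj B x $ i $ j = 0" for i j
      using graded_bundle x unfolding graded_bundle_def by blast
    have "(bproj B x *v ?G y) $ i = ?G (bproj B x *v y) $ i" for y i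
      unfolding matrix_vector_mult_def using *[of i]
      by (auto simp: sum_distrib_left intro!: sum.cong) (metis mult.commute mult_zero_right)
    then show ?thesis
      using f(2)[OF x] by (simp add: vec_eq_iff)
  qed
  then show "(\<lambda>x. ?G (sect B v x)) \<in> section_set B"
    unfolding section_set_def using f schwartz_bounded_linear[OF G f(1)]
    by (auto simp: vec_eq_iff intro!: exI[of _ "\<lambda>x. ?G (f x)"])
qed

lemma sect_parity: "sect B (parity B v) x = (\<chi> i. (-1) powi gdeg B i * sect B v x $ i)"
  unfolding parity_def using section_degree_rescale(1)[of "\<lambda>k. (-1) powi k"]
  by (subst sect_inv) auto

lemma sect_hcomp: "sect B (hcomp B k v) x = (\<chi> i. if gdeg B i = k then sect B v x $ i else 0)"
proof -
  have "(\<lambda>x. \<chi> i. if gdeg B i = k then sect B v x $ i else 0) =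
      (\<lambda>x. \<chi> i. (if gdeg B i = k then 1 else 0) * sect B v x $ i)"
    by (auto simp: vec_eq_iff fun_eq_iff)
  then show ?thesis
    unfolding hcomp_def using section_degree_rescale(1)[of "\<lambda>l. if l = k then 1 else 0"]
    by (subst sect_inv) auto
qed

lemma parity_linear: "linear (parity B)"
  by (rule linearI; subst sect_inj[symmetric])
     (auto simp: sect_parity sect_add sect_scaleR vec_eq_iff fun_eq_iff algebra_simps)

lemma parity_parity [simp]: "parity B (parity B v) = v"
proof -
  have "(-1) powi k * ((-1) powi k * y) = (y :: real)" for k y
    by (simp add: power_int_minus_left)
  then show ?thesis
    by (subst sect_inj[symmetric]) (auto simp: sect_parity vec_eq_iff fun_eq_iff)
qed

lemma sn_parity_le: "sn B m (parity B v) \<le> sn B m v"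
proof -
  let ?G = "\<lambda>y. \<chi> i. (-1) powi gdeg B i * y $ i :: real ^ 'r"
  have "norm (?G y) \<le> 1 * norm y" for y
    by (simp add: norm_vec_def abs_mult power_int_abs)
  from sn_bounded_linear[OF section_degree_rescale(2)[of "\<lambda>k. (-1) powi k"] this, of "parity B v" v m]
  show ?thesis by (simp add: sect_parity)
qed

lemma sn_parity [simp]: "sn B m (parity B v) = sn B m v"
  using sn_parity_le[of m v] sn_parity_le[of m "parity B v"] by simp

lemma hcomp_homog: "hcomp B k v \<in> homog B k"
  by (auto simp: homog_def sect_hcomp)

lemma sect_sum: "sect B (\<Sum>k\<in>I. f k) x = (\<Sum>k\<in>I. sect B (f k) x)"
proof -
  have "linear (\<lambda>v. sect B v x)"
    by (rule linearI) (simp_all add: sect_add sect_scaleR)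
  from linear_sum[OF this] show ?thesis .
qed

lemma hcomp_sum: "(\<Sum>k\<in>range (gdeg B). hcomp B k v) = v"
  by (subst sect_inj[symmetric]) (auto simp: sect_sum sect_hcomp vec_eq_iff fun_eq_iff)

text \<open>Only finitely many degrees occur, so every section is a finite sum of homogeneous ones.
  This turns sign rules for homogeneous vectors into identities with the parity operator on the
  whole space.\<close>

lemma linear_homog_eqI:
  assumes "linear f" "linear h" "\<And>k v. v \<in> homog B k \<Longrightarrow> f v = h v"
  shows "f v = h v"
proof -
  have "f (\<Sum>k\<in>range (gdeg B). hcomp B k v) = h (\<Sum>k\<in>range (gdeg B). hcomp B k v)"
    unfolding linear_sum[OF assms(1)] linear_sum[OF assms(2)]
    using assms(3) hcomp_homog by (intro sum.cong) auto
  then show ?thesis by (simp add: hcomp_sum)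
qed

lemma bilinear_homog_eqI:
  assumes f: "bilinear f" and h: "bilinear h"
    and eq: "\<And>k l v w. v \<in> homog B k \<Longrightarrow> w \<in> homog B l \<Longrightarrow> f v w = h v w"
  shows "f v w = h v w"
proof -
  have lin: "linear (f v)" "linear (h v)" "linear (\<lambda>v. f v w)" "linear (\<lambda>v. h v w)" for v w
    using f h unfolding bilinear_def by auto
  have "f v w = h v w" if v: "v \<in> homog B k" for k v w
    by (rule linear_homog_eqI[OF lin(1,2) eq[OF v]])
  then show ?thesis
    by (rule linear_homog_eqI[OF lin(3,4)])
qed

lemma parity_homog': "v \<in> homog B k \<Longrightarrow> parity B v = (-1) powi k *\<^sub>R v"
  by (rule parity_homog[OF section_space])

lemma odd_degree_parity:
  assumes A: "linear A" "has_degree B d A" and d: "odd d"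
  shows "A (parity B v) = - parity B (A v)"
proof (rule linear_homog_eqI[of "\<lambda>v. A (parity B v)" "\<lambda>v. - parity B (A v)"])
  show "linear (\<lambda>v. A (parity B v))" "linear (\<lambda>v. - parity B (A v))"
    using linear_compose[OF parity_linear A(1)] linear_compose[OF A(1) parity_linear]
    by (auto simp: o_def intro: linear_compose_neg)
  fix k v assume v: "v \<in> homog B k"
  then have "A v \<in> homog B (k + d)"
    using A(2) unfolding has_degree_def by blast
  moreover have "(-1) powi (k + d) = - ((-1) powi k :: real)"
    using d by (simp add: power_int_minus_left)
  ultimately show "A (parity B v) = - parity B (A v)"
    using v by (simp add: parity_homog' linear_cmul[OF A(1)])
qed

text \<open>The constant in \<open>cont_linear\<close> may be negative; its absolute value works as
  well and can be multiplied into further estimates.\<close>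

lemma cont_linearE:
  assumes "cont_linear B A"
  obtains n C where "0 \<le> C" "\<And>v. sn B m (A v) \<le> C * sn B n v"
proof -
  obtain n C where C: "\<And>v. sn B m (A v) \<le> C * sn B n v"
    using assms unfolding cont_linear_def by blast
  have "sn B m (A v) \<le> \<bar>C\<bar> * sn B n v" for v
    using C[of v] mult_right_mono[OF abs_ge_self[of C] sn_nonneg[of n v]] by linarith
  then show ?thesis
    using that[of "\<bar>C\<bar>" n] by simp
qed

lemma cont_linear_linear: "cont_linear B A \<Longrightarrow> linear A"
  by (simp add: cont_linear_def)

lemma cont_linear_compose:
  assumes A: "cont_linear B A" and C: "cont_linear B C"
  shows "cont_linear B (\<lambda>v. A (C v))"
  unfolding cont_linear_def
proof (intro conjI allI)
  show "linear (\<lambda>v. A (C v))"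
    using linear_compose[of C A] A C by (simp add: cont_linear_def o_def)
  fix m
  obtain n a where a: "0 \<le> a" "\<And>v. sn B m (A v) \<le> a * sn B n v"
    by (rule cont_linearE[OF A]) (rule that)
  obtain k c where c: "0 \<le> c" "\<And>v. sn B n (C v) \<le> c * sn B k v"
    by (rule cont_linearE[OF C]) (rule that)
  have "sn B m (A (C v)) \<le> (a * c) * sn B k v" for v
    using a(2)[of "C v"] mult_left_mono[OF c(2)[of v] a(1)] by (simp add: mult.assoc)
  then show "\<exists>n C'. \<forall>v. sn B m (A (C v)) \<le> C' * sn B n v"
    by blast
qed

lemma cont_linear_add:
  assumes A: "cont_linear B A" and C: "cont_linear B C"
  shows "cont_linear B (\<lambda>v. A v + C v)"
  unfolding cont_linear_def
proof (intro conjI allI)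
  show "linear (\<lambda>v. A v + C v)"
    using linear_compose_add[of A C] A C by (simp add: cont_linear_def)
  fix m
  obtain n a where a: "0 \<le> a" "\<And>v. sn B m (A v) \<le> a * sn B n v"
    by (rule cont_linearE[OF A]) (rule that)
  obtain k c where c: "0 \<le> c" "\<And>v. sn B m (C v) \<le> c * sn B k v"
    by (rule cont_linearE[OF C]) (rule that)
  have "sn B m (A v + C v) \<le> (a + c) * sn B (max n k) v" for v
  proof -
    have "sn B m (A v + C v) \<le> a * sn B n v + c * sn B k v"
      using sn_triangle[of m "A v" "C v"] a(2)[of v] c(2)[of v] by linarith
    also have "\<dots> \<le> a * sn B (max n k) v + c * sn B (max n k) v"
      by (intro add_mono mult_left_mono sn_mono a c) auto
    finally show ?thesis by (simp add: algebra_simps)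
  qed
  then show "\<exists>n C'. \<forall>v. sn B m (A v + C v) \<le> C' * sn B n v"
    by blast
qed

lemma cont_linear_id: "cont_linear B (\<lambda>v. v)"
  unfolding cont_linear_def by (auto simp: linear_ident intro!: exI[of _ "1::real"])

lemma cont_linear_parity: "cont_linear B (parity B)"
  unfolding cont_linear_def using parity_linear by (auto intro!: exI[of _ "1::real"])

section \<open>Continuous bilinear forms; limits and derivatives of curves of sections\<close>

lemma bilinear_formsE:
  assumes "\<beta> \<in> bilinear_forms B"
  obtains m C where "0 \<le> C" "\<And>x y. \<bar>\<beta> x y\<bar> \<le> C * sn B m x * sn B m y"
proof -
  obtain m C where C: "\<And>x y. \<bar>\<beta> x y\<bar> \<le> C * sn B m x * sn B m y"
    using assms unfolding bilinear_forms_def by blast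
  have "\<bar>\<beta> x y\<bar> \<le> \<bar>C\<bar> * sn B m x * sn B m y" for x y
  proof -
    have "C * sn B m x * sn B m y \<le> \<bar>C\<bar> * sn B m x * sn B m y"
      by (intro mult_right_mono) auto
    with C[of x y] show ?thesis by linarith
  qed
  then show ?thesis
    using that[of "\<bar>C\<bar>" m] by simp
qed

lemma bilinear_forms_bilinear: "\<beta> \<in> bilinear_forms B \<Longrightarrow> bilinear \<beta>"
  by (simp add: bilinear_forms_def)

lemma bilinear_comp:
  assumes "bilinear \<beta>" "linear A" "linear C"
  shows "bilinear (\<lambda>x y. \<beta> (A x) (C y))"
  using assms linear_compose[OF assms(2), of "\<lambda>x. \<beta> x y" for y]
    linear_compose[OF assms(3), of "\<beta> x" for x]
  unfolding bilinear_def o_def by blast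

lemma bilinear_forms_comp:
  assumes \<beta>: "\<beta> \<in> bilinear_forms B" and A: "cont_linear B A" and C: "cont_linear B C"
  shows "(\<lambda>x y. \<beta> (A x) (C y)) \<in> bilinear_forms B"
proof -
  obtain m b where b: "0 \<le> b" "\<And>x y. \<bar>\<beta> x y\<bar> \<le> b * sn B m x * sn B m y"
    by (rule bilinear_formsE[OF \<beta>]) (rule that)
  obtain n a where a: "0 \<le> a" "\<And>v. sn B m (A v) \<le> a * sn B n v"
    by (rule cont_linearE[OF A]) (rule that)
  obtain k c where c: "0 \<le> c" "\<And>v. sn B m (C v) \<le> c * sn B k v"
    by (rule cont_linearE[OF C]) (rule that)
  have "\<bar>\<beta> (A x) (C y)\<bar> \<le> (b * a * c) * sn B (max n k) x * sn B (max n k) y" for x y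
  proof -
    have "sn B m (A x) \<le> a * sn B (max n k) x"
      using a(2)[of x] mult_left_mono[OF sn_mono[of n "max n k" x] a(1)] by simp
    moreover have "sn B m (C y) \<le> c * sn B (max n k) y"
      using c(2)[of y] mult_left_mono[OF sn_mono[of k "max n k" y] c(1)] by simp
    ultimately have "b * (sn B m (A x) * sn B m (C y)) \<le>
        b * ((a * sn B (max n k) x) * (c * sn B (max n k) y))"
      by (intro mult_left_mono mult_mono) (auto simp: a b c)
    with b(2)[of "A x" "C y"] show ?thesis by (simp add: mult_ac)
  qed
  moreover have "bilinear (\<lambda>x y. \<beta> (A x) (C y))"
    by (rule bilinear_comp[OF bilinear_forms_bilinear[OF \<beta>] cont_linear_linear[OF A]
          cont_linear_linear[OF C]])
  ultimately show ?thesis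
    unfolding bilinear_forms_def by blast
qed

text \<open>The type of sections is only a real vector space, so convergence in the Frechet topology
  is expressed through all seminorms \<open>sn B m\<close>.\<close>

definition vlim :: "('a \<Rightarrow> 'v) \<Rightarrow> 'v \<Rightarrow> 'a filter \<Rightarrow> bool" where
  "vlim c l F \<longleftrightarrow> (\<forall>m. ((\<lambda>s. sn B m (c s - l)) \<longlongrightarrow> 0) F)"

lemma vlimD: "vlim c l F \<Longrightarrow> ((\<lambda>s. sn B m (c s - l)) \<longlongrightarrow> 0) F"
  by (simp add: vlim_def)

lemma vlimI:
  assumes "\<And>m. \<exists>b. (\<forall>\<^sub>F s in F. sn B m (c s - l) \<le> b s) \<and> (b \<longlongrightarrow> 0) F"
  shows "vlim c l F"
  unfolding vlim_def
proof
  fix m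
  obtain b where "\<forall>\<^sub>F s in F. sn B m (c s - l) \<le> b s" "(b \<longlongrightarrow> 0) F"
    by (metis assms)
  then show "((\<lambda>s. sn B m (c s - l)) \<longlongrightarrow> 0) F"
    by (rule tendsto_sandwich[OF always_eventually _ tendsto_const, rotated]) simp_all
qed

lemma vlim_const: "vlim (\<lambda>s. l) l F"
  by (simp add: vlim_def)

lemma vlim_add:
  assumes "vlim c l F" "vlim d k F"
  shows "vlim (\<lambda>s. c s + d s) (l + k) F"
proof (rule vlimI)
  fix m
  have "sn B m (c s + d s - (l + k)) \<le> sn B m (c s - l) + sn B m (d s - k)" for s
    using sn_triangle[of m "c s - l" "d s - k"] by (simp add: algebra_simps)
  moreover have "((\<lambda>s. sn B m (c s - l) + sn B m (d s - k)) \<longlongrightarrow> 0) F"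
    using tendsto_add[OF vlimD[OF assms(1)] vlimD[OF assms(2)]] by simp
  ultimately show "\<exists>b. (\<forall>\<^sub>F s in F. sn B m (c s + d s - (l + k)) \<le> b s) \<and> (b \<longlongrightarrow> 0) F"
    by (intro exI[of _ "\<lambda>s. sn B m (c s - l) + sn B m (d s - k)"]) auto
qed

lemma vlim_linear:
  assumes "vlim c l F" and A: "cont_linear B A"
  shows "vlim (\<lambda>s. A (c s)) (A l) F"
proof (rule vlimI)
  fix m
  obtain n a where a: "0 \<le> a" "\<And>v. sn B m (A v) \<le> a * sn B n v"
    by (rule cont_linearE[OF A]) (rule that)
  have "sn B m (A (c s) - A l) \<le> a * sn B n (c s - l)" for s
    using a(2)[of "c s - l"] by (simp add: linear_diff[OF cont_linear_linear[OF A]])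
  moreover have "((\<lambda>s. a * sn B n (c s - l)) \<longlongrightarrow> 0) F"
    using tendsto_mult_left[OF vlimD[OF assms(1)], of a] by simp
  ultimately show "\<exists>b. (\<forall>\<^sub>F s in F. sn B m (A (c s) - A l) \<le> b s) \<and> (b \<longlongrightarrow> 0) F"
    by (intro exI[of _ "\<lambda>s. a * sn B n (c s - l)"]) auto
qed

lemma vlim_scaleR:
  assumes "vlim c l F" and a: "(a \<longlongrightarrow> b) F"
  shows "vlim (\<lambda>s. a s *\<^sub>R c s) (b *\<^sub>R l) F"
proof (rule vlimI)
  fix m
  let ?e = "\<lambda>s. \<bar>a s\<bar> * sn B m (c s - l) + \<bar>a s - b\<bar> * sn B m l"
  have "sn B m (a s *\<^sub>R c s - b *\<^sub>R l) \<le> ?e s" for s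
  proof -
    have "a s *\<^sub>R c s - b *\<^sub>R l = a s *\<^sub>R (c s - l) + (a s - b) *\<^sub>R l"
      by (simp add: algebra_simps)
    then show ?thesis
      using sn_triangle[of m "a s *\<^sub>R (c s - l)" "(a s - b) *\<^sub>R l"] by (simp add: sn_scaleR)
  qed
  moreover have "(?e \<longlongrightarrow> \<bar>b\<bar> * 0 + \<bar>b - b\<bar> * sn B m l) F"
    by (intro tendsto_intros vlimD assms)
  ultimately show "\<exists>e. (\<forall>\<^sub>F s in F. sn B m (a s *\<^sub>R c s - b *\<^sub>R l) \<le> e s) \<and> (e \<longlongrightarrow> 0) F"
    by (intro exI[of _ ?e]) auto
qed

lemma vlim_minus: "vlim c l F \<Longrightarrow> vlim (\<lambda>s. - c s) (- l) F"
  using vlim_scaleR[of c l F "\<lambda>_. -1" "-1"] by simp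

lemma vlim_diff:
  assumes "vlim c l F" "vlim d k F"
  shows "vlim (\<lambda>s. c s - d s) (l - k) F"
  using vlim_add[OF assms(1) vlim_minus[OF assms(2)]] by simp

lemma vlim_sn:
  assumes "vlim c l F"
  shows "((\<lambda>s. sn B m (c s)) \<longlongrightarrow> sn B m l) F"
proof -
  have "\<bar>sn B m (c s) - sn B m l\<bar> \<le> sn B m (c s - l)" for s
    using sn_triangle[of m "c s - l" l] sn_triangle_diff[of m "c s" "c s - l"] by simp
  then have "((\<lambda>s. sn B m (c s) - sn B m l) \<longlongrightarrow> 0) F"
    by (intro Lim_null_comparison[OF always_eventually vlimD[OF assms, of m]]) simp
  then show ?thesis
    using Lim_null by blast
qed

lemma vlim_compose:
  assumes "vlim c l F" "filterlim f F G"
  shows "vlim (\<lambda>s. c (f s)) l G"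
  unfolding vlim_def using filterlim_compose[OF vlimD[OF assms(1)] assms(2)] by simp

text \<open>Joint continuity: the first increment is paired with the moving second entry, whose
  seminorms converge, and the second increment with the fixed limit \<open>l\<close>.\<close>

lemma vlim_bilinear:
  assumes \<beta>: "\<beta> \<in> bilinear_forms B" and c: "vlim c l F" and d: "vlim d k F"
  shows "((\<lambda>s. \<beta> (c s) (d s)) \<longlongrightarrow> \<beta> l k) F"
proof -
  obtain m b where b: "0 \<le> b" "\<And>x y. \<bar>\<beta> x y\<bar> \<le> b * sn B m x * sn B m y"
    by (rule bilinear_formsE[OF \<beta>]) (rule that)
  note bl = bilinear_forms_bilinear[OF \<beta>]
  let ?e = "\<lambda>s. b * sn B m (c s - l) * sn B m (d s) + b * sn B m l * sn B m (d s - k)"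
  have "\<bar>\<beta> (c s) (d s) - \<beta> l k\<bar> \<le> ?e s" for s
  proof -
    have "\<beta> (c s) (d s) - \<beta> l k = \<beta> (c s - l) (d s) + \<beta> l (d s - k)"
      by (simp add: bilinear_lsub[OF bl] bilinear_rsub[OF bl])
    then show ?thesis
      using b(2)[of "c s - l" "d s"] b(2)[of l "d s - k"] by linarith
  qed
  then have "((\<lambda>s. \<beta> (c s) (d s) - \<beta> l k) \<longlongrightarrow> 0) F" if "(?e \<longlongrightarrow> 0) F"
    by (intro Lim_null_comparison[OF always_eventually that]) simp
  moreover have "(?e \<longlongrightarrow> b * 0 * sn B m k + b * sn B m l * 0) F"
    by (intro tendsto_add tendsto_mult tendsto_const vlimD[OF c] vlimD[OF d] vlim_sn[OF d])
  ultimately have "((\<lambda>s. \<beta> (c s) (d s) - \<beta> l k) \<longlongrightarrow> 0) F"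
    by simp
  then show ?thesis
    using Lim_null by blast
qed

text \<open>The semigroup is controlled only at nonnegative times, hence a derivative within a
  set.\<close>

definition has_vderiv :: "(real \<Rightarrow> 'v) \<Rightarrow> 'v \<Rightarrow> real \<Rightarrow> real set \<Rightarrow> bool" where
  "has_vderiv c c' t X \<longleftrightarrow> vlim (\<lambda>s. (1 / (s - t)) *\<^sub>R (c s - c t)) c' (at t within X)"

lemma has_vderiv_vlim:
  assumes "has_vderiv c c' t X"
  shows "vlim c (c t) (at t within X)"
proof -
  have "((\<lambda>s. s - t) \<longlongrightarrow> t - t) (at t within X)"
    by (intro tendsto_intros)
  then have "((\<lambda>s. s - t) \<longlongrightarrow> 0) (at t within X)" by simp
  from vlim_scaleR[OF assms[unfolded has_vderiv_def] this]
  have v: "vlim (\<lambda>s. (s - t) *\<^sub>R ((1 / (s - t)) *\<^sub>R (c s - c t))) 0 (at t within X)"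
    by simp
  have "(s - t) *\<^sub>R ((1 / (s - t)) *\<^sub>R (c s - c t)) = c s - c t" for s
    by (cases "s = t") auto
  with v have "vlim (\<lambda>s. c s - c t) 0 (at t within X)" by simp
  then show ?thesis by (simp add: vlim_def)
qed

lemma has_vderiv_subset: "has_vderiv c c' t X \<Longrightarrow> Y \<subseteq> X \<Longrightarrow> has_vderiv c c' t Y"
  unfolding has_vderiv_def vlim_def by (blast intro: tendsto_within_subset)

lemma has_vderiv_linear:
  assumes "has_vderiv c c' t X" and A: "cont_linear B A"
  shows "has_vderiv (\<lambda>s. A (c s)) (A c') t X"
  using vlim_linear[OF assms(1)[unfolded has_vderiv_def] A]
  by (simp add: has_vderiv_def linear_cmul[OF cont_linear_linear[OF A]]
      linear_diff[OF cont_linear_linear[OF A]])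

lemma has_vderiv_diff:
  assumes "has_vderiv c c' t X" "has_vderiv d d' t X"
  shows "has_vderiv (\<lambda>s. c s - d s) (c' - d') t X"
proof -
  have eq: "(1 / (s - t)) *\<^sub>R (c s - d s - (c t - d t)) =
      (1 / (s - t)) *\<^sub>R (c s - c t) - (1 / (s - t)) *\<^sub>R (d s - d t)" for s
    unfolding scaleR_diff_right[symmetric] by (rule arg_cong) simp
  show ?thesis
    using vlim_diff[OF assms[unfolded has_vderiv_def]] unfolding has_vderiv_def eq .
qed

lemma has_vderiv_bilinear:
  assumes \<beta>: "\<beta> \<in> bilinear_forms B" and c: "has_vderiv c c' t X" and d: "has_vderiv d d' t X"
  shows "((\<lambda>s. \<beta> (c s) (d s)) has_real_derivative \<beta> c' (d t) + \<beta> (c t) d') (at t within X)"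
proof -
  note bl = bilinear_forms_bilinear[OF \<beta>]
  have "((\<lambda>s. \<beta> ((1 / (s - t)) *\<^sub>R (c s - c t)) (d s) + \<beta> (c t) ((1 / (s - t)) *\<^sub>R (d s - d t)))
      \<longlongrightarrow> \<beta> c' (d t) + \<beta> (c t) d') (at t within X)"
    using c d by (intro tendsto_add vlim_bilinear[OF \<beta>] vlim_const has_vderiv_vlim[OF d])
      (auto simp: has_vderiv_def)
  moreover have "\<beta> ((1 / (s - t)) *\<^sub>R (c s - c t)) (d s) + \<beta> (c t) ((1 / (s - t)) *\<^sub>R (d s - d t)) =
      (\<beta> (c s) (d s) - \<beta> (c t) (d t)) / (s - t)" for s
    unfolding bilinear_lmul[OF bl] bilinear_rmul[OF bl] bilinear_lsub[OF bl] bilinear_rsub[OF bl]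
    by (simp add: diff_divide_distrib)
  ultimately show ?thesis
    by (simp add: has_field_derivative_iff)
qed

end

section \<open>The heat flow and the pairing\<close>

locale gauge_fixed_bv =
  fixes B :: "('m::euclidean_space, 'r::finite, 'v::real_vector) bv"
  assumes free: "free_bv_theory B" and gauge: "gauge_fixing B"

sublocale gauge_fixed_bv \<subseteq> graded_sections B
  using free by unfold_locales (simp_all add: free_bv_theory_def)

context gauge_fixed_bv
begin

abbreviation "\<gamma> \<equiv> parity B"
abbreviation "q \<equiv> dif B"
abbreviation "qGF \<equiv> gfix B"
abbreviation "\<omega> \<equiv> pairing B"
abbreviation "D \<equiv> Dop B"

lemma q_cont: "cont_linear B q" and qGF_cont: "cont_linear B qGF"
  using free gauge unfolding free_bv_theory_def elliptic_complex_def gauge_fixing_def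
    diff_operator_def by simp_all

lemmas \<gamma>_linear = parity_linear
lemmas q_linear = cont_linear_linear[OF q_cont]
lemmas qGF_linear = cont_linear_linear[OF qGF_cont]

lemma q_q: "q (q v) = 0" and qGF_qGF: "qGF (qGF v) = 0"
  using free gauge unfolding free_bv_theory_def elliptic_complex_def gauge_fixing_def by simp_all

lemma q_\<gamma>: "q (\<gamma> v) = - \<gamma> (q v)" and qGF_\<gamma>: "qGF (\<gamma> v) = - \<gamma> (qGF v)"
proof -
  have "has_degree B 1 q" "has_degree B (- 1) qGF"
    using free gauge unfolding free_bv_theory_def elliptic_complex_def gauge_fixing_def by simp_all
  then show "q (\<gamma> v) = - \<gamma> (q v)" "qGF (\<gamma> v) = - \<gamma> (qGF v)"
    by (auto intro: odd_degree_parity q_linear qGF_linear)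
qed

lemma D_cont: "cont_linear B D"
  using cont_linear_add[OF cont_linear_compose[OF q_cont qGF_cont] cont_linear_compose[OF qGF_cont q_cont]]
  unfolding Dop_def[abs_def] .

lemma D_commutes:
  "D (q v) = q (D v)" "D (qGF v) = qGF (D v)" "D (\<gamma> v) = \<gamma> (D v)"
  by (simp_all add: Dop_def q_q qGF_qGF q_\<gamma> qGF_\<gamma> linear_add[OF q_linear] linear_add[OF qGF_linear]
      linear_add[OF \<gamma>_linear] linear_0[OF q_linear] linear_0[OF qGF_linear]
      linear_neg[OF q_linear] linear_neg[OF qGF_linear])

lemma symplectic: "symplectic_pairing B"
  using free by (simp add: free_bv_theory_def)

lemma \<omega>_form: "\<omega> \<in> bilinear_forms B"
  using symplectic[unfolded symplectic_pairing_def] unfolding bilinear_forms_def by blast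

lemmas \<omega>_bilinear = bilinear_forms_bilinear[OF \<omega>_form]

lemma \<omega>_nondegenerate: "(\<And>w. \<omega> v w = 0) \<Longrightarrow> v = 0"
  using symplectic[unfolded symplectic_pairing_def, THEN conjunct2, THEN conjunct2, THEN conjunct2,
      THEN conjunct1] by blast

lemma \<omega>_degree: "v \<in> homog B k \<Longrightarrow> w \<in> homog B l \<Longrightarrow> k + l \<noteq> 1 \<Longrightarrow> \<omega> v w = 0"
  using symplectic[unfolded symplectic_pairing_def, THEN conjunct2, THEN conjunct2, THEN conjunct2,
      THEN conjunct2] by blast

lemma bilinear_uminus: "bilinear \<beta> \<Longrightarrow> bilinear (\<lambda>x y. - \<beta> x y :: real)"
  unfolding bilinear_def by (auto intro: linear_compose_neg)

text \<open>The pairing lives in total degree one, where the two entries have opposite parity; hence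
  the parity operator is skew for it.\<close>

lemma \<omega>_\<gamma>: "\<omega> (\<gamma> v) w = - \<omega> v (\<gamma> w)"
proof (rule bilinear_homog_eqI[of "\<lambda>v w. \<omega> (\<gamma> v) w" "\<lambda>v w. - \<omega> v (\<gamma> w)"])
  show "bilinear (\<lambda>v w. \<omega> (\<gamma> v) w)" "bilinear (\<lambda>v w. - \<omega> v (\<gamma> w))"
    using bilinear_comp[OF \<omega>_bilinear \<gamma>_linear linear_ident]
      bilinear_uminus[OF bilinear_comp[OF \<omega>_bilinear linear_ident \<gamma>_linear]] by simp_all
  fix k l v w assume v: "v \<in> homog B k" and w: "w \<in> homog B l"
  show "\<omega> (\<gamma> v) w = - \<omega> v (\<gamma> w)"
  proof (cases "k + l = 1")
    case True
    then have "l = 1 - k" by simp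
    then have "(-1) powi k = - ((-1) powi l :: real)"
      by (simp add: power_int_minus_left)
    then show ?thesis
      unfolding parity_homog'[OF v] parity_homog'[OF w] bilinear_lmul[OF \<omega>_bilinear]
        bilinear_rmul[OF \<omega>_bilinear] by simp
  next
    case False
    then show ?thesis
      by (simp add: parity_homog'[OF v] parity_homog'[OF w] bilinear_lmul[OF \<omega>_bilinear]
          bilinear_rmul[OF \<omega>_bilinear] \<omega>_degree[OF v w])
  qed
qed

lemma \<omega>_q: "\<omega> (q v) w = - \<omega> (\<gamma> v) (q w)"
proof (rule bilinear_homog_eqI[of "\<lambda>v w. \<omega> (q v) w" "\<lambda>v w. - \<omega> (\<gamma> v) (q w)"])
  show "bilinear (\<lambda>v w. \<omega> (q v) w)" "bilinear (\<lambda>v w. - \<omega> (\<gamma> v) (q w))"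
    using bilinear_comp[OF \<omega>_bilinear q_linear linear_ident]
      bilinear_uminus[OF bilinear_comp[OF \<omega>_bilinear \<gamma>_linear q_linear]] by simp_all
  fix k l v w assume v: "v \<in> homog B k"
  have "\<omega> (q v) w + (-1) powi k * \<omega> v (q w) = 0"
    using free v unfolding free_bv_theory_def by blast
  then show "\<omega> (q v) w = - \<omega> (\<gamma> v) (q w)"
    by (simp add: parity_homog'[OF v] bilinear_lmul[OF \<omega>_bilinear])
qed

lemma \<omega>_qGF: "\<omega> (qGF v) w = \<omega> (\<gamma> v) (qGF w)"
proof (rule bilinear_homog_eqI[of "\<lambda>v w. \<omega> (qGF v) w" "\<lambda>v w. \<omega> (\<gamma> v) (qGF w)"])
  show "bilinear (\<lambda>v w. \<omega> (qGF v) w)" "bilinear (\<lambda>v w. \<omega> (\<gamma> v) (qGF w))"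
    using bilinear_comp[OF \<omega>_bilinear qGF_linear linear_ident]
      bilinear_comp[OF \<omega>_bilinear \<gamma>_linear qGF_linear] by simp_all
  fix k l v w assume v: "v \<in> homog B k"
  have "\<omega> (qGF v) w = (-1) powi k * \<omega> v (qGF w)"
    using gauge v unfolding gauge_fixing_def by blast
  then show "\<omega> (qGF v) w = \<omega> (\<gamma> v) (qGF w)"
    by (simp add: parity_homog'[OF v] bilinear_lmul[OF \<omega>_bilinear])
qed

text \<open>Moving both operators across the pairing exchanges the two summands of \<open>D\<close>.
  One minus sign comes from \<open>q\<close>, a second one from anticommuting with parity, and the
  two parity operators square to one.\<close>

lemma \<omega>_D: "\<omega> (D v) w = \<omega> v (D w)"
proof -
  have "\<omega> (q (qGF v)) w = \<omega> v (qGF (q w))"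
    unfolding \<omega>_q[of "qGF v"] using \<omega>_qGF[of "\<gamma> v" "q w"]
    by (simp add: qGF_\<gamma> bilinear_lneg[OF \<omega>_bilinear])
  moreover have "\<omega> (qGF (q v)) w = \<omega> v (q (qGF w))"
    unfolding \<omega>_qGF[of "q v"] using \<omega>_q[of "\<gamma> v" "qGF w"]
    by (simp add: q_\<gamma> bilinear_lneg[OF \<omega>_bilinear])
  ultimately show ?thesis
    by (simp add: Dop_def bilinear_ladd[OF \<omega>_bilinear] bilinear_radd[OF \<omega>_bilinear])
qed

end

section \<open>Self-adjointness and symmetries of the heat semigroup\<close>

locale heat_bv = gauge_fixed_bv B for B :: "('m::euclidean_space, 'r::finite, 'v::real_vector) bv" +
  fixes U :: "real \<Rightarrow> 'v \<Rightarrow> 'v"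
  assumes heat: "heat_semigroup B U"
begin

lemma U_cont: "0 \<le> t \<Longrightarrow> cont_linear B (U t)"
  and U_0: "U 0 v = v"
  and U_add: "0 \<le> s \<Longrightarrow> 0 \<le> t \<Longrightarrow> U (s + t) v = U s (U t v)"
  using heat unfolding heat_semigroup_def by blast+

lemma U_vderiv:
  assumes "0 \<le> t"
  shows "has_vderiv (\<lambda>s. U s v) (- D (U t v)) t {0..}"
proof -
  have "((\<lambda>s. sn B m ((1 / (s - t)) *\<^sub>R (U s v - U t v) + D (U t v))) \<longlongrightarrow> 0) (at t within {0..})" for m
    using heat assms unfolding heat_semigroup_def by blast
  then show ?thesis
    by (simp add: has_vderiv_def vlim_def)
qed

text \<open>The pairing turns the backward flow \<open>U (t - s) y\<close> into an integrating factor; this replaces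
  local equicontinuity of the semigroup.\<close>

lemma heat_equation_pairing:
  assumes w: "\<And>s. 0 \<le> s \<Longrightarrow> has_vderiv w (- D (w s)) s {0..}" and t: "0 \<le> t"
  shows "\<omega> (w t) y = \<omega> (w 0) (U t y)"
proof -
  let ?f = "\<lambda>s. \<omega> (w s) (U (t - s) y)"
  have "(?f has_real_derivative 0) (at s within {0..t})" if s: "s \<in> {0..t}" for s
  proof -
    \<comment> \<open>For \<open>r\<close> in \<open>{0..t}\<close> the reversed time
      \<open>t - r\<close> stays nonnegative, where the flow is differentiable.\<close>
    have "filterlim (\<lambda>r. t - r) (at (t - s) within {0..}) (at s within {0..t})"
      using s by (auto simp: filterlim_at eventually_at_filter intro!: tendsto_eq_intros)
    from vlim_minus[OF vlim_compose[OF U_vderiv[of "t - s" y, unfolded has_vderiv_def] this]]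
    have "vlim (\<lambda>r. - ((1 / (t - r - (t - s))) *\<^sub>R (U (t - r) y - U (t - s) y))) (D (U (t - s) y))
        (at s within {0..t})"
      using s by simp
    moreover have "- ((1 / (t - r - (t - s))) *\<^sub>R (U (t - r) y - U (t - s) y)) =
        (1 / (r - s)) *\<^sub>R (U (t - r) y - U (t - s) y)" for r
    proof -
      have "1 / (t - r - (t - s)) = - (1 / (r - s))"
        by (metis (no_types) diff_diff_eq2 add_diff_cancel_left' minus_diff_eq minus_divide_right
            diff_add_cancel add.commute add_diff_eq)
      then show ?thesis by simp
    qed
    ultimately have u: "has_vderiv (\<lambda>s. U (t - s) y) (D (U (t - s) y)) s {0..t}"
      by (simp add: has_vderiv_def)
    have "has_vderiv w (- D (w s)) s {0..t}"
      by (rule has_vderiv_subset[OF w]) (use s in auto)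
    \<comment> \<open>With u = \<open>U (t - s) y\<close>, the two terms of the product rule are the
      pairings of \<open>- D (w s)\<close> with u and of \<open>w s\<close> with D u; they cancel
      because \<open>D\<close> is self-adjoint for the pairing.\<close>
    from has_vderiv_bilinear[OF \<omega>_form this u]
    show ?thesis
      by (simp add: bilinear_lneg[OF \<omega>_bilinear] \<omega>_D)
  qed
  then obtain c where c: "\<And>s. s \<in> {0..t} \<Longrightarrow> ?f s = c"
    using has_field_derivative_zero_constant[of "{0..t}" ?f] by auto
  from c[of t] c[of 0] t show ?thesis by (simp add: U_0)
qed

lemma \<omega>_U: "0 \<le> t \<Longrightarrow> \<omega> (U t v) w = \<omega> v (U t w)"
  using heat_equation_pairing[of "\<lambda>s. U s v" t w] U_vderiv by (simp add: U_0)

text \<open>The defect \<open>A (U s v) - U s (A v)\<close> solves the heat equation with initial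
  value zero, so it pairs to zero with everything. Nondegeneracy of the pairing thus plays the part
  of uniqueness of solutions.\<close>

lemma commutes_U:
  assumes A: "cont_linear B A" and AD: "\<And>v. A (D v) = D (A v)" and t: "0 \<le> t"
  shows "A (U t v) = U t (A v)"
proof -
  let ?w = "\<lambda>s. A (U s v) - U s (A v)"
  have "has_vderiv ?w (- D (?w s)) s {0..}" if "0 \<le> s" for s
    using has_vderiv_diff[OF has_vderiv_linear[OF U_vderiv[OF that] A] U_vderiv[OF that]]
    by (simp add: linear_neg[OF cont_linear_linear[OF A]] AD linear_diff[OF cont_linear_linear[OF D_cont]])
  from heat_equation_pairing[of ?w, OF this t]
  have "\<omega> (?w t) y = 0" for y
    by (simp add: U_0 bilinear_lzero[OF \<omega>_bilinear])
  from \<omega>_nondegenerate[OF this] show ?thesis by simp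
qed

lemma U_commutes:
  assumes "0 \<le> t"
  shows "U t (\<gamma> v) = \<gamma> (U t v)" "U t (q v) = q (U t v)" "U t (qGF v) = qGF (U t v)"
  using commutes_U[OF cont_linear_parity _ assms] commutes_U[OF q_cont _ assms]
    commutes_U[OF qGF_cont _ assms] D_commutes by metis+

end

section \<open>Graded symmetric functionals\<close>

text \<open>Only the vector \<open>w\<close> that moves forward has pure parity; the sign for
  passing \<open>u\<close> is carried by \<open>g u\<close>, so \<open>u\<close> may be
  inhomogeneous and no degree is mentioned. \<open>gsymmetric_parity_iff\<close> identifies this
  with the rule in \<open>sym_fnl\<close>.\<close>

definition gsymmetric :: "('v::real_vector \<Rightarrow> 'v) \<Rightarrow> 'v fnl \<Rightarrow> bool" where
  "gsymmetric g \<phi> \<longleftrightarrow> (\<forall>xs ys u w.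
     (g w = w \<longrightarrow> \<phi> (xs @ u # w # ys) = \<phi> (xs @ w # u # ys)) \<and>
     (g w = - w \<longrightarrow> \<phi> (xs @ u # w # ys) = \<phi> (xs @ w # g u # ys)))"

lemma gsymmetricD:
  assumes "gsymmetric g \<phi>"
  shows "g w = w \<Longrightarrow> \<phi> (xs @ u # w # ys) = \<phi> (xs @ w # u # ys)"
    and "g w = - w \<Longrightarrow> \<phi> (xs @ u # w # ys) = \<phi> (xs @ w # g u # ys)"
  using assms unfolding gsymmetric_def by blast+

lemmas gsymmetric_Nil = gsymmetricD[where xs = "[]", unfolded append_Nil]

lemma gsymmetric_tail: "gsymmetric g \<phi> \<Longrightarrow> gsymmetric g (\<lambda>us. \<phi> (v # us))"
  unfolding gsymmetric_def append_Cons[symmetric] by blast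

lemma gsymmetric_map:
  assumes \<phi>: "gsymmetric g \<phi>" and h: "linear h" "\<And>v. h (g v) = g (h v)"
  shows "gsymmetric g (\<lambda>us. \<phi> (map h us))"
  unfolding gsymmetric_def map_append list.map
proof (intro allI conjI impI)
  fix xs ys u w
  show "\<phi> (map h xs @ h u # h w # map h ys) = \<phi> (map h xs @ h w # h u # map h ys)" if "g w = w"
    using that by (intro gsymmetricD(1)[OF \<phi>]) (metis h(2))
  show "\<phi> (map h xs @ h u # h w # map h ys) = \<phi> (map h xs @ h w # h (g u) # map h ys)" if "g w = - w"
    unfolding h(2) using that by (intro gsymmetricD(2)[OF \<phi>]) (metis h linear_neg)
qed

lemma multilinear_linear: "multilinear \<phi> \<Longrightarrow> linear (\<lambda>v. \<phi> (xs @ v # ys))"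
  by (simp add: multilinear_def)

lemma parity_parts:
  fixes g :: "'v::real_vector \<Rightarrow> 'v"
  assumes "linear g" "\<And>v. g (g v) = v"
  shows "g ((1/2) *\<^sub>R (u + g u)) = (1/2) *\<^sub>R (u + g u)"
    and "g ((1/2) *\<^sub>R (u - g u)) = - ((1/2) *\<^sub>R (u - g u))"
    and "u = (1/2) *\<^sub>R (u + g u) + (1/2) *\<^sub>R (u - g u)"
  unfolding scaleR_right_distrib[symmetric] using scaleR_half_double[of u]
  by (simp_all add: assms linear_cmul linear_add linear_diff algebra_simps)

text \<open>For a first vector of pure parity one of the three branches in the recursion of
  \<open>fmult\<close> vanishes.\<close>

lemma fmult_even:
  assumes "g w = w" "multilinear \<phi>"
  shows "fmult g \<phi> \<psi> (w # us) = fmult g (\<lambda>us. \<phi> (w # us)) \<psi> us + fmult g \<phi> (\<lambda>us. \<psi> (w # us)) us"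
proof -
  have "(1/2) *\<^sub>R (w + w) = w" "(1/2) *\<^sub>R (w - w) = 0 *\<^sub>R w"
    by (simp_all only: scaleR_half_double) simp
  then show ?thesis
    unfolding fmult.simps assms(1) by (simp only: multilinear_Cons(3)[OF assms(2)] fmult_zero
        mult_zero_left add_0_right)
qed

lemma fmult_odd:
  assumes "g w = - w" "multilinear \<phi>"
  shows "fmult g \<phi> \<psi> (w # us) =
    fmult g (\<lambda>us. \<phi> (w # us)) (\<lambda>us. \<psi> (map g us)) us + fmult g \<phi> (\<lambda>us. \<psi> (w # us)) us"
proof -
  have "(1/2) *\<^sub>R (w - - w) = w" "(1/2) *\<^sub>R (w + - w) = 0 *\<^sub>R w"
    by (simp_all only: diff_minus_eq_add scaleR_half_double) simp
  then show ?thesis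
    unfolding fmult.simps assms(1) by (simp only: multilinear_Cons(3)[OF assms(2)] fmult_zero
        mult_zero_left add_0_left)
qed

lemma multilinear_fmult:
  assumes g: "linear g" and "multilinear \<phi>" "multilinear \<psi>"
  shows "multilinear (fmult g \<phi> \<psi>)"
  unfolding multilinear_def
proof (intro allI)
  fix xs ys
  show "linear (\<lambda>v. fmult g \<phi> \<psi> (xs @ [v] @ ys))"
    using assms(2,3)
  proof (induction xs arbitrary: \<phi> \<psi>)
    case Nil
    note ml = multilinear_Cons[OF Nil(1)] multilinear_Cons[OF Nil(2)]
    have s: "(1/2) *\<^sub>R (b + c + (g b + g c)) = (1/2) *\<^sub>R (b + g b) + (1/2) *\<^sub>R (c + g c)"
      "(1/2) *\<^sub>R (b + c - (g b + g c)) = (1/2) *\<^sub>R (b - g b) + (1/2) *\<^sub>R (c - g c)"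
      "(1/2) *\<^sub>R (r *\<^sub>R b + r *\<^sub>R g b) = r *\<^sub>R ((1/2) *\<^sub>R (b + g b))"
      "(1/2) *\<^sub>R (r *\<^sub>R b - r *\<^sub>R g b) = r *\<^sub>R ((1/2) *\<^sub>R (b - g b))" for b c r
      by (simp_all add: algebra_simps)
    show ?case
    proof (rule linearI)
      show "fmult g \<phi> \<psi> ([] @ [b + c] @ ys) = fmult g \<phi> \<psi> ([] @ [b] @ ys) + fmult g \<phi> \<psi> ([] @ [c] @ ys)"
        for b c
        unfolding append_Nil append_Cons fmult.simps linear_add[OF g] s ml fmult_add_left fmult_add_right
        by simp
      show "fmult g \<phi> \<psi> ([] @ [r *\<^sub>R b] @ ys) = r *\<^sub>R fmult g \<phi> \<psi> ([] @ [b] @ ys)"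
        for b and r :: real
        unfolding append_Nil append_Cons fmult.simps linear_cmul[OF g] s ml fmult_scale_left fmult_scale_right
        by (simp add: algebra_simps)
    qed
  next
    case (Cons x xs)
    have "linear (\<lambda>v. fmult g (\<lambda>us. \<phi> (y # us)) \<psi>' (xs @ [v] @ ys))" if "multilinear \<psi>'" for y \<psi>'
      by (rule Cons.IH[OF multilinear_tail[OF Cons.prems(1)] that])
    moreover have "linear (\<lambda>v. fmult g \<phi> (\<lambda>us. \<psi> (x # us)) (xs @ [v] @ ys))"
      by (rule Cons.IH[OF Cons.prems(1) multilinear_tail[OF Cons.prems(2)]])
    ultimately show ?case
      unfolding append_Cons fmult.simps
      by (intro linear_compose_add) (use Cons.prems(2) multilinear_map[OF Cons.prems(2) g] in blast)+
  qed
qed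

text \<open>Induction on the prefix reduces the claim to the first two vectors, where it is compared
  on the possible distributions of \<open>u\<close> and \<open>w\<close> over the two
  factors.\<close>

lemma gsymmetric_fmult:
  assumes g: "linear g" "\<And>v. g (g v) = v"
    and "multilinear \<phi>" "multilinear \<psi>" "gsymmetric g \<phi>" "gsymmetric g \<psi>"
  shows "gsymmetric g (fmult g \<phi> \<psi>)"
  unfolding gsymmetric_def
proof (intro allI)
  fix xs ys u w
  show "(g w = w \<longrightarrow> fmult g \<phi> \<psi> (xs @ u # w # ys) = fmult g \<phi> \<psi> (xs @ w # u # ys)) \<and>
    (g w = - w \<longrightarrow> fmult g \<phi> \<psi> (xs @ u # w # ys) = fmult g \<phi> \<psi> (xs @ w # g u # ys))"
    using assms(3-)
  proof (induction xs arbitrary: \<phi> \<psi>)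
    case (Cons x xs)
    note t = multilinear_tail gsymmetric_tail
    have m: "multilinear (\<lambda>us. \<psi> (map g us))" "gsymmetric g (\<lambda>us. \<psi> (map g us))"
      using multilinear_map[OF Cons.prems(2) g(1)] gsymmetric_map[OF Cons.prems(4) g(1)] by simp_all
    show ?case
      unfolding append_Cons fmult.simps
      using Cons.IH[OF t(1)[OF Cons.prems(1)] Cons.prems(2) t(2)[OF Cons.prems(3)] Cons.prems(4),
          of "(1/2) *\<^sub>R (x + g x)"]
        Cons.IH[OF t(1)[OF Cons.prems(1)] m(1) t(2)[OF Cons.prems(3)] m(2),
          of "(1/2) *\<^sub>R (x - g x)"]
        Cons.IH[OF Cons.prems(1) t(1)[OF Cons.prems(2)] Cons.prems(3) t(2)[OF Cons.prems(4)], of x]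
      by simp
  next
    case Nil
    define e where "e = (1/2) *\<^sub>R (u + g u)"
    define d where "d = (1/2) *\<^sub>R (u - g u)"
    have ge: "g e = e" and gd: "g d = - d"
      unfolding e_def d_def by (rule parity_parts(1,2)[OF g])+
    \<comment> \<open>When \<open>w\<close> is odd, \<open>u\<close> is replaced by
      \<open>g u\<close>. Its even part is still \<open>e\<close>, its odd part is
      \<open>- d\<close>; this supplies the sign between two odd vectors.\<close>
    have eg: "(1/2) *\<^sub>R (g u + u) = e" "(1/2) *\<^sub>R (g u - u) = - d"
      unfolding e_def d_def by (simp_all add: algebra_simps)
    note ml = Nil(1,2) multilinear_tail[OF Nil(1)] multilinear_tail[OF Nil(2)] multilinear_map[OF Nil(2) g(1)]
    note m1 = multilinear_Cons[OF Nil(1)] multilinear_Cons[OF Nil(2)]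
      multilinear_Cons[OF multilinear_tail[OF Nil(1)]] multilinear_Cons[OF multilinear_tail[OF Nil(2)]]
    have L: "fmult g \<phi>' \<psi>' (u # us) = fmult g (\<lambda>us. \<phi>' (e # us)) \<psi>' us +
        fmult g (\<lambda>us. \<phi>' (d # us)) (\<lambda>us. \<psi>' (map g us)) us + fmult g \<phi>' (\<lambda>us. \<psi>' (u # us)) us"
      for \<phi>' \<psi>' us
      by (simp only: fmult.simps e_def d_def)
    have L': "fmult g \<phi>' \<psi>' (g u # us) = fmult g (\<lambda>us. \<phi>' (e # us)) \<psi>' us +
        fmult g (\<lambda>us. \<phi>' (- d # us)) (\<lambda>us. \<psi>' (map g us)) us + fmult g \<phi>' (\<lambda>us. \<psi>' (g u # us)) us"
      for \<phi>' \<psi>' us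
      by (simp only: fmult.simps g(2) eg)
    have "fmult g \<phi> \<psi> (u # w # ys) = fmult g \<phi> \<psi> (w # u # ys)" if w: "g w = w"
    proof -
      have s: "\<phi> (e # w # us) = \<phi> (w # e # us)" "\<phi> (d # w # us) = \<phi> (w # d # us)"
        "\<psi> (u # w # us) = \<psi> (w # u # us)" for us
        using gsymmetric_Nil(1)[where g = g and w = w, OF _ w] Nil(3,4) by blast+
      show ?thesis
        unfolding L[of \<phi> \<psi>] fmult_even[where g = g and w = w, OF w ml(1)]
          fmult_even[where g = g and w = w, OF w ml(3)] unfolding L
        unfolding list.map w s by simp
    qed
    moreover have "fmult g \<phi> \<psi> (u # w # ys) = fmult g \<phi> \<psi> (w # g u # ys)" if w: "g w = - w"
    proof -
      have s: "\<phi> (e # w # us) = \<phi> (w # e # us)" "\<phi> (d # w # us) = \<phi> (w # (- d) # us)"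
        "\<psi> (u # w # us) = \<psi> (w # g u # us)" for us
        using gsymmetric_Nil(2)[where g = g and w = w, OF _ w] Nil(3,4) ge gd by metis+
      show ?thesis
        unfolding L[of \<phi> \<psi>] fmult_odd[where g = g and w = w, OF w ml(1)]
          fmult_odd[where g = g and w = w, OF w ml(3)] unfolding L'
        unfolding list.map w s by (simp add: m1 fmult_neg_left fmult_neg_right g o_def)
    qed
    ultimately show ?case by simp
  qed
qed

text \<open>If both sublists of a splitting reached their thresholds, \<open>vs\<close> would have
  length at least \<open>a + b\<close>. In the recursion a threshold drops by one for each vector
  handed to its factor; truncation at zero is harmless.\<close>

lemma fmult_weight:
  assumes "\<And>vs. length vs < a \<Longrightarrow> \<phi> vs = 0" "\<And>vs. length vs < b \<Longrightarrow> \<psi> vs = 0" "length vs < a + b"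
  shows "fmult g \<phi> \<psi> vs = 0"
  using assms
proof (induction vs arbitrary: \<phi> \<psi> a b)
  case Nil
  then have "\<phi> [] = 0 \<or> \<psi> [] = 0" by (cases "a = 0") auto
  then show ?case by auto
next
  case (Cons v vs)
  have "fmult g (\<lambda>us. \<phi> (x # us)) \<psi>' vs = 0" if "\<And>vs. length vs < b \<Longrightarrow> \<psi>' vs = 0" for x \<psi>'
    by (rule Cons.IH[of "a - 1" _ b]) (use Cons.prems that in auto)
  moreover have "fmult g \<phi> (\<lambda>us. \<psi> (v # us)) vs = 0"
    by (rule Cons.IH[of a _ "b - 1"]) (use Cons.prems in auto)
  ultimately show ?case
    using Cons.prems(2) by simp
qed

section \<open>Derivations induced by odd operators\<close>

lemma odd_der_scale: "odd_der g A (\<lambda>us. c * \<phi> us) vs = c * odd_der g A \<phi> vs"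
  by (simp add: odd_der_def sum_distrib_left)

lemma multilinear_odd_der:
  assumes g: "linear g" and A: "linear A" and "multilinear \<phi>"
  shows "multilinear (odd_der g A \<phi>)"
  unfolding multilinear_def
proof (intro allI)
  fix xs ys
  show "linear (\<lambda>v. odd_der g A \<phi> (xs @ [v] @ ys))"
    using assms(3)
  proof (induction xs arbitrary: \<phi>)
    case Nil
    show ?case
      by (rule linearI)
        (simp_all add: odd_der_Cons multilinear_Cons[OF Nil] linear_add[OF g] linear_add[OF A]
          linear_cmul[OF g] linear_cmul[OF A] odd_der_add odd_der_scale distrib_left)
  next
    case (Cons x xs)
    have "linear (\<lambda>v. \<phi> (A (g x) # map g (xs @ [v] @ ys)))"
      using multilinear_linear[OF multilinear_map[OF multilinear_tail[OF Cons.prems] g]] by simp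
    with Cons.IH[OF multilinear_tail[OF Cons.prems]] show ?case
      unfolding append_Cons odd_der_Cons by (intro linear_compose_add) auto
  qed
qed

lemma gsymmetric_odd_der:
  assumes g: "linear g" "\<And>v. g (g v) = v" and A: "linear A" "\<And>v. A (g v) = - g (A v)"
    and "multilinear \<phi>" "gsymmetric g \<phi>"
  shows "gsymmetric g (odd_der g A \<phi>)"
  unfolding gsymmetric_def
proof (intro allI)
  fix xs ys u w
  have gA: "g (A v) = - A (g v)" for v
    using A(2)[of v] by simp
  show "(g w = w \<longrightarrow> odd_der g A \<phi> (xs @ u # w # ys) = odd_der g A \<phi> (xs @ w # u # ys)) \<and>
    (g w = - w \<longrightarrow> odd_der g A \<phi> (xs @ u # w # ys) = odd_der g A \<phi> (xs @ w # g u # ys))"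
    using assms(5,6)
  proof (induction xs arbitrary: \<phi>)
    case Nil
    note s = gsymmetric_Nil[OF Nil(2)]
    have "odd_der g A \<phi> (u # w # ys) = odd_der g A \<phi> (w # u # ys)" if w: "g w = w"
    proof -
      have "g (A w) = - A w" by (simp add: gA w)
      then show ?thesis
        using s(1)[of w "A (g u)" "map g ys", OF w] s(2)[of "A w" u "map g ys"] s(1)[of w u, OF w]
        by (simp add: odd_der_Cons w)
    qed
    moreover have "odd_der g A \<phi> (u # w # ys) = odd_der g A \<phi> (w # g u # ys)" if w: "g w = - w"
    proof -
      have "g (- A w) = - A w" by (simp add: gA w linear_neg[OF g(1)] linear_neg[OF A(1)])
      moreover have "g (- w) = - (- w)"
        using g(2)[of w] w by simp
      ultimately show ?thesis
        using s(2)[of "- w" "A (g u)" "map g ys"] s(1)[of "- A w" u "map g ys"] s(2)[of w u, OF w]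
        by (simp add: odd_der_Cons w gA g linear_neg[OF A(1)] multilinear_Cons[OF Nil(1)]
            multilinear_Cons[OF multilinear_tail[OF Nil(1)]])
    qed
    ultimately show ?case by simp
  next
    case (Cons x xs)
    have s: "gsymmetric g (\<lambda>us. \<phi> (A (g x) # map g us))"
      using gsymmetric_map[OF gsymmetric_tail[OF Cons.prems(2)] g(1)] by simp
    show ?case
      using Cons.IH[OF multilinear_tail[OF Cons.prems(1)] gsymmetric_tail[OF Cons.prems(2)], of x]
        gsymmetricD[OF s, of w xs u ys]
      unfolding append_Cons odd_der_Cons by simp
  qed
qed

text \<open>Terms in which the two operators act on different vectors cancel because both are odd;
  what remains is the derivation of the even operator A C + C A. The minus sign comes from
  \<open>C (g (A (g v))) = - C (A v)\<close>.\<close>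

lemma odd_der_commutator:
  assumes g: "linear g" "\<And>v. g (g v) = v"
    and A: "linear A" "\<And>v. A (g v) = - g (A v)" and C: "linear C" "\<And>v. C (g v) = - g (C v)"
    and "multilinear \<phi>"
  shows "odd_der g A (odd_der g C \<phi>) vs + odd_der g C (odd_der g A \<phi>) vs =
    - (\<Sum>i<length vs. \<phi> (take i vs @ (A (C (vs ! i)) + C (A (vs ! i))) # drop (Suc i) vs))"
  using assms(7)
proof (induction vs arbitrary: \<phi>)
  case Nil
  show ?case by (simp add: odd_der_Nil)
next
  case (Cons v vs)
  \<comment> \<open>The two middle terms are antisymmetric in \<open>A\<close> and \<open>C\<close>,
    so they drop out when both orders are added.\<close>
  have *: "odd_der g A (odd_der g C \<phi>) (v # vs) = - \<phi> (C (A v) # vs)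
      + odd_der g C (\<lambda>us. \<phi> (A (g v) # us)) (map g vs)
      - odd_der g A (\<lambda>us. \<phi> (C (g v) # us)) (map g vs)
      + odd_der g A (odd_der g C (\<lambda>us. \<phi> (v # us))) vs"
    if A: "linear A" "\<And>v. A (g v) = - g (A v)" and C: "linear C" "\<And>v. C (g v) = - g (C v)" for A C
  proof -
    have "C (g (A (g v))) = - C (A v)"
      using A(2)[of "v"] g(2) by (simp add: linear_neg[OF g(1)] linear_neg[OF C(1)])
    then have "odd_der g C \<phi> (A (g v) # map g vs) = - \<phi> (C (A v) # vs) + odd_der g C (\<lambda>us. \<phi> (A (g v) # us)) (map g vs)"
      by (simp add: odd_der_Cons multilinear_Cons[OF Cons.prems] o_def g)
    moreover have "odd_der g A (\<lambda>us. odd_der g C \<phi> (v # us)) vs =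
        - odd_der g A (\<lambda>us. \<phi> (C (g v) # us)) (map g vs) + odd_der g A (odd_der g C (\<lambda>us. \<phi> (v # us))) vs"
      unfolding odd_der_Cons odd_der_add
      using odd_der_map[where g = g and A = A, OF g(2) A(2) multilinear_tail[OF Cons.prems, of "C (g v)"]] by simp
    ultimately show ?thesis
      unfolding odd_der_Cons[of g A] by simp
  qed
  show ?case
    unfolding *[OF A C] *[OF C A]
    using Cons.IH[OF multilinear_tail[OF Cons.prems], of v]
    by (simp add: sum.lessThan_Suc_shift multilinear_Cons[OF Cons.prems] del: sum.lessThan_Suc)
qed

text \<open>Fubini for a pair of contractions: the product bound gives absolute summability over
  pairs of indices, where unordered sums may be exchanged.\<close>

lemma suminf_swap_bounded:
  fixes f :: "nat \<Rightarrow> nat \<Rightarrow> real"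
  assumes a: "summable a" "\<And>i. 0 \<le> a i" and b: "summable b" "\<And>i. 0 \<le> b i"
    and f: "\<And>i j. \<bar>f i j\<bar> \<le> C * a i * b j"
  shows "(\<Sum>i. \<Sum>j. f i j) = (\<Sum>j. \<Sum>i. f i j)"
proof -
  have un: "h summable_on UNIV" "infsum h UNIV = suminf h"
    if "\<And>i. \<bar>h i\<bar> \<le> c * e i" "summable e" for h e :: "nat \<Rightarrow> real" and c
  proof -
    have "summable (\<lambda>i. norm (h i))"
      by (rule summable_comparison_test[OF _ summable_mult[OF that(2), of c]]) (use that(1) in auto)
    from norm_summable_imp_has_sum[OF this summable_sums[OF summable_norm_cancel[OF this]]]
    show "h summable_on UNIV" "infsum h UNIV = suminf h"
      by (auto dest: has_sum_imp_summable infsumI)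
  qed
  have Ca: "\<bar>(\<Sum>j. f i j)\<bar> \<le> (C * suminf b) * a i" "\<bar>(\<Sum>j. f j i)\<bar> \<le> (C * suminf a) * b i" for i
  proof -
    have "norm (\<Sum>j. f i j) \<le> (\<Sum>j. (C * a i) * b j)" "norm (\<Sum>j. f j i) \<le> (\<Sum>j. (C * b i) * a j)"
      using f[of i] f[of _ i] by (intro norm_suminf_le summable_mult a b; simp add: mult_ac)+
    then show "\<bar>(\<Sum>j. f i j)\<bar> \<le> (C * suminf b) * a i" "\<bar>(\<Sum>j. f j i)\<bar> \<le> (C * suminf a) * b i"
      unfolding suminf_mult[OF a(1)] suminf_mult[OF b(1)] real_norm_def by (simp_all only: mult_ac)
  qed
  have "(\<lambda>p. C * (case p of (i, j) \<Rightarrow> a i * b j)) summable_on UNIV \<times> UNIV"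
  proof (intro summable_on_cmult_right summable_on_SigmaI)
    show "((\<lambda>j. case (i, j) of (i, j) \<Rightarrow> a i * b j) has_sum a i * suminf b) UNIV" for i
      using norm_summable_imp_has_sum[of "\<lambda>j. a i * b j" "a i * suminf b"] a b
      by (simp add: sums_mult summable_sums abs_mult summable_mult)
    show "(\<lambda>i. a i * suminf b) summable_on UNIV"
      by (rule un(1)[of _ "suminf b" a]) (use a suminf_nonneg[OF b] in \<open>auto simp: abs_mult\<close>)
  qed (use a b in auto)
  then have "(\<lambda>p. norm (case p of (i, j) \<Rightarrow> f i j)) summable_on UNIV \<times> UNIV"
    by (rule Infinite_Sum.abs_summable_on_comparison_test') (use f in \<open>auto simp: mult.assoc\<close>)
  from infsum_swap_banach[OF Infinite_Sum.abs_summable_summable[OF this]]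
  have s: "infsum (\<lambda>i. infsum (f i) UNIV) UNIV = infsum (\<lambda>j. infsum (\<lambda>i. f i j) UNIV) UNIV" .
  have r: "infsum (f i) UNIV = (\<Sum>j. f i j)" "infsum (\<lambda>j. f j i) UNIV = (\<Sum>j. f j i)" for i
    by (rule un(2)[OF _ b(1), of _ "C * a i"] un(2)[OF _ a(1), of _ "C * b i"], use f in \<open>simp add: mult_ac\<close>)+
  show ?thesis
    using s unfolding r un(2)[OF Ca(1) a(1)] un(2)[OF Ca(2) b(1)] .
qed

section \<open>Continuity of multilinear functionals\<close>

context graded_sections
begin

abbreviation sn_list :: "nat \<Rightarrow> 'v list \<Rightarrow> real" where
  "sn_list m vs \<equiv> prod_list (map (sn B m) vs)"

lemma sn_list_nonneg: "0 \<le> sn_list m vs"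
  by (induction vs) auto

lemma sn_list_mono: "m \<le> n \<Longrightarrow> sn_list m vs \<le> sn_list n vs"
  by (induction vs) (auto intro!: mult_mono sn_mono sn_list_nonneg)

definition cont_fnl :: "'v fnl \<Rightarrow> bool" where
  "cont_fnl \<phi> \<longleftrightarrow> (\<forall>n. \<exists>m C. \<forall>vs. length vs = n \<longrightarrow> \<bar>\<phi> vs\<bar> \<le> C * sn_list m vs)"

lemma cont_fnlE:
  assumes "cont_fnl \<phi>"
  obtains m C where "0 \<le> C" "\<And>vs. length vs = n \<Longrightarrow> \<bar>\<phi> vs\<bar> \<le> C * sn_list m vs"
proof -
  obtain m C where C: "\<And>vs. length vs = n \<Longrightarrow> \<bar>\<phi> vs\<bar> \<le> C * sn_list m vs"
    using assms unfolding cont_fnl_def by meson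
  have "\<bar>\<phi> vs\<bar> \<le> \<bar>C\<bar> * sn_list m vs" if "length vs = n" for vs
    using C[OF that] mult_right_mono[OF abs_ge_self[of C] sn_list_nonneg[of m vs]] by linarith
  then show ?thesis
    using that[of "\<bar>C\<bar>" m] by simp
qed

text \<open>A product evaluates its factors on sublists of every length, so one seminorm and one
  constant must serve all lengths up to \<open>n\<close>.\<close>

lemma cont_fnl_up_to:
  assumes "cont_fnl \<phi>"
  shows "\<exists>m C. 0 \<le> C \<and> (\<forall>vs. length vs \<le> n \<longrightarrow> \<bar>\<phi> vs\<bar> \<le> C * sn_list m vs)"
proof (induction n)
  case 0
  show ?case
    by (rule cont_fnlE[OF assms, of 0]) (metis le_zero_eq)
next
  case (Suc n)
  then obtain m C where C: "0 \<le> C" "\<And>vs. length vs \<le> n \<Longrightarrow> \<bar>\<phi> vs\<bar> \<le> C * sn_list m vs"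
    by meson
  obtain k E where E: "0 \<le> E" "\<And>vs. length vs = Suc n \<Longrightarrow> \<bar>\<phi> vs\<bar> \<le> E * sn_list k vs"
    by (rule cont_fnlE[OF assms]) (rule that)
  have "\<bar>\<phi> vs\<bar> \<le> (C + E) * sn_list (max m k) vs" if "length vs \<le> Suc n" for vs
  proof -
    have b: "C * sn_list m vs \<le> C * sn_list (max m k) vs" "E * sn_list k vs \<le> E * sn_list (max m k) vs"
      by (intro mult_left_mono sn_list_mono C E; simp)+
    have nn: "0 \<le> C * sn_list (max m k) vs" "0 \<le> E * sn_list (max m k) vs"
      by (intro mult_nonneg_nonneg C E sn_list_nonneg)+
    show ?thesis
    proof (cases "length vs \<le> n")
      case True
      with C(2)[OF True] b nn show ?thesis by (simp add: distrib_right)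
    next
      case False
      then have "length vs = Suc n" using that by simp
      from E(2)[OF this] b nn show ?thesis by (simp add: distrib_right)
    qed
  qed
  then show ?case
    using C(1) E(1) by (intro exI[of _ "max m k"] exI[of _ "C + E"]) simp
qed

lemma cont_fnl_add:
  assumes \<phi>: "cont_fnl \<phi>" and \<psi>: "cont_fnl \<psi>"
  shows "cont_fnl (\<lambda>vs. \<phi> vs + \<psi> vs)"
  unfolding cont_fnl_def
proof
  fix n
  obtain m C where C: "0 \<le> C" "\<And>vs. length vs = n \<Longrightarrow> \<bar>\<phi> vs\<bar> \<le> C * sn_list m vs"
    by (rule cont_fnlE[OF \<phi>]) (rule that)
  obtain k E where E: "0 \<le> E" "\<And>vs. length vs = n \<Longrightarrow> \<bar>\<psi> vs\<bar> \<le> E * sn_list k vs"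
    by (rule cont_fnlE[OF \<psi>]) (rule that)
  have "\<bar>\<phi> vs + \<psi> vs\<bar> \<le> (C + E) * sn_list (max m k) vs" if "length vs = n" for vs
  proof -
    have "C * sn_list m vs \<le> C * sn_list (max m k) vs" "E * sn_list k vs \<le> E * sn_list (max m k) vs"
      by (intro mult_left_mono sn_list_mono C E; simp)+
    then show ?thesis
      using C(2)[OF that] E(2)[OF that] by (simp add: distrib_right)
  qed
  then show "\<exists>m C. \<forall>vs. length vs = n \<longrightarrow> \<bar>\<phi> vs + \<psi> vs\<bar> \<le> C * sn_list m vs"
    by blast
qed

lemma cont_fnl_scale:
  assumes \<phi>: "cont_fnl \<phi>"
  shows "cont_fnl (\<lambda>vs. c * \<phi> vs)"
  unfolding cont_fnl_def
proof
  fix n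
  obtain m C where C: "0 \<le> C" "\<And>vs. length vs = n \<Longrightarrow> \<bar>\<phi> vs\<bar> \<le> C * sn_list m vs"
    by (rule cont_fnlE[OF \<phi>]) (rule that)
  have "\<bar>c * \<phi> vs\<bar> \<le> (\<bar>c\<bar> * C) * sn_list m vs" if "length vs = n" for vs
    using mult_left_mono[OF C(2)[OF that], of "\<bar>c\<bar>"] by (simp add: abs_mult mult.assoc)
  then show "\<exists>m C. \<forall>vs. length vs = n \<longrightarrow> \<bar>c * \<phi> vs\<bar> \<le> C * sn_list m vs"
    by blast
qed

lemma cont_fnl_map:
  assumes \<phi>: "cont_fnl \<phi>" and A: "cont_linear B A"
  shows "cont_fnl (\<lambda>vs. \<phi> (map A vs))"
  unfolding cont_fnl_def
proof
  fix n
  obtain m C where C: "0 \<le> C" "\<And>vs. length vs = n \<Longrightarrow> \<bar>\<phi> vs\<bar> \<le> C * sn_list m vs"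
    by (rule cont_fnlE[OF \<phi>]) (rule that)
  obtain k a where a: "0 \<le> a" "\<And>v. sn B m (A v) \<le> a * sn B k v"
    by (rule cont_linearE[OF A]) (rule that)
  have l: "sn_list m (map A vs) \<le> a ^ length vs * sn_list k vs" for vs
  proof (induction vs)
    case (Cons v vs)
    have "sn_list m (map A (v # vs)) \<le> (a * sn B k v) * (a ^ length vs * sn_list k vs)"
      unfolding list.map prod_list.Cons by (intro mult_mono Cons a sn_list_nonneg mult_nonneg_nonneg sn_nonneg)
    then show ?case by (simp add: mult_ac)
  qed simp
  have "\<bar>\<phi> (map A vs)\<bar> \<le> (C * a ^ n) * sn_list k vs" if "length vs = n" for vs
    using C(2)[of "map A vs"] mult_left_mono[OF l[of vs] C(1)] that by (simp add: mult.assoc)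
  then show "\<exists>m C. \<forall>vs. length vs = n \<longrightarrow> \<bar>\<phi> (map A vs)\<bar> \<le> C * sn_list m vs"
    by blast
qed

text \<open>Each vector opens three branches in the recursion, whence \<open>3 ^ length vs\<close>.
  The parity operator preserves every seminorm, so even and odd parts are no larger than the vector
  they come from.\<close>

lemma fmult_bound:
  assumes "\<And>us. length us \<le> length vs \<Longrightarrow> \<bar>\<phi> us\<bar> \<le> C * sn_list m us"
    and "\<And>us. length us \<le> length vs \<Longrightarrow> \<bar>\<psi> us\<bar> \<le> E * sn_list m us"
    and "0 \<le> C" "0 \<le> E"
  shows "\<bar>fmult (parity B) \<phi> \<psi> vs\<bar> \<le> 3 ^ length vs * C * E * sn_list m vs"
  using assms
proof (induction vs arbitrary: \<phi> \<psi> C E)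
  case Nil
  have "\<bar>\<phi> []\<bar> * \<bar>\<psi> []\<bar> \<le> C * E"
    using Nil(1)[of "[]"] Nil(2)[of "[]"] Nil(3,4) by (intro mult_mono) auto
  then show ?case by (simp add: abs_mult)
next
  case (Cons v vs)
  let ?K = "3 ^ length vs * C * E * sn_list m (v # vs)"
  have par: "sn_list m (map (parity B) us) = sn_list m us" for us
    by (induction us) auto
  have half: "sn B m ((1/2) *\<^sub>R (v + parity B v)) \<le> sn B m v" "sn B m ((1/2) *\<^sub>R (v - parity B v)) \<le> sn B m v"
    using sn_triangle[of m v "parity B v"] sn_triangle_diff[of m v "parity B v"]
    by (simp_all add: sn_scaleR)
  have 1: "\<bar>fmult (parity B) (\<lambda>us. \<phi> (x # us)) \<psi>' vs\<bar> \<le> ?K"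
    if x: "sn B m x \<le> sn B m v" and \<psi>': "\<And>us. length us \<le> length vs \<Longrightarrow> \<bar>\<psi>' us\<bar> \<le> E * sn_list m us" for x \<psi>'
  proof -
    have "\<bar>\<phi> (x # us)\<bar> \<le> (C * sn B m v) * sn_list m us" if "length us \<le> length vs" for us
    proof -
      have "\<bar>\<phi> (x # us)\<bar> \<le> C * (sn B m x * sn_list m us)"
        using Cons.prems(1)[of "x # us"] that by simp
      also have "\<dots> \<le> C * (sn B m v * sn_list m us)"
        by (intro mult_left_mono mult_right_mono x Cons.prems sn_list_nonneg)
      finally show ?thesis by (simp add: mult.assoc)
    qed
    from Cons.IH[OF this \<psi>'] Cons.prems(3,4) show ?thesis
      by (simp add: mult_ac)
  qed
  have 2: "\<bar>\<psi> (v # us)\<bar> \<le> (E * sn B m v) * sn_list m us" if "length us \<le> length vs" for us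
    using Cons.prems(2)[of "v # us"] that by (simp add: mult.assoc)
  have "\<bar>fmult (parity B) \<phi> (\<lambda>us. \<psi> (v # us)) vs\<bar> \<le> ?K"
    using Cons.IH[of \<phi> C "\<lambda>us. \<psi> (v # us)" "E * sn B m v", OF Cons.prems(1) 2] Cons.prems(3,4)
    by (simp add: mult_ac)
  moreover have "\<bar>fmult (parity B) (\<lambda>us. \<phi> ((1/2) *\<^sub>R (v + parity B v) # us)) \<psi> vs\<bar> \<le> ?K"
    using Cons.prems(2) by (intro 1 half) simp
  moreover have "\<bar>fmult (parity B) (\<lambda>us. \<phi> ((1/2) *\<^sub>R (v - parity B v) # us)) (\<lambda>us. \<psi> (map (parity B) us)) vs\<bar> \<le> ?K"
  proof (intro 1 half)
    show "\<bar>\<psi> (map (parity B) us)\<bar> \<le> E * sn_list m us" if "length us \<le> length vs" for us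
      using Cons.prems(2)[of "map (parity B) us"] that by (simp only: par length_map) simp
  qed
  ultimately have "\<bar>fmult (parity B) \<phi> \<psi> (v # vs)\<bar> \<le> ?K + ?K + ?K"
    unfolding fmult.simps by linarith
  then show ?case by (simp add: algebra_simps)
qed

lemma cont_fnl_fmult:
  assumes \<phi>: "cont_fnl \<phi>" and \<psi>: "cont_fnl \<psi>"
  shows "cont_fnl (fmult (parity B) \<phi> \<psi>)"
  unfolding cont_fnl_def
proof
  fix n
  obtain m C where C: "0 \<le> C" "\<And>vs. length vs \<le> n \<Longrightarrow> \<bar>\<phi> vs\<bar> \<le> C * sn_list m vs"
    using cont_fnl_up_to[OF \<phi>] by meson
  obtain k E where E: "0 \<le> E" "\<And>vs. length vs \<le> n \<Longrightarrow> \<bar>\<psi> vs\<bar> \<le> E * sn_list k vs"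
    using cont_fnl_up_to[OF \<psi>] by meson
  have "\<bar>\<phi> vs\<bar> \<le> C * sn_list (max m k) vs" "\<bar>\<psi> vs\<bar> \<le> E * sn_list (max m k) vs" if "length vs \<le> n" for vs
    using C(2)[OF that] E(2)[OF that] mult_left_mono[OF sn_list_mono[of m "max m k" vs] C(1)]
      mult_left_mono[OF sn_list_mono[of k "max m k" vs] E(1)] by simp_all
  then have "\<bar>fmult (parity B) \<phi> \<psi> vs\<bar> \<le> (3 ^ n * C * E) * sn_list (max m k) vs" if "length vs = n" for vs
    using fmult_bound[of vs \<phi> C "max m k" \<psi> E] C(1) E(1) that by simp
  then show "\<exists>m C. \<forall>vs. length vs = n \<longrightarrow> \<bar>fmult (parity B) \<phi> \<psi> vs\<bar> \<le> C * sn_list m vs"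
    by blast
qed

lemma odd_der_bound:
  fixes a C :: real
  assumes "\<And>us. length us = length vs \<Longrightarrow> \<bar>\<phi> us\<bar> \<le> C * sn_list m us" "0 \<le> C"
    and A: "\<And>v. sn B m (A v) \<le> a * sn B k v" "0 \<le> a" and mk: "m \<le> k"
  shows "\<bar>odd_der (parity B) A \<phi> vs\<bar> \<le> length vs * a * C * sn_list k vs"
  using assms(1,2)
proof (induction vs arbitrary: \<phi> C)
  case Nil
  show ?case by (simp add: odd_der_Nil)
next
  case (Cons v vs)
  have par: "sn_list m (map (parity B) vs) = sn_list m vs"
    by (induction vs) auto
  have "\<bar>\<phi> (A (parity B v) # map (parity B) vs)\<bar> \<le> C * (sn B m (A (parity B v)) * sn_list m vs)"
    using Cons.prems(1)[of "A (parity B v) # map (parity B) vs"] by (simp only: par list.map prod_list.Cons length_map length_Cons simp_thms)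
  also have "\<dots> \<le> C * ((a * sn B k v) * sn_list k vs)"
    using A(1)[of "parity B v"] A(2) by (intro mult_left_mono mult_mono sn_list_mono[OF mk] Cons.prems sn_list_nonneg) simp_all
  finally have 1: "\<bar>\<phi> (A (parity B v) # map (parity B) vs)\<bar> \<le> a * C * sn_list k (v # vs)"
    by (simp add: mult_ac)
  have "\<bar>odd_der (parity B) A (\<lambda>us. \<phi> (v # us)) vs\<bar> \<le> length vs * a * (C * sn B m v) * sn_list k vs"
  proof (rule Cons.IH)
    show "\<bar>\<phi> (v # us)\<bar> \<le> C * sn B m v * sn_list m us" if "length us = length vs" for us
      using Cons.prems(1)[of "v # us"] that by (simp add: mult.assoc)
  qed (simp add: Cons.prems)
  also have "\<dots> \<le> length vs * a * (C * sn B k v) * sn_list k vs"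
    using A(2) Cons.prems(2) by (intro mult_right_mono mult_left_mono sn_mono mk sn_list_nonneg) auto
  finally show ?case
    using 1 unfolding odd_der_Cons by (simp add: algebra_simps)
qed

lemma cont_fnl_odd_der:
  assumes \<phi>: "cont_fnl \<phi>" and A: "cont_linear B A"
  shows "cont_fnl (odd_der (parity B) A \<phi>)"
  unfolding cont_fnl_def
proof
  fix n
  obtain m C where C: "0 \<le> C" "\<And>vs. length vs = n \<Longrightarrow> \<bar>\<phi> vs\<bar> \<le> C * sn_list m vs"
    by (rule cont_fnlE[OF \<phi>]) (rule that)
  obtain k a where a: "0 \<le> a" "\<And>v. sn B m (A v) \<le> a * sn B k v"
    by (rule cont_linearE[OF A]) (rule that)
  have a': "sn B m (A v) \<le> a * sn B (max m k) v" for v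
    using a(2)[of v] mult_left_mono[OF sn_mono[of k "max m k" v] a(1)] by simp
  have "\<bar>odd_der (parity B) A \<phi> vs\<bar> \<le> (n * a * C) * sn_list (max m k) vs" if "length vs = n" for vs
    using odd_der_bound[where vs = vs and \<phi> = \<phi> and C = C and m = m and A = A and a = a and k = "max m k"] C a(1) a' that by simp
  then show "\<exists>m C. \<forall>vs. length vs = n \<longrightarrow> \<bar>odd_der (parity B) A \<phi> vs\<bar> \<le> C * sn_list m vs"
    by blast
qed

lemma bilinear_plus:
  assumes "bilinear \<beta>" "bilinear \<delta>"
  shows "bilinear (\<lambda>x y. \<beta> x y + \<delta> x y)"
  using assms unfolding bilinear_def by (auto intro: linear_compose_add)

lemma gsymmetric_parity_iff:
  assumes ml: "multilinear \<phi>"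
  shows "gsymmetric (parity B) \<phi> \<longleftrightarrow> (\<forall>xs ys k l. \<forall>u\<in>homog B k. \<forall>w\<in>homog B l.
        \<phi> (xs @ [u, w] @ ys) = (-1) powi (k * l) * \<phi> (xs @ [w, u] @ ys))" (is "_ \<longleftrightarrow> ?R")
proof
  assume s: "gsymmetric (parity B) \<phi>"
  show ?R
  proof (intro allI ballI)
    fix xs ys k l u w assume u: "u \<in> homog B k" and w: "w \<in> homog B l"
    show "\<phi> (xs @ [u, w] @ ys) = (-1) powi (k * l) * \<phi> (xs @ [w, u] @ ys)"
    proof (cases "even l")
      case True
      then have "parity B w = w" by (simp add: parity_homog'[OF w])
      from gsymmetricD(1)[OF s this] True show ?thesis by simp
    next
      case False
      then have "parity B w = - w" by (simp add: parity_homog'[OF w])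
      from gsymmetricD(2)[OF s this] False show ?thesis
        using multilinearD(3)[OF ml, of "xs @ [w]" "(-1) powi k" u ys]
        by (simp add: parity_homog'[OF u] power_int_minus_left)
    qed
  qed
next
  assume R: ?R
  have bl: "bilinear (\<lambda>u w. \<phi> (xs @ u # w # ys))" for xs ys
    unfolding bilinear_def using multilinear_linear[OF ml, of xs] multilinear_linear[OF ml, of "xs @ [_]"] by auto
  let ?e = "\<lambda>w. (1/2) *\<^sub>R (w + parity B w)" and ?d = "\<lambda>w. (1/2) *\<^sub>R (w - parity B w)"
  have lin: "linear ?e" "linear ?d"
    by (rule linearI; simp add: linear_add[OF parity_linear] linear_cmul[OF parity_linear] algebra_simps)+
  \<comment> \<open>A form of the exchange rule without parity condition on \<open>w\<close>: both
    sides are bilinear in \<open>u\<close> and \<open>w\<close>, so homogeneous vectors suffice. For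
    \<open>w\<close> of pure parity one of the two summands vanishes, which gives the two rules of
    \<open>gsymmetric\<close>.\<close>
  have key: "\<phi> (xs @ u # w # ys) = \<phi> (xs @ ?e w # u # ys) + \<phi> (xs @ ?d w # parity B u # ys)" for xs ys u w
  proof (rule bilinear_homog_eqI[of "\<lambda>u w. \<phi> (xs @ u # w # ys)"
      "\<lambda>u w. \<phi> (xs @ ?e w # u # ys) + \<phi> (xs @ ?d w # parity B u # ys)", OF bl])
    have "bilinear (\<lambda>u w. \<phi> (xs @ ?e w # u # ys))" "bilinear (\<lambda>u w. \<phi> (xs @ ?d w # parity B u # ys))"
      using bilinear_comp[OF bl lin(1) linear_ident] bilinear_comp[OF bl lin(2) parity_linear]
      unfolding bilinear_def by blast+
    then show "bilinear (\<lambda>u w. \<phi> (xs @ ?e w # u # ys) + \<phi> (xs @ ?d w # parity B u # ys))"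
      by (rule bilinear_plus)
    fix k l u w assume u: "u \<in> homog B k" and w: "w \<in> homog B l"
    have *: "\<phi> (xs @ u # w # ys) = (-1) powi (k * l) * \<phi> (xs @ w # u # ys)"
    proof -
      have "\<phi> (xs @ [u, w] @ ys) = (-1) powi (k * l) * \<phi> (xs @ [w, u] @ ys)"
        using R u w by blast
      then show ?thesis by (simp only: append_Cons append_Nil)
    qed
    have z: "\<phi> (xs @ 0 # us) = 0" for us
      using multilinearD(3)[OF ml, of xs 0 0 us] by simp
    show "\<phi> (xs @ u # w # ys) = \<phi> (xs @ ?e w # u # ys) + \<phi> (xs @ ?d w # parity B u # ys)"
      unfolding * parity_homog'[OF w] parity_homog'[OF u]
      using multilinearD(3)[OF ml, of "xs @ [w]" "(-1) powi k" u ys]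
      by (cases "even l") (simp_all add: z scaleR_half_double power_int_minus_left
          del: scaleR_right_diff_distrib scaleR_right_distrib)
  qed
  have half: "(1/2) *\<^sub>R (w - - w) = w" "(1/2) *\<^sub>R (w + - w) = 0 *\<^sub>R w" "(1/2) *\<^sub>R (w + w) = w" "(1/2) *\<^sub>R (w - w) = 0 *\<^sub>R w" for w :: 'v
    by (simp_all only: diff_minus_eq_add scaleR_half_double) simp_all
  show "gsymmetric (parity B) \<phi>"
    unfolding gsymmetric_def
  proof (intro allI conjI impI)
    fix xs ys u w
    show "\<phi> (xs @ u # w # ys) = \<phi> (xs @ w # u # ys)" if "parity B w = w"
      unfolding key[of xs u w ys] that half by (simp only: multilinearD(3)[OF ml] mult_zero_left add_0_right)
    show "\<phi> (xs @ u # w # ys) = \<phi> (xs @ w # parity B u # ys)" if "parity B w = - w"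
      unfolding key[of xs u w ys] that half by (simp only: multilinearD(3)[OF ml] mult_zero_left add_0_left)
  qed
qed

lemma sym_fnl_iff: "\<phi> \<in> sym_fnl B \<longleftrightarrow> multilinear \<phi> \<and> cont_fnl \<phi> \<and> gsymmetric (parity B) \<phi>"
proof (cases "multilinear \<phi>")
  case True
  then show ?thesis
    unfolding sym_fnl_def mem_Collect_eq gsymmetric_parity_iff[OF True] cont_fnl_def multilinear_def by simp
next
  case False
  then show ?thesis
    unfolding sym_fnl_def mem_Collect_eq multilinear_def by blast
qed

lemma sym_fnlD:
  assumes "\<phi> \<in> sym_fnl B"
  shows "multilinear \<phi>" "cont_fnl \<phi>" "gsymmetric (parity B) \<phi>"
  using assms by (simp_all add: sym_fnl_iff)

text \<open>None of the conditions relates lists of different lengths. This handles exponentials,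
  whose truncation to a finite sum depends on the length.\<close>

lemma sym_fnl_length_cong:
  assumes "\<And>n. \<exists>\<psi>\<in>sym_fnl B. \<forall>vs. length vs = n \<longrightarrow> \<phi> vs = \<psi> vs"
  shows "\<phi> \<in> sym_fnl B"
proof -
  obtain \<psi> where \<psi>: "\<And>n. \<psi> n \<in> sym_fnl B" "\<And>n vs. length vs = n \<Longrightarrow> \<phi> vs = \<psi> n vs"
    using assms by metis
  have "linear (\<lambda>v. \<phi> (xs @ [v] @ ys))" for xs ys
  proof -
    have "(\<lambda>v. \<phi> (xs @ [v] @ ys)) = (\<lambda>v. \<psi> (length xs + length ys + 1) (xs @ [v] @ ys))"
      by (rule ext, rule \<psi>(2)) simp
    then show ?thesis
      using sym_fnlD(1)[OF \<psi>(1)] by (simp add: multilinear_def)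
  qed
  moreover have "\<exists>m C. \<forall>vs. length vs = n \<longrightarrow> \<bar>\<phi> vs\<bar> \<le> C * sn_list m vs" for n
    using sym_fnlD(2)[OF \<psi>(1), of n] \<psi>(2)[of _ n] unfolding cont_fnl_def by metis
  moreover have "\<phi> (xs @ u # w # ys) = \<psi> (length xs + length ys + 2) (xs @ u # w # ys)" for xs u w ys
    by (rule \<psi>(2)) simp
  then have "gsymmetric (parity B) \<phi>"
    unfolding gsymmetric_def using gsymmetricD[OF sym_fnlD(3)[OF \<psi>(1)]] by auto
  ultimately show ?thesis
    by (simp add: sym_fnl_iff cont_fnl_def multilinear_def)
qed

lemma sym_fnl_add: "\<phi> \<in> sym_fnl B \<Longrightarrow> \<psi> \<in> sym_fnl B \<Longrightarrow> (\<lambda>vs. \<phi> vs + \<psi> vs) \<in> sym_fnl B"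
  unfolding sym_fnl_iff
proof (elim conjE, intro conjI)
  assume "multilinear \<phi>" "multilinear \<psi>"
  then show "multilinear (\<lambda>vs. \<phi> vs + \<psi> vs)"
    unfolding multilinear_def by (auto intro: linear_compose_add)
  assume "gsymmetric (parity B) \<phi>" "gsymmetric (parity B) \<psi>"
  then show "gsymmetric (parity B) (\<lambda>vs. \<phi> vs + \<psi> vs)"
    unfolding gsymmetric_def by metis
qed (rule cont_fnl_add)

lemma sym_fnl_scale: "\<phi> \<in> sym_fnl B \<Longrightarrow> (\<lambda>vs. c * \<phi> vs) \<in> sym_fnl B"
  unfolding sym_fnl_iff
proof (elim conjE, intro conjI)
  assume "multilinear \<phi>"
  then show "multilinear (\<lambda>vs. c * \<phi> vs)"
    unfolding multilinear_def by (simp add: linear_compose_scale_right[where 'b = real, simplified])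
  assume "gsymmetric (parity B) \<phi>"
  then show "gsymmetric (parity B) (\<lambda>vs. c * \<phi> vs)"
    unfolding gsymmetric_def by metis
qed (rule cont_fnl_scale)

lemma sym_fnl_supported_Nil: "(\<lambda>vs. if vs = [] then c else 0) \<in> sym_fnl B"
  unfolding sym_fnl_iff multilinear_def gsymmetric_def cont_fnl_def
  using abs_ge_self by (auto simp: linear_zero intro!: exI[of _ "\<bar>c\<bar>"] mult_nonneg_nonneg sn_list_nonneg)

lemma sym_fnl_sum:
  assumes "\<And>i. i \<in> I \<Longrightarrow> \<phi> i \<in> sym_fnl B"
  shows "(\<lambda>vs. \<Sum>i\<in>I. \<phi> i vs) \<in> sym_fnl B"
proof -
  have "(\<lambda>vs. 0) \<in> sym_fnl B"
    using sym_fnl_supported_Nil[of 0] by simp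
  then show ?thesis
    using assms by (induction I rule: infinite_finite_induct) (auto intro: sym_fnl_add)
qed

lemma sym_fnl_fmult: "\<phi> \<in> sym_fnl B \<Longrightarrow> \<psi> \<in> sym_fnl B \<Longrightarrow> fmult (parity B) \<phi> \<psi> \<in> sym_fnl B"
  unfolding sym_fnl_iff
  by (simp add: multilinear_fmult cont_fnl_fmult gsymmetric_fmult parity_linear)

lemma sym_fnl_odd_der:
  assumes "\<phi> \<in> sym_fnl B" "cont_linear B A" "\<And>v. A (parity B v) = - parity B (A v)"
  shows "odd_der (parity B) A \<phi> \<in> sym_fnl B"
  using assms unfolding sym_fnl_iff
  by (simp add: multilinear_odd_der cont_fnl_odd_der gsymmetric_odd_der parity_linear cont_linear_linear)

lemma sym_fnl_map:
  assumes "\<phi> \<in> sym_fnl B" "cont_linear B A" "\<And>v. A (parity B v) = parity B (A v)"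
  shows "(\<lambda>vs. \<phi> (map A vs)) \<in> sym_fnl B"
  using assms unfolding sym_fnl_iff
  by (simp add: multilinear_map cont_fnl_map gsymmetric_map cont_linear_linear)

section \<open>Exponentials and the weight grading\<close>

lemma hpower_sym_fnl:
  assumes "\<And>k. S k \<in> sym_fnl B"
  shows "hpower B S n k \<in> sym_fnl B"
proof (induction n arbitrary: k)
  case 0
  show ?case
    using sym_fnl_supported_Nil[of 1] sym_fnl_supported_Nil[of 0] by (cases "k = 0") simp_all
next
  case (Suc n)
  then show ?case
    by (auto simp: hmult_def[abs_def] intro!: sym_fnl_sum sym_fnl_fmult assms)
qed

text \<open>Weight is additive under products and each of the \<open>n\<close> factors has weight at
  least three.\<close>

lemma hpower_weight:
  assumes "\<And>k vs. length vs + 2 * k < 3 \<Longrightarrow> S k vs = 0" "length vs + 2 * k < 3 * n"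
  shows "hpower B S n k vs = 0"
  using assms(2)
proof (induction n arbitrary: k vs)
  case (Suc n)
  \<comment> \<open>Truncated subtraction only raises the sum of the two thresholds, and a threshold
    of zero demands nothing from its factor.\<close>
  have "fmult (parity B) (S i) (hpower B S n (k - i)) vs = 0" if i: "i \<le> k" for i
    by (rule fmult_weight[of "3 - 2 * i" _ "3 * n - 2 * (k - i)"])
      (use assms(1) Suc.IH Suc.prems i in auto)
  then show ?case by (simp add: hmult_def)
qed simp

text \<open>In polynomial degree \<open>d\<close> only the powers \<open>n \<le> d + 2 k\<close> contribute to the coefficient of
  \<open>\<hbar> ^ k\<close>, since \<open>S / \<hbar>\<close> has weight at least one.\<close>

lemma exp_over_hbar_finite:
  assumes S: "interaction B S"
  shows "exp_over_hbar B S k vs = (\<Sum>n\<le>nat (int (length vs) + 2 * k).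
    if 0 \<le> k + int n then hpower B S n (nat (k + int n)) vs / fact n else 0)"
  unfolding exp_over_hbar_def
proof (rule suminf_finite)
  fix n assume n: "n \<notin> {..nat (int (length vs) + 2 * k)}"
  \<comment> \<open>The \<open>n\<close>-th power has weight at least 3 n, and its coefficient of
    \<open>\<hbar> ^ (k + n)\<close> in degree d has weight d + 2 (k + n). The latter is below 3 n
    exactly when d + 2 k < n.\<close>
  have "hpower B S n (nat (k + int n)) vs = 0" if "0 \<le> k + int n"
    using S n that unfolding interaction_def by (intro hpower_weight) auto
  then show "(if 0 \<le> k + int n then hpower B S n (nat (k + int n)) vs / fact n else 0) = 0"
    by simp
qed simp

lemma exp_over_hbar_sym_fnl:
  assumes S: "interaction B S"
  shows "exp_over_hbar B S k \<in> sym_fnl B"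
proof (rule sym_fnl_length_cong)
  fix n
  let ?\<psi> = "\<lambda>vs. \<Sum>i\<le>nat (int n + 2 * k). (if 0 \<le> k + int i then 1 / fact i else 0) * hpower B S i (nat (k + int i)) vs"
  have "?\<psi> \<in> sym_fnl B"
    by (rule sym_fnl_sum, rule sym_fnl_scale, rule hpower_sym_fnl) (use S in \<open>simp add: interaction_def\<close>)
  moreover have "exp_over_hbar B S k vs = ?\<psi> vs" if "length vs = n" for vs
    unfolding exp_over_hbar_finite[OF S] that by (intro sum.cong) auto
  ultimately show "\<exists>\<psi>\<in>sym_fnl B. \<forall>vs. length vs = n \<longrightarrow> exp_over_hbar B S k vs = \<psi> vs"
    by (intro bexI[of _ ?\<psi>]) simp_all
qed

text \<open>Division by \<open>\<hbar> ^ n\<close> forces n \<ge> - k, while the weight forces n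
  \<le> d + 2 k in degree d; together they require d + 3 k \<ge> 0. This lower bound later makes the
  contraction series finite.\<close>

lemma exp_over_hbar_zero:
  assumes S: "interaction B S" and "int (length vs) + 3 * k < 0"
  shows "exp_over_hbar B S k vs = 0"
proof -
  have "\<not> 0 \<le> k + int n" if "n \<le> nat (int (length vs) + 2 * k)" for n
    using that assms(2) by linarith
  then show ?thesis
    unfolding exp_over_hbar_finite[OF S] by (intro sum.neutral) auto
qed

section \<open>Tensors and contractions\<close>

lemma sym_fnl_form:
  assumes \<phi>: "\<phi> \<in> sym_fnl B"
  shows "(\<lambda>x y. \<phi> (xs @ x # y # ys)) \<in> bilinear_forms B"
proof -
  obtain m C where C: "0 \<le> C"
    "\<And>vs. length vs = length xs + length ys + 2 \<Longrightarrow> \<bar>\<phi> vs\<bar> \<le> C * sn_list m vs"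
    by (rule cont_fnlE[OF sym_fnlD(2)[OF \<phi>]]) (rule that)
  have "\<bar>\<phi> (xs @ x # y # ys)\<bar> \<le> (C * sn_list m xs * sn_list m ys) * sn B m x * sn B m y" for x y
    using C(2)[of "xs @ x # y # ys"] by (simp add: mult_ac)
  moreover have "bilinear (\<lambda>x y. \<phi> (xs @ x # y # ys))"
    unfolding bilinear_def using multilinear_linear[OF sym_fnlD(1)[OF \<phi>], of xs]
      multilinear_linear[OF sym_fnlD(1)[OF \<phi>], of "xs @ [_]"] by auto
  ultimately show ?thesis
    unfolding bilinear_forms_def by blast
qed

lemma bilinear_forms_add:
  assumes \<beta>: "\<beta> \<in> bilinear_forms B" and \<delta>: "\<delta> \<in> bilinear_forms B"
  shows "(\<lambda>x y. \<beta> x y + \<delta> x y) \<in> bilinear_forms B"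
proof -
  obtain m b where b: "0 \<le> b" "\<And>x y. \<bar>\<beta> x y\<bar> \<le> b * sn B m x * sn B m y"
    by (rule bilinear_formsE[OF \<beta>]) (rule that)
  obtain n d where d: "0 \<le> d" "\<And>x y. \<bar>\<delta> x y\<bar> \<le> d * sn B n x * sn B n y"
    by (rule bilinear_formsE[OF \<delta>]) (rule that)
  have "\<bar>\<beta> x y + \<delta> x y\<bar> \<le> (b + d) * sn B (max m n) x * sn B (max m n) y" for x y
  proof -
    have "b * (sn B m x * sn B m y) \<le> b * (sn B (max m n) x * sn B (max m n) y)"
      "d * (sn B n x * sn B n y) \<le> d * (sn B (max m n) x * sn B (max m n) y)"
      by (intro mult_left_mono mult_mono sn_mono b d; simp)+
    then show ?thesis
      using b(2)[of x y] d(2)[of x y] abs_triangle_ineq[of "\<beta> x y" "\<delta> x y"]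
      unfolding distrib_right mult.assoc by linarith
  qed
  then show ?thesis
    using bilinear_plus[OF bilinear_forms_bilinear[OF \<beta>] bilinear_forms_bilinear[OF \<delta>]]
    unfolding bilinear_forms_def by blast
qed

lemma bilinear_forms_scale:
  assumes \<beta>: "\<beta> \<in> bilinear_forms B"
  shows "(\<lambda>x y. c * \<beta> x y) \<in> bilinear_forms B"
proof -
  obtain m b where b: "0 \<le> b" "\<And>x y. \<bar>\<beta> x y\<bar> \<le> b * sn B m x * sn B m y"
    by (rule bilinear_formsE[OF \<beta>]) (rule that)
  have "\<bar>c * \<beta> x y\<bar> \<le> (\<bar>c\<bar> * b) * sn B m x * sn B m y" for x y
    using mult_left_mono[OF b(2)[of x y], of "\<bar>c\<bar>"] by (simp add: abs_mult mult.assoc)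
  moreover have "bilinear (\<lambda>x y. c * \<beta> x y)"
    using bilinear_forms_bilinear[OF \<beta>] unfolding bilinear_def
    by (simp add: linear_compose_scale_right[where 'b = real, simplified])
  ultimately show ?thesis
    unfolding bilinear_forms_def by blast
qed

lemma bilinear_forms_swap:
  assumes \<beta>: "\<beta> \<in> bilinear_forms B"
  shows "(\<lambda>x y. \<beta> y x) \<in> bilinear_forms B"
proof -
  obtain m b where b: "0 \<le> b" "\<And>x y. \<bar>\<beta> x y\<bar> \<le> b * sn B m x * sn B m y"
    by (rule bilinear_formsE[OF \<beta>]) (rule that)
  have "\<bar>\<beta> y x\<bar> \<le> b * sn B m x * sn B m y" for x y
    using b(2)[of y x] by (simp add: mult_ac)
  then show ?thesis
    using bilinear_forms_bilinear[OF \<beta>] unfolding bilinear_forms_def bilinear_def by blast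
qed

text \<open>Depends on the chosen presentation: an upper bound for the projective seminorm, not that
  seminorm itself.\<close>

definition tensor_norm :: "nat \<Rightarrow> 'v tens \<Rightarrow> real" where
  "tensor_norm m P = (\<Sum>i. sn B m (fst (P i)) * sn B m (snd (P i)))"

lemma tensor_summable: "tensor B P \<Longrightarrow> summable (\<lambda>i. sn B m (fst (P i)) * sn B m (snd (P i)))"
  by (simp add: tensor_def)

lemma tensor_norm_nonneg: "tensor B P \<Longrightarrow> 0 \<le> tensor_norm m P"
  unfolding tensor_norm_def by (intro suminf_nonneg tensor_summable) auto

lemma tpair_summable:
  assumes P: "tensor B P" and \<beta>: "\<And>x y. \<bar>\<beta> x y\<bar> \<le> C * sn B m x * sn B m y"
  shows "summable (\<lambda>i. \<beta> (fst (P i)) (snd (P i)))"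
proof (rule summable_comparison_test)
  show "summable (\<lambda>i. C * (sn B m (fst (P i)) * sn B m (snd (P i))))"
    by (intro summable_mult tensor_summable P)
qed (use \<beta> in \<open>auto simp: mult.assoc\<close>)

lemma tpair_form_summable:
  assumes P: "tensor B P" and \<beta>: "\<beta> \<in> bilinear_forms B"
  shows "summable (\<lambda>i. \<beta> (fst (P i)) (snd (P i)))"
  by (rule bilinear_formsE[OF \<beta>]) (rule tpair_summable[OF P])

lemma tpair_bound:
  assumes P: "tensor B P" and \<beta>: "\<And>x y. \<bar>\<beta> x y\<bar> \<le> C * sn B m x * sn B m y"
  shows "\<bar>tpair P \<beta>\<bar> \<le> C * tensor_norm m P"
proof -
  have "norm (\<Sum>i. \<beta> (fst (P i)) (snd (P i))) \<le> (\<Sum>i. C * (sn B m (fst (P i)) * sn B m (snd (P i))))"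
    using \<beta> by (intro norm_suminf_le summable_mult tensor_summable P) (simp add: mult.assoc)
  then show ?thesis
    by (simp add: tpair_def tensor_norm_def suminf_mult tensor_summable[OF P])
qed

lemma tpair_add:
  assumes "tensor B P" "\<beta> \<in> bilinear_forms B" "\<delta> \<in> bilinear_forms B"
  shows "tpair P (\<lambda>x y. \<beta> x y + \<delta> x y) = tpair P \<beta> + tpair P \<delta>"
  unfolding tpair_def by (simp add: suminf_add[symmetric] tpair_form_summable assms)

lemma tpair_scale:
  assumes "tensor B P" "\<beta> \<in> bilinear_forms B"
  shows "tpair P (\<lambda>x y. c * \<beta> x y) = c * tpair P \<beta>"
  unfolding tpair_def by (simp add: suminf_mult tpair_form_summable assms)

lemma tensor_tmap:
  assumes P: "tensor B P" and A: "cont_linear B A" and C: "cont_linear B C"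
  shows "tensor B (tmap A C P)"
  unfolding tensor_def
proof
  fix m
  obtain n a where a: "0 \<le> a" "\<And>v. sn B m (A v) \<le> a * sn B n v"
    by (rule cont_linearE[OF A]) (rule that)
  obtain k c where c: "0 \<le> c" "\<And>v. sn B m (C v) \<le> c * sn B k v"
    by (rule cont_linearE[OF C]) (rule that)
  have "\<bar>sn B m (A x) * sn B m (C y)\<bar> \<le> (a * c) * sn B (max n k) x * sn B (max n k) y" for x y
  proof -
    have "sn B m (A x) \<le> a * sn B (max n k) x"
      using a(2)[of x] mult_left_mono[OF sn_mono[of n "max n k" x] a(1)] by simp
    moreover have "sn B m (C y) \<le> c * sn B (max n k) y"
      using c(2)[of y] mult_left_mono[OF sn_mono[of k "max n k" y] c(1)] by simp
    ultimately have "sn B m (A x) * sn B m (C y) \<le> (a * sn B (max n k) x) * (c * sn B (max n k) y)"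
      by (intro mult_mono) (auto simp: a c)
    then show ?thesis by (simp add: mult_ac)
  qed
  from tpair_summable[OF P this]
  show "summable (\<lambda>i. sn B m (fst (tmap A C P i)) * sn B m (snd (tmap A C P i)))"
    by (simp add: tmap_def)
qed

lemma tpair_tmap: "tpair (tmap A C P) \<beta> = tpair P (\<lambda>x y. \<beta> (A x) (C y))"
  by (simp add: tpair_def tmap_def)

text \<open>Parity is tested against continuous forms because a presentation may have inhomogeneous
  entries. Heat kernels will be odd, as the pairing has odd degree, and propagators even, as
  \<open>qGF\<close> is odd.\<close>

definition even_tensor :: "'v tens \<Rightarrow> bool" where
  "even_tensor P \<longleftrightarrow> (\<forall>\<beta>\<in>bilinear_forms B. tpair P (\<lambda>x y. \<beta> (parity B x) (parity B y)) = tpair P \<beta>)"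

definition odd_tensor :: "'v tens \<Rightarrow> bool" where
  "odd_tensor P \<longleftrightarrow> (\<forall>\<beta>\<in>bilinear_forms B. tpair P (\<lambda>x y. \<beta> (parity B x) (parity B y)) = - tpair P \<beta>)"

lemma even_tensorD:
  "even_tensor P \<Longrightarrow> \<beta> \<in> bilinear_forms B \<Longrightarrow> tpair P (\<lambda>x y. \<beta> (parity B x) (parity B y)) = tpair P \<beta>"
  by (simp add: even_tensor_def)

lemma odd_tensorD:
  "odd_tensor P \<Longrightarrow> \<beta> \<in> bilinear_forms B \<Longrightarrow> tpair P (\<lambda>x y. \<beta> (parity B x) (parity B y)) = - tpair P \<beta>"
  by (simp add: odd_tensor_def)

text \<open>In an odd tensor one leg is even and the other odd, so the Koszul sign is trivial and
  graded symmetry becomes plain symmetry.\<close>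

lemma odd_graded_symmetric:
  assumes P: "tensor B P" "odd_tensor P" "graded_symmetric B P" and \<beta>: "\<beta> \<in> bilinear_forms B"
  shows "tpair P (\<lambda>x y. \<beta> y x) = tpair P \<beta>"
proof -
  let ?g = "parity B" and ?I = "range (gdeg B)"
  note bl = bilinear_forms_bilinear[OF \<beta>]
  \<comment> \<open>For parity signs s and t the number (1 + s + t - s t) / 2 is - 1 when both are -
    1 and is 1 otherwise. Thus \<open>\<delta>\<close> is \<open>\<beta>\<close> with the Koszul
    sign, written without degrees.\<close>
  define \<delta> where "\<delta> = (\<lambda>x y. (1/2) * (\<beta> x y + \<beta> x (?g y) + (\<beta> (?g x) y + (-1) * \<beta> (?g x) (?g y))))"
  have forms: "(\<lambda>x y. \<beta> y x) \<in> bilinear_forms B" "(\<lambda>x y. \<beta> y (?g x)) \<in> bilinear_forms B"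
    "(\<lambda>x y. \<beta> (?g y) x) \<in> bilinear_forms B" "(\<lambda>x y. \<beta> (?g y) (?g x)) \<in> bilinear_forms B"
    using bilinear_forms_swap[OF \<beta>] bilinear_forms_swap[OF bilinear_forms_comp[OF \<beta> cont_linear_id cont_linear_parity]]
      bilinear_forms_swap[OF bilinear_forms_comp[OF \<beta> cont_linear_parity cont_linear_id]]
      bilinear_forms_swap[OF bilinear_forms_comp[OF \<beta> cont_linear_parity cont_linear_parity]] by simp_all
  have "bilinear \<delta>"
    unfolding \<delta>_def using bilinear_forms_bilinear[OF bilinear_forms_scale[OF bilinear_forms_add[OF
          bilinear_forms_add[OF \<beta> bilinear_forms_comp[OF \<beta> cont_linear_id cont_linear_parity]]
          bilinear_forms_add[OF bilinear_forms_comp[OF \<beta> cont_linear_parity cont_linear_id]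
            bilinear_forms_scale[OF bilinear_forms_comp[OF \<beta> cont_linear_parity cont_linear_parity]]]]]] .
  then have lin: "linear (\<delta> x)" "linear (\<lambda>x. \<delta> x y)" for x y
    unfolding bilinear_def by auto
  have homog: "(-1) powi (k * l) * \<beta> v w = \<delta> v w" if v: "v \<in> homog B l" and w: "w \<in> homog B k" for k l v w
    unfolding \<delta>_def parity_homog'[OF v] parity_homog'[OF w] bilinear_lmul[OF bl] bilinear_rmul[OF bl]
    by (cases "even k"; cases "even l") (simp_all add: power_int_minus_left)
  have "(\<Sum>k\<in>?I. \<Sum>l\<in>?I. (-1) powi (k * l) * \<beta> (hcomp B l y) (hcomp B k x)) = \<delta> y x" for x y
  proof -
    have "(\<Sum>k\<in>?I. \<Sum>l\<in>?I. (-1) powi (k * l) * \<beta> (hcomp B l y) (hcomp B k x)) =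
        (\<Sum>k\<in>?I. \<Sum>l\<in>?I. \<delta> (hcomp B l y) (hcomp B k x))"
      by (simp only: homog[OF hcomp_homog hcomp_homog])
    also have "\<dots> = \<delta> (\<Sum>l\<in>?I. hcomp B l y) (\<Sum>k\<in>?I. hcomp B k x)"
      by (simp only: linear_sum[OF lin(1)] linear_sum[OF lin(2)])
    finally show ?thesis by (simp only: hcomp_sum)
  qed
  then have "tpair P \<beta> = tpair P (\<lambda>x y. \<delta> y x)"
    using P(3) \<beta> unfolding graded_symmetric_def by simp
  also have "\<dots> = (1/2) * (tpair P (\<lambda>x y. \<beta> y x) + tpair P (\<lambda>x y. \<beta> y (?g x)) +
      (tpair P (\<lambda>x y. \<beta> (?g y) x) + (-1) * tpair P (\<lambda>x y. \<beta> (?g y) (?g x))))"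
    unfolding \<delta>_def
    by (simp only: tpair_scale[OF P(1)] tpair_add[OF P(1)] forms bilinear_forms_add bilinear_forms_scale)
  \<comment> \<open>Oddness cancels the two mixed terms and turns the last term into a second copy
    of the first.\<close>
  also have "\<dots> = tpair P (\<lambda>x y. \<beta> y x)"
    using odd_tensorD[OF P(2) forms(1)]
      odd_tensorD[OF P(2) forms(2)] by simp
  finally show ?thesis by simp
qed

text \<open>An even \<open>c\<close> passes both legs freely; an odd \<open>c\<close> puts a parity
  operator on each leg, and on an even tensor the two together act trivially. A general
  \<open>c\<close> is split into its even and odd parts.\<close>

lemma even_tensor_move:
  assumes P: "tensor B P" "even_tensor P" and \<phi>: "\<phi> \<in> sym_fnl B"
  shows "tpair P (\<lambda>x y. \<phi> (xs @ x # y # c # ys)) = tpair P (\<lambda>x y. \<phi> (xs @ c # x # y # ys))"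
proof -
  let ?g = "parity B"
  note ml = multilinearD[OF sym_fnlD(1)[OF \<phi>]] and s = gsymmetricD[OF sym_fnlD(3)[OF \<phi>]]
  have hom: "tpair P (\<lambda>x y. \<phi> (xs @ x # y # c # ys)) = tpair P (\<lambda>x y. \<phi> (xs @ c # x # y # ys))"
    if "?g c = c \<or> ?g c = - c" for c
    using that
  proof
    assume c: "?g c = c"
    have "\<phi> (xs @ x # y # c # ys) = \<phi> (xs @ c # x # y # ys)" for x y
      using s(1)[OF c, of "xs @ [x]" y ys] s(1)[OF c, of xs x "y # ys"] by simp
    then show ?thesis by simp
  next
    assume c: "?g c = - c"
    have "\<phi> (xs @ x # y # c # ys) = \<phi> (xs @ c # ?g x # ?g y # ys)" for x y
      using s(2)[OF c, of "xs @ [x]" y ys] s(2)[OF c, of xs x "?g y # ys"] by simp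
    then show ?thesis
      using even_tensorD[OF P(2) sym_fnl_form[OF \<phi>, of "xs @ [c]" ys]] by simp
  qed
  define e where "e = (1/2) *\<^sub>R (c + ?g c)"
  define d where "d = (1/2) *\<^sub>R (c - ?g c)"
  have ed: "?g e = e" "?g d = - d" "c = e + d"
    unfolding e_def d_def by (rule parity_parts[OF parity_linear parity_parity])+
  have forms: "(\<lambda>x y. \<phi> (xs @ x # y # z # ys)) \<in> bilinear_forms B"
    "(\<lambda>x y. \<phi> (xs @ z # x # y # ys)) \<in> bilinear_forms B" for z
    using sym_fnl_form[OF \<phi>, of xs "z # ys"] sym_fnl_form[OF \<phi>, of "xs @ [z]" ys] by simp_all
  have "\<phi> (xs @ x # y # (e + d) # ys) = \<phi> (xs @ x # y # e # ys) + \<phi> (xs @ x # y # d # ys)" for x y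
    using ml(1)[of "xs @ [x, y]"] by simp
  then show ?thesis
    unfolding ed(3) using hom[of e] hom[of d] ed(1,2)
    by (simp add: ml(1) tpair_add P(1) forms)
qed

section \<open>Contraction of functionals with a tensor\<close>

lemma partial2_eq: "partial2 B P \<phi> vs = (1/2) * tpair P (\<lambda>x y. \<phi> (vs @ [parity B x, parity B y]))"
  by (simp add: partial2_def partial_def tpair_def)

lemma partial2_form:
  assumes "\<phi> \<in> sym_fnl B"
  shows "(\<lambda>x y. \<phi> (vs @ [parity B x, parity B y])) \<in> bilinear_forms B"
  using bilinear_forms_comp[OF sym_fnl_form[OF assms, of vs "[]"] cont_linear_parity cont_linear_parity] by simp

lemma partial2_bound:
  assumes P: "tensor B P" and \<phi>: "\<And>us. length us = length vs + 2 \<Longrightarrow> \<bar>\<phi> us\<bar> \<le> C * sn_list m us"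
  shows "\<bar>partial2 B P \<phi> vs\<bar> \<le> (1/2 * C * tensor_norm m P) * sn_list m vs"
proof -
  have "\<bar>\<phi> (vs @ [parity B x, parity B y])\<bar> \<le> (C * sn_list m vs) * sn B m x * sn B m y" for x y
    using \<phi>[of "vs @ [parity B x, parity B y]"] by (simp add: mult_ac)
  from tpair_bound[OF P this] show ?thesis
    by (simp add: partial2_eq mult_ac abs_mult)
qed

lemma sym_fnl_partial2:
  assumes P: "tensor B P" and \<phi>: "\<phi> \<in> sym_fnl B"
  shows "partial2 B P \<phi> \<in> sym_fnl B"
  unfolding sym_fnl_iff
proof (intro conjI)
  note ml = multilinearD[OF sym_fnlD(1)[OF \<phi>]] and s = gsymmetricD[OF sym_fnlD(3)[OF \<phi>]]
  show "multilinear (partial2 B P \<phi>)"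
    unfolding multilinear_def
  proof (intro allI linearI)
    show "partial2 B P \<phi> (xs @ [b + c] @ ys) = partial2 B P \<phi> (xs @ [b] @ ys) + partial2 B P \<phi> (xs @ [c] @ ys)"
      for xs ys b c
      using partial2_form[OF \<phi>, of "xs @ [_] @ ys"]
      by (simp add: partial2_eq ml tpair_add[OF P])
    show "partial2 B P \<phi> (xs @ [c *\<^sub>R b] @ ys) = c *\<^sub>R partial2 B P \<phi> (xs @ [b] @ ys)"
      for xs ys b and c :: real
      using partial2_form[OF \<phi>, of "xs @ [_] @ ys"]
      by (simp add: partial2_eq ml tpair_scale[OF P])
  qed
  show "cont_fnl (partial2 B P \<phi>)"
    unfolding cont_fnl_def
  proof
    fix n
    obtain m C where C: "0 \<le> C" "\<And>vs. length vs = n + 2 \<Longrightarrow> \<bar>\<phi> vs\<bar> \<le> C * sn_list m vs"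
      by (rule cont_fnlE[OF sym_fnlD(2)[OF \<phi>]]) (rule that)
    have "\<bar>partial2 B P \<phi> vs\<bar> \<le> (1/2 * C * tensor_norm m P) * sn_list m vs" if "length vs = n" for vs
      using C(2) that by (intro partial2_bound P) simp
    then show "\<exists>m C. \<forall>vs. length vs = n \<longrightarrow> \<bar>partial2 B P \<phi> vs\<bar> \<le> C * sn_list m vs"
      by blast
  qed
  show "gsymmetric (parity B) (partial2 B P \<phi>)"
    unfolding gsymmetric_def partial2_eq
  proof (intro allI conjI impI)
    fix xs ys u w
    show "1 / 2 * tpair P (\<lambda>x y. \<phi> ((xs @ u # w # ys) @ [parity B x, parity B y])) =
      1 / 2 * tpair P (\<lambda>x y. \<phi> ((xs @ w # u # ys) @ [parity B x, parity B y]))" if "parity B w = w"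
      unfolding append_assoc append_Cons s(1)[OF that] ..
    show "1 / 2 * tpair P (\<lambda>x y. \<phi> ((xs @ u # w # ys) @ [parity B x, parity B y])) =
      1 / 2 * tpair P (\<lambda>x y. \<phi> ((xs @ w # parity B u # ys) @ [parity B x, parity B y]))" if "parity B w = - w"
      unfolding append_assoc append_Cons s(2)[OF that] ..
  qed
qed

lemma sym_fnl_partial2_power: "tensor B P \<Longrightarrow> \<phi> \<in> sym_fnl B \<Longrightarrow> (partial2 B P ^^ j) \<phi> \<in> sym_fnl B"
  by (induction j) (auto intro: sym_fnl_partial2)

lemma partial2_cong:
  assumes "\<And>us. length us = length vs + 2 \<Longrightarrow> \<phi> us = \<psi> us"
  shows "partial2 B P \<phi> vs = partial2 B P \<psi> vs"
  unfolding partial2_eq by (simp add: assms)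

lemma partial2_power_zero:
  assumes "\<And>us. length us = length vs + 2 * j \<Longrightarrow> \<phi> us = 0"
  shows "(partial2 B P ^^ j) \<phi> vs = 0"
  using assms
proof (induction j arbitrary: vs)
  case (Suc j)
  have "partial2 B P ((partial2 B P ^^ j) \<phi>) vs = partial2 B P (\<lambda>us. 0) vs"
    by (rule partial2_cong, rule Suc.IH) (rule Suc.prems, simp)
  then show ?case by (simp add: partial2_eq[of P "\<lambda>us. 0"] tpair_def)
qed simp

lemma partial2_add:
  assumes "tensor B P" "\<phi> \<in> sym_fnl B" "\<psi> \<in> sym_fnl B"
  shows "partial2 B P (\<lambda>vs. \<phi> vs + \<psi> vs) vs = partial2 B P \<phi> vs + partial2 B P \<psi> vs"
  unfolding partial2_eq by (simp add: tpair_add partial2_form assms)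

lemma partial2_scale:
  assumes "tensor B P" "\<phi> \<in> sym_fnl B"
  shows "partial2 B P (\<lambda>vs. c * \<phi> vs) vs = c * partial2 B P \<phi> vs"
  unfolding partial2_eq by (simp add: tpair_scale partial2_form assms)

lemma partial2_sum:
  assumes P: "tensor B P" and "\<And>i. i \<in> I \<Longrightarrow> \<phi> i \<in> sym_fnl B"
  shows "partial2 B P (\<lambda>vs. \<Sum>i\<in>I. c i * \<phi> i vs) vs = (\<Sum>i\<in>I. c i * partial2 B P (\<phi> i) vs)"
  using assms(2)
proof (induction I rule: infinite_finite_induct)
  case (insert i I)
  have "(\<lambda>vs. c i * \<phi> i vs) \<in> sym_fnl B" "(\<lambda>vs. \<Sum>i\<in>I. c i * \<phi> i vs) \<in> sym_fnl B"
    using insert.prems by (auto intro!: sym_fnl_scale sym_fnl_sum)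
  from partial2_add[OF P this] show ?case
    using insert partial2_scale[OF P, of "\<phi> i" "c i" vs] by simp
qed (simp_all add: partial2_eq tpair_def)

text \<open>The even pair of legs is moved past the other pair, and the two series are exchanged by
  absolute convergence. This is what brings the derivative of a power of contractions into closed
  form.\<close>

lemma partial2_commute:
  assumes P: "tensor B P" "even_tensor P" and R: "tensor B R" and \<phi>: "\<phi> \<in> sym_fnl B"
  shows "partial2 B P (partial2 B R \<phi>) vs = partial2 B R (partial2 B P \<phi>) vs"
proof -
  let ?g = "parity B"
  obtain m C where C: "0 \<le> C" "\<And>us. length us = length vs + 4 \<Longrightarrow> \<bar>\<phi> us\<bar> \<le> C * sn_list m us"
    by (rule cont_fnlE[OF sym_fnlD(2)[OF \<phi>]]) (rule that)
  let ?f = "\<lambda>i j. \<phi> (vs @ [?g (fst (P i)), ?g (snd (P i)), ?g (fst (R j)), ?g (snd (R j))])"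
  let ?n = "\<lambda>P i. sn B m (fst (P i)) * sn B m (snd (P i))"
  have "\<bar>?f i j\<bar> \<le> (C * sn_list m vs) * ?n P i * ?n R j" for i j
    using C(2)[of "vs @ [?g (fst (P i)), ?g (snd (P i)), ?g (fst (R j)), ?g (snd (R j))]"]
    by (simp add: mult_ac)
  then have swap: "(\<Sum>i. \<Sum>j. ?f i j) = (\<Sum>j. \<Sum>i. ?f i j)"
    by (rule suminf_swap_bounded[rotated 4]) (auto intro: tensor_summable P R)
  have move: "tpair P (\<lambda>x y. \<phi> (vs @ [?g x, ?g y, a, b])) = tpair P (\<lambda>x y. \<phi> (vs @ [a, b, ?g x, ?g y]))" for a b
  proof -
    have e: "tpair P (\<lambda>x y. \<phi> (xs @ ?g x # ?g y # ys)) = tpair P (\<lambda>x y. \<phi> (xs @ x # y # ys))" for xs ys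
      by (rule even_tensorD[OF P(2) sym_fnl_form[OF \<phi>]])
    show ?thesis
      using even_tensor_move[OF P \<phi>, of vs a "[b]"] even_tensor_move[OF P \<phi>, of "vs @ [a]" b "[]"]
        e[of vs "[a, b]"] e[of "vs @ [a, b]" "[]"] by simp
  qed
  \<comment> \<open>The double contraction as an iterated series. The factor 2 clears the inner 1/2
    under the outer pairing, leaving 1/4 in front.\<close>
  have dbl: "partial2 B Q (partial2 B T \<phi>) vs = (1/4) * (\<Sum>i. \<Sum>j.
      \<phi> (vs @ [?g (fst (Q i)), ?g (snd (Q i)), ?g (fst (T j)), ?g (snd (T j))]))"
    if Q: "tensor B Q" and T: "tensor B T" for Q T
  proof -
    have "partial2 B Q (partial2 B T \<phi>) vs = (1/4) * tpair Q (\<lambda>x y. 2 * partial2 B T \<phi> (vs @ [?g x, ?g y]))"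
      unfolding tpair_scale[OF Q partial2_form[OF sym_fnl_partial2[OF T \<phi>]]]
      by (simp add: partial2_eq[of Q])
    then show ?thesis
      by (simp add: partial2_eq tpair_def)
  qed
  have "partial2 B P (partial2 B R \<phi>) vs = (1/4) * (\<Sum>j. \<Sum>i. ?f i j)"
    unfolding dbl[OF P(1) R] swap ..
  also have "\<dots> = partial2 B R (partial2 B P \<phi>) vs"
    unfolding dbl[OF R P(1)] using move by (simp add: tpair_def)
  finally show ?thesis .
qed

end

section \<open>Differentiation in the scale\<close>

text \<open>A quantitative fundamental theorem of calculus: \<open>f\<close> enters the error only
  through \<open>e\<close>, so the estimate is uniform over any family of integrands with the same
  \<open>e\<close>.\<close>

lemma has_integral_increment_bound:
  fixes f I :: "real \<Rightarrow> real"
  assumes I: "\<And>x. \<epsilon> \<le> x \<Longrightarrow> (f has_integral I x) {\<epsilon>..x}" and ab: "\<epsilon> \<le> a" "a \<le> b"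
    and c: "\<And>s. s \<in> {a..b} \<Longrightarrow> \<bar>f s - c\<bar> \<le> e" and e: "0 \<le> e"
  shows "\<bar>I b - I a - (b - a) * c\<bar> \<le> e * (b - a)"
proof -
  have b: "\<epsilon> \<le> b" using ab by simp
  have int: "f integrable_on {\<epsilon>..b}" using I[OF b] by blast
  then have "f integrable_on {a..b}"
    by (rule integrable_subinterval_real) (use ab in auto)
  moreover have "integral {\<epsilon>..a} f + integral {a..b} f = integral {\<epsilon>..b} f"
    by (rule Henstock_Kurzweil_Integration.integral_combine[OF ab int])
  ultimately have "(f has_integral I b - I a) {a..b}"
    using integral_unique[OF I[OF b]] integral_unique[OF I[OF ab(1)]] by (simp add: has_integral_iff)
  moreover have "((\<lambda>s. c) has_integral (b - a) * c) {a..b}"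
    using has_integral_const_real[of c a b] ab by simp
  ultimately have "((\<lambda>s. f s - c) has_integral I b - I a - (b - a) * c) {a..b}"
    by (rule has_integral_diff)
  from has_integral_bound_real[OF e finite.emptyI this] c ab(2) show ?thesis
    by simp
qed

context graded_sections
begin

lemma cont_linear_uminus: "cont_linear B (\<lambda>v. - v)"
  unfolding cont_linear_def using linear_uminus by (auto intro!: exI[of _ "1::real"])

text \<open>Uniform convergence on these sets is the projective tensor topology used in
  \<open>tensor_differentiable\<close>.\<close>

definition form_ball :: "nat \<Rightarrow> ('v \<Rightarrow> 'v \<Rightarrow> real) set" where
  "form_ball m = {\<beta>. bilinear \<beta> \<and> (\<forall>x y. \<bar>\<beta> x y\<bar> \<le> sn B m x * sn B m y)}"

lemma form_ballI: "bilinear \<beta> \<Longrightarrow> (\<And>x y. \<bar>\<beta> x y\<bar> \<le> sn B m x * sn B m y) \<Longrightarrow> \<beta> \<in> form_ball m"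
  by (simp add: form_ball_def)

lemma form_ballD:
  assumes "\<beta> \<in> form_ball m"
  shows "bilinear \<beta>" "\<bar>\<beta> x y\<bar> \<le> sn B m x * sn B m y"
  using assms by (simp_all add: form_ball_def)

lemma form_ball_forms: "\<beta> \<in> form_ball m \<Longrightarrow> \<beta> \<in> bilinear_forms B"
  unfolding bilinear_forms_def form_ball_def by (auto intro!: exI[of _ m] exI[of _ "1::real"])

text \<open>The difference quotient is multiplied out, so \<open>l = L\<close> needs no exception.
  Uniformity over \<open>form_ball m\<close> is essential: a contraction pairs the tensor with all
  forms obtained by freezing the other arguments.\<close>

definition tensor_deriv :: "(real \<Rightarrow> 'v tens) \<Rightarrow> 'v tens \<Rightarrow> real \<Rightarrow> bool" where
  "tensor_deriv P R L \<longleftrightarrow> tensor B R \<and> (\<forall>m. \<forall>e>0. \<exists>d>0. \<forall>l. \<bar>l - L\<bar> < d \<longrightarrow> tensor B (P l) \<and>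
     (\<forall>\<beta>\<in>form_ball m. \<bar>tpair (P l) \<beta> - tpair (P L) \<beta> - (l - L) * tpair R \<beta>\<bar> \<le> e * \<bar>l - L\<bar>))"

lemma tensor_derivD:
  assumes P: "tensor_deriv P R L"
  shows "tensor B R" "tensor B (P L)"
proof -
  show "tensor B R"
    using P unfolding tensor_deriv_def by blast
  show "tensor B (P L)"
    using P[unfolded tensor_deriv_def, THEN conjunct2, rule_format, OF zero_less_one, of undefined]
    by (elim exE conjE) simp
qed

text \<open>Rescaling by \<open>C\<close> reduces to the unit ball; for \<open>C = 0\<close> the
  form itself is zero.\<close>

lemma tensor_deriv_bound:
  assumes P: "tensor_deriv P R L" and e: "0 < e"
  obtains d where "0 < d" "\<And>l. \<bar>l - L\<bar> < d \<Longrightarrow> tensor B (P l)"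
    "\<And>l \<beta> C. \<bar>l - L\<bar> < d \<Longrightarrow> bilinear \<beta> \<Longrightarrow> 0 \<le> C \<Longrightarrow>
      (\<forall>x y. \<bar>\<beta> x y\<bar> \<le> C * sn B m x * sn B m y) \<Longrightarrow>
      \<bar>tpair (P l) \<beta> - tpair (P L) \<beta> - (l - L) * tpair R \<beta>\<bar> \<le> C * e * \<bar>l - L\<bar>"
proof -
  note R = tensor_derivD[OF P]
  obtain d where d: "0 < d" "\<And>l. \<bar>l - L\<bar> < d \<Longrightarrow> tensor B (P l)"
    "\<And>l \<beta>. \<bar>l - L\<bar> < d \<Longrightarrow> \<beta> \<in> form_ball m \<Longrightarrow>
       \<bar>tpair (P l) \<beta> - tpair (P L) \<beta> - (l - L) * tpair R \<beta>\<bar> \<le> e * \<bar>l - L\<bar>"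
    using P[unfolded tensor_deriv_def, THEN conjunct2, rule_format, OF e, of m]
    by (elim exE conjE) (erule that; blast)
  have scaled: "\<bar>tpair (P l) \<beta> - tpair (P L) \<beta> - (l - L) * tpair R \<beta>\<bar> \<le> C * e * \<bar>l - L\<bar>"
    if l: "\<bar>l - L\<bar> < d" and \<beta>: "bilinear \<beta>" and C: "0 \<le> C" "\<forall>x y. \<bar>\<beta> x y\<bar> \<le> C * sn B m x * sn B m y"
    for l \<beta> C
  proof (cases "C = 0")
    case True
    then have "\<beta> = (\<lambda>x y. 0)"
      using C(2) by (auto simp: fun_eq_iff)
    then show ?thesis
      using True by (simp add: tpair_def)
  next
    case False
    then have C': "0 < C" using C(1) by simp
    let ?\<delta> = "\<lambda>x y. (1 / C) * \<beta> x y"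
    have \<beta>': "\<beta> \<in> bilinear_forms B"
      using \<beta> C(2) unfolding bilinear_forms_def by blast
    have "\<bar>?\<delta> x y\<bar> \<le> sn B m x * sn B m y" for x y
      using C(2)[rule_format, of x y] C' by (simp add: abs_mult field_simps)
    note b = d(3)[OF l form_ballI[OF bilinear_forms_bilinear[OF bilinear_forms_scale[OF \<beta>']] this]]
    have eq: "z * a - z * b - h * (z * c) = z * (a - b - h * c)" for z a b c h :: real
      by (simp add: algebra_simps)
    have "C * \<bar>(1 / C) * (tpair (P l) \<beta> - tpair (P L) \<beta> - (l - L) * tpair R \<beta>)\<bar> \<le> C * (e * \<bar>l - L\<bar>)"
      using C' b unfolding tpair_scale[OF d(2)[OF l] \<beta>'] tpair_scale[OF R(1) \<beta>'] tpair_scale[OF R(2) \<beta>'] eq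
      by (intro mult_left_mono) simp_all
    then show ?thesis
      using C' by (simp add: abs_mult mult.assoc)
  qed
  show ?thesis
    by (rule that[OF d(1)]) (assumption | rule d(2) scaled)+
qed

text \<open>One seminorm index serves every \<open>e\<close> and all arguments of length
  \<open>n\<close>, which later allows the arguments to move with \<open>l\<close>. The index may
  depend on \<open>n\<close>, as continuity of functionals is imposed in each polynomial degree
  separately.\<close>

definition fnl_deriv :: "(real \<Rightarrow> 'v fnl) \<Rightarrow> 'v fnl \<Rightarrow> real \<Rightarrow> nat \<Rightarrow> bool" where
  "fnl_deriv \<Phi> \<Psi> L n \<longleftrightarrow> \<Psi> \<in> sym_fnl B \<and> (\<exists>m. \<forall>e>0. \<exists>d>0. \<forall>l. \<bar>l - L\<bar> < d \<longrightarrow> \<Phi> l \<in> sym_fnl B \<and>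
     (\<forall>vs. length vs = n \<longrightarrow> \<bar>\<Phi> l vs - \<Phi> L vs - (l - L) * \<Psi> vs\<bar> \<le> e * \<bar>l - L\<bar> * sn_list m vs))"

lemma fnl_deriv_sym_fnl:
  assumes "fnl_deriv \<Phi> \<Psi> L n"
  shows "\<Psi> \<in> sym_fnl B" "\<Phi> L \<in> sym_fnl B"
proof -
  show "\<Psi> \<in> sym_fnl B"
    using assms unfolding fnl_deriv_def by blast
  obtain d :: real where "0 < d" "\<And>l. \<bar>l - L\<bar> < d \<Longrightarrow> \<Phi> l \<in> sym_fnl B"
    using assms[unfolded fnl_deriv_def] by (elim exE conjE) (drule spec[of _ 1], auto)
  then show "\<Phi> L \<in> sym_fnl B" by simp
qed

lemma fnl_deriv_const:
  assumes "\<phi> \<in> sym_fnl B"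
  shows "fnl_deriv (\<lambda>l. \<phi>) (\<lambda>vs. 0) L n"
  using assms sym_fnl_supported_Nil[of 0] sn_list_nonneg
  by (auto simp: fnl_deriv_def intro!: exI[of _ "1::real"] mult_nonneg_nonneg)

text \<open>Contraction fills two arguments, hence degree \<open>n + 2\<close> in the hypothesis.
  The increment splits into the remainder of \<open>\<Phi>\<close>, the remainder of
  \<open>P\<close> tested on \<open>\<Phi> L\<close>, and a mixed second-order term; each receives a
  third of the error.\<close>

lemma fnl_deriv_partial2:
  assumes \<Phi>: "fnl_deriv \<Phi> \<Psi> L (n + 2)" and P: "tensor_deriv P R L"
  shows "fnl_deriv (\<lambda>l. partial2 B (P l) (\<Phi> l))
    (\<lambda>vs. partial2 B R (\<Phi> L) vs + partial2 B (P L) \<Psi> vs) L n"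
proof -
  note sym = fnl_deriv_sym_fnl[OF \<Phi>]
  note R = tensor_derivD[OF P]
  obtain m1 where m1: "\<And>e. 0 < e \<Longrightarrow> \<exists>d>0. \<forall>l. \<bar>l - L\<bar> < d \<longrightarrow> \<Phi> l \<in> sym_fnl B \<and>
     (\<forall>vs. length vs = n + 2 \<longrightarrow> \<bar>\<Phi> l vs - \<Phi> L vs - (l - L) * \<Psi> vs\<bar> \<le> e * \<bar>l - L\<bar> * sn_list m1 vs)"
    using \<Phi> unfolding fnl_deriv_def by blast
  obtain m2 C1 where C1: "0 \<le> C1" "\<And>vs. length vs = n + 2 \<Longrightarrow> \<bar>\<Phi> L vs\<bar> \<le> C1 * sn_list m2 vs"
    by (rule cont_fnlE[OF sym_fnlD(2)[OF sym(2)]]) (rule that)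
  obtain m3 C2 where C2: "0 \<le> C2" "\<And>vs. length vs = n + 2 \<Longrightarrow> \<bar>\<Psi> vs\<bar> \<le> C2 * sn_list m3 vs"
    by (rule cont_fnlE[OF sym_fnlD(2)[OF sym(1)]]) (rule that)
  define m where "m = max m1 (max m2 m3)"
  have le: "m1 \<le> m" "m2 \<le> m" "m3 \<le> m" by (simp_all add: m_def)
  have C1': "\<bar>\<Phi> L vs\<bar> \<le> C1 * sn_list m vs" if "length vs = n + 2" for vs
    using C1(2)[OF that] mult_left_mono[OF sn_list_mono[OF le(2)] C1(1)] by (rule order_trans)
  have C2': "\<bar>\<Psi> vs\<bar> \<le> C2 * sn_list m vs" if "length vs = n + 2" for vs
    using C2(2)[OF that] mult_left_mono[OF sn_list_mono[OF le(3)] C2(1)] by (rule order_trans)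
  define NR where "NR = tensor_norm m R"
  \<comment> \<open>Once \<open>\<bar>l - L\<bar> \<le> 1\<close>, the pairing of \<open>P l\<close>
    with a form bounded by \<open>C\<close> is at most \<open>C * N\<close>.\<close>
  define N where "N = tensor_norm m (P L) + NR + 1"
  have NR: "0 \<le> NR" and N: "0 < N"
    using tensor_norm_nonneg[OF R(1), of m] tensor_norm_nonneg[OF R(2), of m] by (simp_all add: NR_def N_def)
  let ?g = "parity B"
  have "\<exists>d>0. \<forall>l. \<bar>l - L\<bar> < d \<longrightarrow> partial2 B (P l) (\<Phi> l) \<in> sym_fnl B \<and> (\<forall>vs. length vs = n \<longrightarrow>
      \<bar>partial2 B (P l) (\<Phi> l) vs - partial2 B (P L) (\<Phi> L) vs -
        (l - L) * (partial2 B R (\<Phi> L) vs + partial2 B (P L) \<Psi> vs)\<bar> \<le> e * \<bar>l - L\<bar> * sn_list m vs)"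
    if e: "0 < e" for e :: real
  proof -
    define e1 where "e1 = e / (3 * N)"
    define e2 where "e2 = min 1 (e / (3 * (C1 + 1)))"
    have e1: "0 < e1" and e2: "0 < e2" "e2 \<le> 1" "C1 * e2 \<le> e / 3"
    proof -
      show "0 < e1" "0 < e2" "e2 \<le> 1" using e N C1(1) by (simp_all add: e1_def e2_def)
      have "C1 * e2 \<le> (C1 + 1) * (e / (3 * (C1 + 1)))"
        using C1(1) e by (intro mult_mono) (auto simp: e2_def)
      also have "\<dots> = e / 3" using C1(1) by (simp add: field_simps)
      finally show "C1 * e2 \<le> e / 3" .
    qed
    obtain d1 where d1: "0 < d1" "\<And>l. \<bar>l - L\<bar> < d1 \<Longrightarrow> \<Phi> l \<in> sym_fnl B"
      "\<And>l vs. \<bar>l - L\<bar> < d1 \<Longrightarrow> length vs = n + 2 \<Longrightarrow>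
        \<bar>\<Phi> l vs - \<Phi> L vs - (l - L) * \<Psi> vs\<bar> \<le> e1 * \<bar>l - L\<bar> * sn_list m1 vs"
      using m1[OF e1] by (elim exE conjE) (erule that; blast)
    obtain d2 where d2: "0 < d2" "\<And>l. \<bar>l - L\<bar> < d2 \<Longrightarrow> tensor B (P l)"
      "\<And>l \<beta> C. \<bar>l - L\<bar> < d2 \<Longrightarrow> bilinear \<beta> \<Longrightarrow> 0 \<le> C \<Longrightarrow>
        (\<forall>x y. \<bar>\<beta> x y\<bar> \<le> C * sn B m x * sn B m y) \<Longrightarrow>
        \<bar>tpair (P l) \<beta> - tpair (P L) \<beta> - (l - L) * tpair R \<beta>\<bar> \<le> C * e2 * \<bar>l - L\<bar>"
      by (rule tensor_deriv_bound[OF P e2(1), of m]) (rule that)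
    \<comment> \<open>The mixed term is of second order in \<open>l - L\<close> with a factor of
      about \<open>C2 * NR\<close>; this radius absorbs one of the two powers. The added ones keep
      the denominator positive.\<close>
    define d3 where "d3 = e / (3 * (NR + 1) * (C2 + 1))"
    have d3: "0 < d3" using e NR C2(1) by (simp add: d3_def)
    define d where "d = min (min d1 d2) (min 1 d3)"
    have "0 < d" using d1 d2 d3 by (simp add: d_def)
    moreover have "partial2 B (P l) (\<Phi> l) \<in> sym_fnl B" if "\<bar>l - L\<bar> < d" for l
      using that by (intro sym_fnl_partial2 d1 d2) (simp_all add: d_def)
    moreover have "\<bar>partial2 B (P l) (\<Phi> l) vs - partial2 B (P L) (\<Phi> L) vs -
        (l - L) * (partial2 B R (\<Phi> L) vs + partial2 B (P L) \<Psi> vs)\<bar> \<le> e * \<bar>l - L\<bar> * sn_list m vs"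
      if l: "\<bar>l - L\<bar> < d" and vs: "length vs = n" for l vs
    proof -
      define h where "h = l - L"
      define s where "s = sn_list m vs"
      have s: "0 \<le> s" by (simp add: s_def sn_list_nonneg)
      have h: "\<bar>l - L\<bar> < d1" "\<bar>l - L\<bar> < d2" "\<bar>h\<bar> \<le> 1" "\<bar>h\<bar> \<le> d3"
        using l by (simp_all add: d_def h_def)
      have T: "tensor B (P l)" by (rule d2(2)[OF h(2)])
      let ?\<beta> = "\<lambda>\<xi> x y. \<xi> (vs @ [?g x, ?g y])"
      let ?\<Delta> = "\<lambda>us. \<Phi> l us - \<Phi> L us - h * \<Psi> us"
      have \<Delta>: "?\<Delta> = (\<lambda>us. \<Phi> l us + (-1) * \<Phi> L us + (- h) * \<Psi> us)"
        by auto
      have \<Delta>': "?\<Delta> \<in> sym_fnl B"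
        unfolding \<Delta> by (intro sym_fnl_add sym_fnl_scale sym d1(2)[OF h(1)])
      note form = partial2_form[of _ vs]
      have bound: "\<bar>\<xi> (vs @ [?g x, ?g y])\<bar> \<le> (c * s) * sn B m x * sn B m y"
        if "\<And>us. length us = n + 2 \<Longrightarrow> \<bar>\<xi> us\<bar> \<le> c * sn_list m us" for \<xi> c x y
        using that[of "vs @ [?g x, ?g y]"] vs by (simp add: s_def mult_ac)
      have "\<bar>?\<Delta> us\<bar> \<le> (e1 * \<bar>h\<bar>) * sn_list m us" if "length us = n + 2" for us
        by (rule order_trans[OF d1(3)[OF h(1) that, folded h_def]])
          (intro mult_left_mono sn_list_mono le(1) mult_nonneg_nonneg less_imp_le[OF e1] abs_ge_zero)
      note b\<Delta> = bound[of ?\<Delta>, OF this] and b\<Phi> = bound[of "\<Phi> L", OF C1'] and b\<Psi> = bound[of \<Psi>, OF C2']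
      have nn: "0 \<le> e1 * \<bar>h\<bar> * s" "0 \<le> C1 * s" "0 \<le> C2 * s"
        using e1 C1(1) C2(1) s by simp_all
      note bil = bilinear_forms_bilinear[OF form]
      \<comment> \<open>The presentation norm of \<open>P l\<close> is not controlled as
        \<open>l\<close> varies. Only the difference from \<open>P L\<close> is estimated, from the
        derivative bound and the norm of \<open>R\<close>.\<close>
      have near: "\<bar>tpair (P l) \<beta> - tpair (P L) \<beta>\<bar> \<le> C * (NR + 1) * \<bar>h\<bar>"
        if "bilinear \<beta>" "0 \<le> C" "\<And>x y. \<bar>\<beta> x y\<bar> \<le> C * sn B m x * sn B m y" for \<beta> C
      proof -
        have "\<bar>tpair (P l) \<beta> - tpair (P L) \<beta>\<bar> \<le> C * e2 * \<bar>h\<bar> + \<bar>h * tpair R \<beta>\<bar>"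
          using d2(3)[OF h(2) that(1,2) allI[OF allI[OF that(3)]]] unfolding h_def by linarith
        also have "\<dots> \<le> C * 1 * \<bar>h\<bar> + \<bar>h\<bar> * (C * NR)"
          unfolding abs_mult NR_def using tpair_bound[OF R(1) that(3)] that(2) e2
          by (intro add_mono mult_right_mono mult_left_mono) auto
        finally show ?thesis by (simp add: algebra_simps)
      qed
      have 1: "\<bar>tpair (P l) (?\<beta> ?\<Delta>)\<bar> \<le> e / 3 * \<bar>h\<bar> * s"
      proof -
        have "\<bar>tpair (P l) (?\<beta> ?\<Delta>)\<bar> \<le> (e1 * \<bar>h\<bar> * s) * (NR + 1) * \<bar>h\<bar> + (e1 * \<bar>h\<bar> * s) * tensor_norm m (P L)"
          using near[OF bil[OF \<Delta>'] nn(1) b\<Delta>] tpair_bound[OF R(2) b\<Delta>] by linarith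
        also have "\<dots> \<le> (e1 * \<bar>h\<bar> * s) * (NR + 1) * 1 + (e1 * \<bar>h\<bar> * s) * tensor_norm m (P L)"
          using nn(1) NR h(3) by (intro add_right_mono mult_left_mono) simp_all
        also have "\<dots> = (e1 * N) * \<bar>h\<bar> * s"
          by (simp add: N_def algebra_simps)
        finally show ?thesis
          using N by (simp add: e1_def)
      qed
      have 2: "\<bar>tpair (P l) (?\<beta> (\<Phi> L)) - tpair (P L) (?\<beta> (\<Phi> L)) - h * tpair R (?\<beta> (\<Phi> L))\<bar> \<le> e / 3 * \<bar>h\<bar> * s"
      proof -
        have "\<bar>tpair (P l) (?\<beta> (\<Phi> L)) - tpair (P L) (?\<beta> (\<Phi> L)) - h * tpair R (?\<beta> (\<Phi> L))\<bar> \<le> (C1 * s) * e2 * \<bar>h\<bar>"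
          using d2(3)[OF h(2) bil[OF sym(2)] nn(2) allI[OF allI[OF b\<Phi>]]] by (simp add: h_def)
        also have "\<dots> = (C1 * e2) * (\<bar>h\<bar> * s)" by simp
        also have "\<dots> \<le> e / 3 * (\<bar>h\<bar> * s)"
          using s by (intro mult_right_mono e2) simp
        finally show ?thesis by (simp add: mult.assoc)
      qed
      have 3: "\<bar>h * (tpair (P l) (?\<beta> \<Psi>) - tpair (P L) (?\<beta> \<Psi>))\<bar> \<le> e / 3 * \<bar>h\<bar> * s"
      proof -
        have "\<bar>tpair (P l) (?\<beta> \<Psi>) - tpair (P L) (?\<beta> \<Psi>)\<bar> \<le> (C2 * s) * (NR + 1) * \<bar>h\<bar>"
          by (rule near[OF bil[OF sym(1)] nn(3) b\<Psi>])
        also have "\<dots> \<le> ((C2 + 1) * s) * (NR + 1) * d3"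
          using s NR C2(1) h(4) by (intro mult_mono mult_right_mono) simp_all
        also have "\<dots> = e / 3 * s"
        proof -
          have "a \<noteq> 0 \<Longrightarrow> b \<noteq> 0 \<Longrightarrow> (b * s) * a * (e / (3 * a * b)) = e / 3 * s" for a b :: real
            by (simp add: field_simps)
          from this[of "NR + 1" "C2 + 1"] show ?thesis
            using NR C2(1) unfolding d3_def by linarith
        qed
        finally show ?thesis
          unfolding abs_mult mult.commute[of "e / 3" "\<bar>h\<bar>"] mult.assoc
          by (rule mult_left_mono[OF _ abs_ge_zero])
      qed
      have split: "tpair (P l) (?\<beta> ?\<Delta>) = tpair (P l) (?\<beta> (\<Phi> l)) - tpair (P l) (?\<beta> (\<Phi> L)) - h * tpair (P l) (?\<beta> \<Psi>)"
      proof -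
        have "tpair (P l) (?\<beta> ?\<Delta>) = tpair (P l) (\<lambda>x y. ?\<beta> (\<Phi> l) x y + (-1) * ?\<beta> (\<Phi> L) x y + (- h) * ?\<beta> \<Psi> x y)"
          by (rule arg_cong[where f = "tpair (P l)"]) auto
        then show ?thesis
          using form[OF d1(2)[OF h(1)]] form[OF sym(2)] form[OF sym(1)]
          by (simp only: tpair_add[OF T] tpair_scale[OF T] bilinear_forms_add bilinear_forms_scale)
      qed
      have "partial2 B (P l) (\<Phi> l) vs - partial2 B (P L) (\<Phi> L) vs -
        (l - L) * (partial2 B R (\<Phi> L) vs + partial2 B (P L) \<Psi> vs) = (1/2) * (tpair (P l) (?\<beta> ?\<Delta>) +
        (tpair (P l) (?\<beta> (\<Phi> L)) - tpair (P L) (?\<beta> (\<Phi> L)) - h * tpair R (?\<beta> (\<Phi> L))) +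
        h * (tpair (P l) (?\<beta> \<Psi>) - tpair (P L) (?\<beta> \<Psi>)))"
        unfolding split partial2_eq h_def[symmetric] by (simp add: algebra_simps)
      also have "\<bar>\<dots>\<bar> \<le> (1/2) * (e / 3 * \<bar>h\<bar> * s + e / 3 * \<bar>h\<bar> * s + e / 3 * \<bar>h\<bar> * s)"
      proof -
        have "\<bar>a\<bar> \<le> z \<Longrightarrow> \<bar>b\<bar> \<le> z \<Longrightarrow> \<bar>c\<bar> \<le> z \<Longrightarrow> \<bar>(1/2) * (a + b + c)\<bar> \<le> (1/2) * (z + z + z)"
          for a b c z :: real unfolding abs_le_iff by argo
        from this[OF 1 2 3] show ?thesis .
      qed
      also have "\<dots> \<le> e * \<bar>h\<bar> * s"
        using s e by simp
      finally show ?thesis by (simp add: h_def s_def)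
    qed
    ultimately show ?thesis by blast
  qed
  then show ?thesis
    unfolding fnl_deriv_def using sym_fnl_add[OF sym_fnl_partial2[OF R(1) sym(2)] sym_fnl_partial2[OF R(2) sym(1)]]
    by blast
qed

text \<open>Since \<open>P L\<close> is even, the contraction with \<open>R\<close> can be moved to
  the outside in each term of the product rule, giving \<open>j\<close> equal terms.\<close>

lemma fnl_deriv_partial2_power:
  assumes P: "tensor_deriv P R L" "even_tensor (P L)" and \<phi>: "\<phi> \<in> sym_fnl B"
  shows "fnl_deriv (\<lambda>l. (partial2 B (P l) ^^ j) \<phi>)
    (\<lambda>vs. real j * partial2 B R ((partial2 B (P L) ^^ (j - 1)) \<phi>) vs) L n"
proof (induction j arbitrary: n)
  case 0
  show ?case using fnl_deriv_const[OF \<phi>] by simp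
next
  case (Suc j)
  note T = tensor_derivD[OF P(1)]
  have s: "(partial2 B (P L) ^^ i) \<phi> \<in> sym_fnl B" for i
    by (rule sym_fnl_partial2_power[OF T(2) \<phi>])
  have "partial2 B R ((partial2 B (P L) ^^ j) \<phi>) vs +
      partial2 B (P L) (\<lambda>vs. real j * partial2 B R ((partial2 B (P L) ^^ (j - 1)) \<phi>) vs) vs =
      real (Suc j) * partial2 B R ((partial2 B (P L) ^^ (Suc j - 1)) \<phi>) vs" for vs
  \<comment> \<open>At \<open>j = 0\<close> the truncated exponent \<open>j - 1\<close> comes with
    the factor zero.\<close>
  proof (cases j)
    case (Suc i)
    then show ?thesis
      unfolding partial2_scale[OF T(2) sym_fnl_partial2[OF T(1) s]] partial2_commute[OF T(2) P(2) T(1) s]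
      by (simp add: algebra_simps)
  qed (simp add: partial2_eq tpair_def)
  then show ?case
    using fnl_deriv_partial2[OF Suc.IH P(1), of n] by simp
qed

text \<open>Boundedness of the difference quotient on the ball of forms gives a Lipschitz estimate
  at \<open>L\<close>; this uniform continuity is what the fundamental theorem for the propagator
  consumes.\<close>

lemma tensor_differentiable_continuous:
  assumes K: "tensor_differentiable B K" and L: "0 < L" and e: "0 < e"
  obtains d where "0 < d" "\<And>s \<beta>. 0 < s \<Longrightarrow> \<bar>s - L\<bar> < d \<Longrightarrow> \<beta> \<in> form_ball m \<Longrightarrow>
      \<bar>tpair (K s) \<beta> - tpair (K L) \<beta>\<bar> \<le> e"
proof -
  have "\<exists>R. tensor B R \<and> (\<forall>m. \<forall>e>0. \<exists>d>0. \<forall>s>0. 0 < \<bar>s - L\<bar> \<and> \<bar>s - L\<bar> < d \<longrightarrow>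
        (\<forall>\<beta>. \<beta> \<in> form_ball m \<longrightarrow> \<bar>(tpair (K s) \<beta> - tpair (K L) \<beta>) / (s - L) - tpair R \<beta>\<bar> \<le> e))"
    using K[unfolded tensor_differentiable_def, rule_format, OF L]
    by (simp only: form_ball_def mem_Collect_eq)
  then obtain R where R: "tensor B R" and R': "\<forall>m. \<forall>e>0. \<exists>d>0. \<forall>s>0. 0 < \<bar>s - L\<bar> \<and> \<bar>s - L\<bar> < d \<longrightarrow>
        (\<forall>\<beta>. \<beta> \<in> form_ball m \<longrightarrow> \<bar>(tpair (K s) \<beta> - tpair (K L) \<beta>) / (s - L) - tpair R \<beta>\<bar> \<le> e)"
    by (elim exE conjE) (rule that)
  obtain d where d: "0 < d" "\<And>s \<beta>. 0 < s \<Longrightarrow> 0 < \<bar>s - L\<bar> \<Longrightarrow> \<bar>s - L\<bar> < d \<Longrightarrow> \<beta> \<in> form_ball m \<Longrightarrow>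
      \<bar>(tpair (K s) \<beta> - tpair (K L) \<beta>) / (s - L) - tpair R \<beta>\<bar> \<le> 1"
    using R'[rule_format, OF zero_less_one, of m] by (elim exE conjE) (erule that; blast)
  define N where "N = tensor_norm m R + 1"
  have N: "0 < N" using tensor_norm_nonneg[OF R, of m] by (simp add: N_def)
  have "\<bar>tpair (K s) \<beta> - tpair (K L) \<beta>\<bar> \<le> e"
    if s: "0 < s" "\<bar>s - L\<bar> < min d (e / N)" and \<beta>: "\<beta> \<in> form_ball m" for s \<beta>
  proof (cases "s = L")
    case False
    then have sL: "0 < \<bar>s - L\<bar>" by simp
    have "\<bar>tpair R \<beta>\<bar> \<le> tensor_norm m R"
      using tpair_bound[OF R, of \<beta> 1 m] form_ballD(2)[OF \<beta>] by simp
    then have "\<bar>(tpair (K s) \<beta> - tpair (K L) \<beta>) / (s - L)\<bar> \<le> N"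
      using d(2)[OF s(1) sL _ \<beta>] s(2) unfolding N_def by linarith
    then have "\<bar>tpair (K s) \<beta> - tpair (K L) \<beta>\<bar> \<le> N * \<bar>s - L\<bar>"
      using sL by (simp add: field_simps)
    also have "\<dots> \<le> e"
      using s(2) N by (simp add: field_simps)
    finally show ?thesis .
  qed (use e in simp)
  then show ?thesis
    using that[of "min d (e / N)"] d(1) e N by simp
qed

end

section \<open>The propagator: derivative and parity\<close>

context gauge_fixed_bv
begin

text \<open>The propagator is only a weak integral, so the fundamental theorem is applied to one
  form at a time; the uniform continuity of the heat kernel makes the error independent of the
  form.\<close>

lemma propagator_deriv:
  assumes K: "tensor_differentiable B K" "\<And>l. 0 < l \<Longrightarrow> tensor B (K l)" and \<epsilon>: "0 < \<epsilon>" "\<epsilon> < L"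
    and P: "\<And>l. \<epsilon> \<le> l \<Longrightarrow> is_propagator B K \<epsilon> l (P l)"
  shows "tensor_deriv P (tmap qGF (\<lambda>v. v) (K L)) L"
  unfolding tensor_deriv_def
proof (intro conjI allI impI)
  have L: "0 < L" using \<epsilon> by simp
  show "tensor B (tmap qGF (\<lambda>v. v) (K L))"
    by (rule tensor_tmap[OF K(2)[OF L] qGF_cont cont_linear_id])
  fix m and e :: real assume e: "0 < e"
  obtain n a where a: "0 \<le> a" "\<And>v. sn B m (qGF v) \<le> a * sn B n v"
    by (rule cont_linearE[OF qGF_cont]) (rule that)
  define k where "k = max m n"
  \<comment> \<open>Inserting \<open>qGF\<close> in the first slot maps \<open>form_ball m\<close>
    into \<open>a + 1\<close> times \<open>form_ball k\<close>; the added one avoids division by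
    zero.\<close>
  have ea: "0 < e / (a + 1)" using e a(1) by simp
  obtain d where d: "0 < d" "\<And>s \<beta>. 0 < s \<Longrightarrow> \<bar>s - L\<bar> < d \<Longrightarrow> \<beta> \<in> form_ball k \<Longrightarrow>
      \<bar>tpair (K s) \<beta> - tpair (K L) \<beta>\<bar> \<le> e / (a + 1)"
    by (rule tensor_differentiable_continuous[OF K(1) L ea]) (rule that)
  have "tensor B (P l) \<and> (\<forall>\<beta>\<in>form_ball m.
      \<bar>tpair (P l) \<beta> - tpair (P L) \<beta> - (l - L) * tpair (tmap qGF (\<lambda>v. v) (K L)) \<beta>\<bar> \<le> e * \<bar>l - L\<bar>)"
    if l: "\<bar>l - L\<bar> < min d (L - \<epsilon>)" for l
  proof (intro conjI ballI)
    have l\<epsilon>: "\<epsilon> \<le> l" using l by linarith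
    then show "tensor B (P l)"
      using P unfolding is_propagator_def by blast
    fix \<beta> assume \<beta>: "\<beta> \<in> form_ball m"
    note form = form_ball_forms[OF \<beta>]
    let ?\<delta> = "\<lambda>x y. \<beta> (qGF x) y"
    let ?f = "\<lambda>s. tpair (K s) ?\<delta>"
    have form': "?\<delta> \<in> bilinear_forms B"
      using bilinear_forms_comp[OF form qGF_cont cont_linear_id] .
    have b': "\<bar>(1 / (a + 1)) * \<beta> (qGF x) y\<bar> \<le> sn B k x * sn B k y" for x y
    proof -
      have "\<bar>\<beta> (qGF x) y\<bar> \<le> sn B m (qGF x) * sn B m y" by (rule form_ballD(2)[OF \<beta>])
      also have "\<dots> \<le> (a * sn B k x) * sn B k y"
        using a(2)[of x] mult_left_mono[OF sn_mono[of n k x] a(1)] a(1)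
        by (intro mult_mono sn_mono) (auto simp: k_def)
      also have "\<dots> \<le> (a + 1) * (sn B k x * sn B k y)"
        by (simp add: algebra_simps)
      finally show ?thesis
        using a(1) by (simp add: abs_mult field_simps)
    qed
    have near: "\<bar>?f s - ?f L\<bar> \<le> e" if s: "0 < s" "\<bar>s - L\<bar> < d" for s
    proof -
      have "(a + 1) * \<bar>(1 / (a + 1)) * (?f s - ?f L)\<bar> \<le> (a + 1) * (e / (a + 1))"
        using d(2)[OF s form_ballI[OF bilinear_forms_bilinear[OF bilinear_forms_scale[OF form']] b']] a(1)
        unfolding tpair_scale[OF K(2)[OF s(1)] form'] tpair_scale[OF K(2)[OF L] form']
        by (intro mult_left_mono) (simp_all add: right_diff_distrib)
      then show ?thesis
        using a(1) by (simp add: abs_mult)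
    qed
    have I: "(?f has_integral tpair (P x) \<beta>) {\<epsilon>..x}" if "\<epsilon> \<le> x" for x
      using P[OF that] form unfolding is_propagator_def tpair_tmap by blast
    have "\<bar>tpair (P l) \<beta> - tpair (P L) \<beta> - (l - L) * ?f L\<bar> \<le> e * \<bar>l - L\<bar>"
    proof (cases "L \<le> l")
      case True
      have "\<bar>tpair (P l) \<beta> - tpair (P L) \<beta> - (l - L) * ?f L\<bar> \<le> e * (l - L)"
        using True l L \<epsilon> e by (intro has_integral_increment_bound[OF I] near) auto
      then show ?thesis using True by simp
    next
      case False
      \<comment> \<open>The increment bound runs forward, so it is used from \<open>l\<close> to
        \<open>L\<close>, still with the value at \<open>L\<close> as reference, and the sign is
        reversed afterwards.\<close>
      have "\<bar>tpair (P L) \<beta> - tpair (P l) \<beta> - (L - l) * ?f L\<bar> \<le> e * (L - l)"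
        using False l l\<epsilon> L \<epsilon> e by (intro has_integral_increment_bound[OF I] near) auto
      then have "\<bar>- (tpair (P L) \<beta> - tpair (P l) \<beta> - (L - l) * ?f L)\<bar> \<le> e * \<bar>l - L\<bar>"
        unfolding abs_minus_cancel using False by simp
      moreover have "- (tpair (P L) \<beta> - tpair (P l) \<beta> - (L - l) * ?f L) =
          tpair (P l) \<beta> - tpair (P L) \<beta> - (l - L) * ?f L"
        by (simp add: algebra_simps)
      ultimately show ?thesis by simp
    qed
    then show "\<bar>tpair (P l) \<beta> - tpair (P L) \<beta> - (l - L) * tpair (tmap qGF (\<lambda>v. v) (K L)) \<beta>\<bar> \<le> e * \<bar>l - L\<bar>"
      by (simp add: tpair_tmap)
  qed
  moreover have "0 < min d (L - \<epsilon>)" using d(1) \<epsilon> by simp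
  ultimately show "\<exists>d>0. \<forall>l. \<bar>l - L\<bar> < d \<longrightarrow> tensor B (P l) \<and>
      (\<forall>\<beta>\<in>form_ball m.
      \<bar>tpair (P l) \<beta> - tpair (P L) \<beta> - (l - L) * tpair (tmap qGF (\<lambda>v. v) (K L)) \<beta>\<bar> \<le> e * \<bar>l - L\<bar>)"
    by blast
qed

text \<open>\<open>qGF\<close> anticommutes with parity, so acting on one leg of an odd tensor it
  produces an even one.\<close>

lemma odd_tensor_qGF:
  assumes "odd_tensor K" "\<beta> \<in> bilinear_forms B" "tensor B K"
  shows "tpair K (\<lambda>x y. \<beta> (\<gamma> (qGF x)) (\<gamma> y)) = tpair K (\<lambda>x y. \<beta> (qGF x) y)"
proof -
  note bl = bilinear_forms_bilinear[OF assms(2)]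
  have "\<gamma> (qGF x) = - qGF (\<gamma> x)" for x
    by (simp add: qGF_\<gamma>)
  then have "tpair K (\<lambda>x y. \<beta> (\<gamma> (qGF x)) (\<gamma> y)) = tpair K (\<lambda>x y. - \<beta> (qGF (\<gamma> x)) (\<gamma> y))"
    by (simp only: bilinear_lneg[OF bl])
  also have "\<dots> = - tpair K (\<lambda>x y. \<beta> (qGF (\<gamma> x)) (\<gamma> y))"
    using tpair_scale[OF assms(3) bilinear_forms_comp[OF assms(2)
          cont_linear_compose[OF qGF_cont cont_linear_parity] cont_linear_parity], of "-1"] by simp
  also have "\<dots> = tpair K (\<lambda>x y. \<beta> (qGF x) y)"
    unfolding odd_tensorD[OF assms(1) bilinear_forms_comp[OF assms(2) qGF_cont cont_linear_id]] by simp
  finally show ?thesis .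
qed

text \<open>The integrand is even at each scale, and uniqueness of the integral passes this on to
  the weak integral.\<close>

lemma even_propagator:
  assumes K: "\<And>l. 0 < l \<Longrightarrow> odd_tensor (K l)" "\<And>l. 0 < l \<Longrightarrow> tensor B (K l)"
    and \<epsilon>: "0 < \<epsilon>" and P: "is_propagator B K \<epsilon> L P"
  shows "even_tensor P"
  unfolding even_tensor_def
proof
  fix \<beta> assume \<beta>: "\<beta> \<in> bilinear_forms B"
  have "((\<lambda>l. tpair (K l) (\<lambda>x y. \<beta> (\<gamma> (qGF x)) (\<gamma> y))) has_integral tpair P (\<lambda>x y. \<beta> (\<gamma> x) (\<gamma> y))) {\<epsilon>..L}"
    using P[unfolded is_propagator_def, THEN conjunct2, rule_format,
        OF bilinear_forms_comp[OF \<beta> cont_linear_parity cont_linear_parity]]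
    unfolding tpair_tmap .
  then have "((\<lambda>l. tpair (K l) (\<lambda>x y. \<beta> (qGF x) y)) has_integral tpair P (\<lambda>x y. \<beta> (\<gamma> x) (\<gamma> y))) {\<epsilon>..L}"
    by (rule has_integral_eq[rotated]) (use \<epsilon> odd_tensor_qGF[OF K(1) \<beta> K(2)] in auto)
  moreover have "((\<lambda>l. tpair (K l) (\<lambda>x y. \<beta> (qGF x) y)) has_integral tpair P \<beta>) {\<epsilon>..L}"
    using P \<beta> unfolding is_propagator_def tpair_tmap by blast
  ultimately show "tpair P (\<lambda>x y. \<beta> (\<gamma> x) (\<gamma> y)) = tpair P \<beta>"
    by (rule has_integral_unique)
qed

lemma star_eq_vlim:
  "star_eq B P v w \<longleftrightarrow> vlim (\<lambda>N. \<Sum>i<N. \<omega> (snd (P i)) (\<gamma> v) *\<^sub>R fst (P i)) w sequentially"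
  by (simp add: star_eq_def vlim_def)

lemma star_eq_tmap:
  assumes "star_eq B P (C' v) w" and A: "cont_linear B A" and C: "\<And>x. \<omega> (C x) (\<gamma> v) = \<omega> x (\<gamma> (C' v))"
  shows "star_eq B (tmap A C P) v (A w)"
  using vlim_linear[OF assms(1)[unfolded star_eq_vlim] A] unfolding star_eq_vlim
  by (simp add: tmap_def C linear_sum[OF cont_linear_linear[OF A]] linear_cmul[OF cont_linear_linear[OF A]])

end

context heat_bv
begin

text \<open>Applying \<open>\<gamma>\<close> to the first leg and \<open>- \<gamma>\<close> to the
  second gives another kernel of \<open>U L\<close>: the flow commutes with \<open>\<gamma>\<close>,
  and the minus sign compensates that \<open>\<gamma>\<close> is skew for the pairing.\<close>

lemma heat_kernel_odd:
  assumes K: "is_heat_kernel B U L K" and L: "0 < L"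
  shows "odd_tensor K"
proof -
  let ?K = "tmap \<gamma> (\<lambda>x. - \<gamma> x) K"
  have c: "cont_linear B (\<lambda>x. - \<gamma> x)"
    by (rule cont_linear_compose[OF cont_linear_uminus cont_linear_parity])
  have "star_eq B ?K v (U L v)" for v
  proof -
    have "star_eq B K (\<gamma> v) (U L (\<gamma> v))"
      using K unfolding is_heat_kernel_def by blast
    from star_eq_tmap[of K \<gamma> v, OF this cont_linear_parity, of "\<lambda>x. - \<gamma> x"] show ?thesis
      using L by (simp add: U_commutes bilinear_lneg[OF \<omega>_bilinear] \<omega>_\<gamma>)
  qed
  moreover have "tensor B ?K"
    using K unfolding is_heat_kernel_def by (blast intro: tensor_tmap cont_linear_parity c)
  ultimately have eq: "tensor_eq B ?K K"
    using K unfolding is_heat_kernel_def by blast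
  show ?thesis
    unfolding odd_tensor_def
  proof
    fix \<beta> assume \<beta>: "\<beta> \<in> bilinear_forms B"
    have T: "tensor B K" using K unfolding is_heat_kernel_def by blast
    have "tpair K \<beta> = tpair K (\<lambda>x y. \<beta> (\<gamma> x) (- \<gamma> y))"
      using eq \<beta> unfolding tensor_eq_def tpair_tmap by simp
    also have "\<dots> = - tpair K (\<lambda>x y. \<beta> (\<gamma> x) (\<gamma> y))"
      using tpair_scale[OF T bilinear_forms_comp[OF \<beta> cont_linear_parity cont_linear_parity], of "-1"]
      by (simp add: bilinear_rneg[OF bilinear_forms_bilinear[OF \<beta>]])
    finally show "tpair K (\<lambda>x y. \<beta> (\<gamma> x) (\<gamma> y)) = - tpair K \<beta>" by simp
  qed
qed

text \<open>The flow on the first leg acts on the output; that on the second moves through the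
  pairing to the input by self-adjointness. The operator becomes U t U L U t, the flow at time
  \<open>L + 2 * t\<close>.\<close>

lemma heat_kernel_flow:
  assumes K: "is_heat_kernel B U L K" and K': "is_heat_kernel B U L' K'"
    and L: "0 < L" "L' = L + 2 * t" "0 \<le> t" and \<beta>: "\<beta> \<in> bilinear_forms B"
  shows "tpair K' \<beta> = tpair K (\<lambda>x y. \<beta> (U t x) (U t y))"
proof -
  let ?K = "tmap (U t) (U t) K"
  have "star_eq B ?K v (U L' v)" for v
  proof -
    have "star_eq B K (U t v) (U L (U t v))"
      using K unfolding is_heat_kernel_def by blast
    from star_eq_tmap[of K "U t" v, OF this U_cont[OF L(3)], of "U t"]
    have "star_eq B ?K v (U t (U L (U t v)))"
      using L(3) by (simp add: U_commutes \<omega>_U)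
    moreover have "U t (U L (U t v)) = U (t + (L + t)) v"
      using L by (simp only: U_add[of t "L + t"] U_add[of L t])
    ultimately show ?thesis
      using L(2) by (simp add: algebra_simps)
  qed
  moreover have "tensor B ?K"
    using K unfolding is_heat_kernel_def by (blast intro: tensor_tmap U_cont L(3))
  ultimately have "tensor_eq B ?K K'"
    using K' unfolding is_heat_kernel_def by blast
  then show ?thesis
    using \<beta> unfolding tensor_eq_def tpair_tmap by simp
qed

end

section \<open>The exact flow\<close>

lemma odd_der_append:
  "odd_der g A \<phi> (vs @ ws) =
    odd_der g A (\<lambda>us. \<phi> (us @ map g ws)) vs + odd_der g A (\<lambda>us. \<phi> (vs @ us)) ws"
  by (induction vs arbitrary: \<phi>) (simp_all add: odd_der_Nil odd_der_Cons)

lemma odd_der_compose: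
  assumes "\<And>v. h (g v) = g (h v)" "\<And>v. h (A v) = A (h v)"
  shows "odd_der g A (\<lambda>us. \<phi> (map h us)) vs = odd_der g A \<phi> (map h vs)"
  unfolding odd_der_def by (simp add: take_map drop_map assms o_def)

section \<open>Differentiating functionals at moving sections\<close>

context graded_sections
begin

lemma cont_fnl_tail:
  assumes "cont_fnl \<phi>"
  shows "cont_fnl (\<lambda>us. \<phi> (v # us))"
  unfolding cont_fnl_def
proof
  fix n
  obtain m C where C: "0 \<le> C" "\<And>vs. length vs = Suc n \<Longrightarrow> \<bar>\<phi> vs\<bar> \<le> C * sn_list m vs"
    by (rule cont_fnlE[OF assms]) (rule that)
  have "\<bar>\<phi> (v # us)\<bar> \<le> (C * sn B m v) * sn_list m us" if "length us = n" for us
    using C(2)[of "v # us"] that by (simp add: mult.assoc)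
  then show "\<exists>m C. \<forall>vs. length vs = n \<longrightarrow> \<bar>\<phi> (v # vs)\<bar> \<le> C * sn_list m vs"
    by blast
qed

lemma sn_list_tendsto:
  assumes "list_all2 (\<lambda>c l. vlim c l F) cs ls"
  shows "((\<lambda>s. sn_list m (map (\<lambda>c. c s) cs)) \<longlongrightarrow> sn_list m ls) F"
  using assms
proof (induction rule: list_all2_induct)
  case (Cons c cs l ls)
  then show ?case
    using tendsto_mult[OF vlim_sn[OF Cons(1), of m] Cons.IH] by simp
qed simp

lemma multilinear_tendsto:
  assumes "list_all2 (\<lambda>c l. vlim c l F) cs ls" "multilinear \<phi>" "cont_fnl \<phi>"
  shows "((\<lambda>s. \<phi> (map (\<lambda>c. c s) cs)) \<longlongrightarrow> \<phi> ls) F"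
  using assms
proof (induction arbitrary: \<phi> rule: list_all2_induct)
  case (Cons c cs l ls)
  obtain m C where C: "0 \<le> C" "\<And>vs. length vs = Suc (length cs) \<Longrightarrow> \<bar>\<phi> vs\<bar> \<le> C * sn_list m vs"
    by (rule cont_fnlE[OF Cons.prems(2)]) (rule that)
  let ?us = "\<lambda>s. map (\<lambda>c. c s) cs"
  have "\<bar>\<phi> ((c s - l) # ?us s)\<bar> \<le> C * (sn B m (c s - l) * sn_list m (?us s))" for s
    using C(2)[of "(c s - l) # ?us s"] by simp
  moreover have "((\<lambda>s. C * (sn B m (c s - l) * sn_list m (?us s))) \<longlongrightarrow> C * (0 * sn_list m ls)) F"
    by (intro tendsto_mult_left tendsto_mult vlimD[OF Cons(1)] sn_list_tendsto[OF Cons(2)])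
  then have z: "((\<lambda>s. C * (sn B m (c s - l) * sn_list m (?us s))) \<longlongrightarrow> 0) F"
    by simp
  ultimately have "((\<lambda>s. \<phi> ((c s - l) # ?us s)) \<longlongrightarrow> 0) F"
    by (intro Lim_null_comparison[OF always_eventually z]) simp
  moreover have "((\<lambda>s. \<phi> (l # ?us s)) \<longlongrightarrow> \<phi> (l # ls)) F"
    by (rule Cons.IH[OF multilinear_tail[OF Cons.prems(1)] cont_fnl_tail[OF Cons.prems(2)]])
  ultimately have "((\<lambda>s. \<phi> ((c s - l) # ?us s) + \<phi> (l # ?us s)) \<longlongrightarrow> 0 + \<phi> (l # ls)) F"
    by (rule tendsto_add)
  then show ?case
    by (simp add: multilinear_Cons[OF Cons.prems(1)])
qed simp

lemma multilinear_has_derivative: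
  assumes "multilinear \<phi>" "cont_fnl \<phi>" "\<And>v. v \<in> set vs \<Longrightarrow> has_vderiv (\<lambda>s. c s v) (c' v) t X"
  shows "((\<lambda>s. \<phi> (map (c s) vs)) has_real_derivative
    (\<Sum>i<length vs. \<phi> (take i (map (c t) vs) @ c' (vs ! i) # drop (Suc i) (map (c t) vs)))) (at t within X)"
  using assms
proof (induction vs arbitrary: \<phi>)
  case (Cons v vs)
  let ?q = "\<lambda>s. (1 / (s - t)) *\<^sub>R (c s v - c t v)"
  have "vlim (\<lambda>s. c s u) (c t u) (at t within X)" if "u \<in> set vs" for u
    using Cons.prems(3)[of u] that by (intro has_vderiv_vlim) simp
  moreover have "vlim ?q (c' v) (at t within X)"
    using Cons.prems(3)[of v] by (simp add: has_vderiv_def)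
  ultimately have "list_all2 (\<lambda>c l. vlim c l (at t within X)) (?q # map (\<lambda>v s. c s v) vs) (c' v # map (c t) vs)"
    by (simp add: list_all2_map1 list_all2_map2 list_all2_same)
  from multilinear_tendsto[OF this Cons.prems(1,2)]
  have 1: "((\<lambda>s. \<phi> (?q s # map (c s) vs)) \<longlongrightarrow> \<phi> (c' v # map (c t) vs)) (at t within X)"
    by (simp add: o_def)
  have 2: "((\<lambda>s. (\<phi> (c t v # map (c s) vs) - \<phi> (c t v # map (c t) vs)) / (s - t)) \<longlongrightarrow>
    (\<Sum>i<length vs. \<phi> (c t v # take i (map (c t) vs) @ c' (vs ! i) # drop (Suc i) (map (c t) vs)))) (at t within X)"
    using Cons.IH[OF multilinear_tail[OF Cons.prems(1)] cont_fnl_tail[OF Cons.prems(2)] Cons.prems(3)]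
    unfolding has_field_derivative_iff by simp
  have eq: "\<phi> (?q s # map (c s) vs) + (\<phi> (c t v # map (c s) vs) - \<phi> (c t v # map (c t) vs)) / (s - t) =
      (\<phi> (map (c s) (v # vs)) - \<phi> (map (c t) (v # vs))) / (s - t)" for s
    unfolding multilinear_Cons[OF Cons.prems(1)] list.map by (simp add: diff_divide_distrib)
  show ?case
    using tendsto_add[OF 1 2] unfolding eq has_field_derivative_iff
    by (simp add: sum.lessThan_Suc_shift del: sum.lessThan_Suc)
qed simp

text \<open>The increment splits into the remainder of \<open>\<Phi>\<close> at the moving
  arguments, the linear term \<open>\<Psi>\<close> along the curve, and \<open>\<Phi> L\<close>
  frozen along the curve. Uniformity of \<open>fnl_deriv\<close> in the arguments is used for the
  first part.\<close>

lemma fnl_deriv_along_curve: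
  assumes \<Phi>: "fnl_deriv \<Phi> \<Psi> L (length vs)" and c: "\<And>v. v \<in> set vs \<Longrightarrow> has_vderiv (\<lambda>s. c s v) (c' v) L UNIV"
  shows "((\<lambda>l. \<Phi> l (map (c l) vs)) has_real_derivative \<Psi> (map (c L) vs) +
    (\<Sum>i<length vs. \<Phi> L (take i (map (c L) vs) @ c' (vs ! i) # drop (Suc i) (map (c L) vs)))) (at L)"
proof -
  note sym = fnl_deriv_sym_fnl[OF \<Phi>]
  have lim: "list_all2 (\<lambda>c l. vlim c l (at L)) (map (\<lambda>v s. c s v) vs) (map (c L) vs)"
    using has_vderiv_vlim[OF c] by (simp add: list_all2_map1 list_all2_map2 list_all2_same)
  let ?A = "\<lambda>l. (\<Phi> l (map (c l) vs) - \<Phi> L (map (c l) vs) - (l - L) * \<Psi> (map (c l) vs)) / (l - L)"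
  obtain m where m: "\<And>e. 0 < e \<Longrightarrow> \<exists>d>0. \<forall>l. \<bar>l - L\<bar> < d \<longrightarrow> \<Phi> l \<in> sym_fnl B \<and>
     (\<forall>us. length us = length vs \<longrightarrow> \<bar>\<Phi> l us - \<Phi> L us - (l - L) * \<Psi> us\<bar> \<le> e * \<bar>l - L\<bar> * sn_list m us)"
    using \<Phi> unfolding fnl_deriv_def by blast
  \<comment> \<open>Near \<open>L\<close> the seminorms of the moving arguments multiply to less
    than \<open>M\<close>, so the uniform remainder bound stays small along the curve.\<close>
  define M where "M = sn_list m (map (c L) vs) + 1"
  have M: "0 < M" using sn_list_nonneg[of m "map (c L) vs"] by (simp add: M_def)
  have "((\<lambda>l. sn_list m (map (c l) vs)) \<longlongrightarrow> sn_list m (map (c L) vs)) (at L)"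
    using sn_list_tendsto[OF lim, of m] by (simp add: o_def)
  then have ev: "\<forall>\<^sub>F l in at L. sn_list m (map (c l) vs) < M"
    by (rule order_tendstoD) (simp add: M_def)
  have "(?A \<longlongrightarrow> 0) (at L)"
  proof (rule tendstoI)
    fix e :: real assume e: "0 < e"
    then have "0 < e / (2 * M)" using M by simp
    from m[OF this] obtain d where d: "0 < d" "\<And>l us. \<bar>l - L\<bar> < d \<Longrightarrow> length us = length vs \<Longrightarrow>
        \<bar>\<Phi> l us - \<Phi> L us - (l - L) * \<Psi> us\<bar> \<le> e / (2 * M) * \<bar>l - L\<bar> * sn_list m us"
      by (elim exE conjE) (erule that; blast)
    have "\<forall>\<^sub>F l in at L. \<bar>l - L\<bar> < d \<and> l \<noteq> L"
      using d(1) unfolding eventually_at by (auto simp: dist_real_def intro!: exI[of _ d])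
    with ev show "\<forall>\<^sub>F l in at L. dist (?A l) 0 < e"
    proof eventually_elim
      case (elim l)
      have "\<bar>\<Phi> l (map (c l) vs) - \<Phi> L (map (c l) vs) - (l - L) * \<Psi> (map (c l) vs)\<bar>
          \<le> e / (2 * M) * \<bar>l - L\<bar> * sn_list m (map (c l) vs)"
        using elim by (intro d(2)) simp_all
      also have "\<dots> \<le> e / (2 * M) * \<bar>l - L\<bar> * M"
        using e M elim by (intro mult_left_mono) simp_all
      also have "\<dots> < e * \<bar>l - L\<bar>"
        using e M elim by simp
      finally show ?case
        using elim by (simp add: dist_real_def field_simps)
    qed
  qed
  moreover have "((\<lambda>l. \<Psi> (map (c l) vs)) \<longlongrightarrow> \<Psi> (map (c L) vs)) (at L)"
    using multilinear_tendsto[OF lim sym_fnlD(1,2)[OF sym(1)]] by (simp add: o_def)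
  moreover have "((\<lambda>l. (\<Phi> L (map (c l) vs) - \<Phi> L (map (c L) vs)) / (l - L)) \<longlongrightarrow>
    (\<Sum>i<length vs. \<Phi> L (take i (map (c L) vs) @ c' (vs ! i) # drop (Suc i) (map (c L) vs)))) (at L)"
    using multilinear_has_derivative[where vs = vs and c = c and c' = c', OF sym_fnlD(1,2)[OF sym(2)] c] unfolding has_field_derivative_iff by simp
  ultimately have t: "((\<lambda>l. ?A l + (\<Psi> (map (c l) vs) + (\<Phi> L (map (c l) vs) - \<Phi> L (map (c L) vs)) / (l - L))) \<longlongrightarrow>
    0 + (\<Psi> (map (c L) vs) +
    (\<Sum>i<length vs. \<Phi> L (take i (map (c L) vs) @ c' (vs ! i) # drop (Suc i) (map (c L) vs))))) (at L)"
    by (intro tendsto_add)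
  have eq: "?A l + (\<Psi> (map (c l) vs) + (\<Phi> L (map (c l) vs) - \<Phi> L (map (c L) vs)) / (l - L)) =
      (\<Phi> l (map (c l) vs) - \<Phi> L (map (c L) vs)) / (l - L)" if "l \<noteq> L" for l
    using that by (simp add: diff_divide_distrib)
  show ?thesis
    unfolding has_field_derivative_iff
    by (rule Lim_transform_eventually[OF t[unfolded add_0_left]]) (simp add: eventually_at_filter eq)
qed

text \<open>One contraction costs a power of \<hbar> and fills two arguments, replacing d + 3 k by d
  + 2 + 3 (k - 1), which is one less. After more than d + 3 k contractions only vanishing
  coefficients are left.\<close>

lemma exp_contraction_finite:
  assumes F: "\<And>k us. int (length us) + 3 * k < 0 \<Longrightarrow> F k us = 0" and N: "int (length vs) + 3 * k \<le> int N"
  shows "exp_contraction B P F k vs = (\<Sum>j\<le>N. (-1) ^ j / fact j * (partial2 B P ^^ j) (F (k - int j)) vs)"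
  unfolding exp_contraction_def
proof (rule suminf_finite)
  fix j assume "j \<notin> {..N}"
  then have "(partial2 B P ^^ j) (F (k - int j)) vs = 0"
    using N by (intro partial2_power_zero F) simp
  then show "(-1) ^ j / fact j * (partial2 B P ^^ j) (F (k - int j)) vs = 0" by simp
qed simp

lemma exp_contraction_deriv:
  assumes P: "tensor_deriv P R L" "even_tensor (P L)"
    and F: "\<And>k. F k \<in> sym_fnl B" "\<And>k us. int (length us) + 3 * k < 0 \<Longrightarrow> F k us = 0"
    and c: "\<And>v. v \<in> set vs \<Longrightarrow> has_vderiv (\<lambda>s. c s v) (c' v) L UNIV"
  shows "((\<lambda>l. exp_contraction B (P l) F k (map (c l) vs)) has_real_derivative
    - partial2 B R (exp_contraction B (P L) F (k - 1)) (map (c L) vs) +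
    (\<Sum>i<length vs. exp_contraction B (P L) F k
      (take i (map (c L) vs) @ c' (vs ! i) # drop (Suc i) (map (c L) vs)))) (at L)"
proof -
  note T = tensor_derivD[OF P(1)]
  \<comment> \<open>Summation bounds that do not depend on \<open>l\<close>. Ending at
    \<open>Suc M\<close> for the coefficient \<open>k\<close> makes its index shift end at
    \<open>M\<close>, which is enough for the coefficient \<open>k - 1\<close> in degree d +
    2.\<close>
  define M where "M = nat (int (length vs) + 3 * k)"
  define a :: "nat \<Rightarrow> real" where "a j = (-1) ^ j / fact j" for j
  let ?A = "\<lambda>j. (partial2 B (P L) ^^ j)"
  let ?ws = "map (c L) vs"
  let ?us = "\<lambda>i. take i ?ws @ c' (vs ! i) # drop (Suc i) ?ws"
  have fin: "exp_contraction B Q F k us = (\<Sum>j\<le>Suc M. a j * (partial2 B Q ^^ j) (F (k - int j)) us)"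
    if "length us = length vs" for us Q
    unfolding a_def by (rule exp_contraction_finite[OF F(2)]) (simp_all add: that M_def)
  have fin': "exp_contraction B (P L) F (k - 1) us = (\<Sum>j\<le>M. a j * ?A j (F (k - 1 - int j)) us)"
    if "length us = length vs + 2" for us
    unfolding a_def by (rule exp_contraction_finite[OF F(2)]) (simp_all add: that M_def)
  have "((\<lambda>l. \<Sum>j\<le>Suc M. a j * (partial2 B (P l) ^^ j) (F (k - int j)) (map (c l) vs)) has_real_derivative
    (\<Sum>j\<le>Suc M. a j * (real j * partial2 B R (?A (j - 1) (F (k - int j))) ?ws +
      (\<Sum>i<length vs. ?A j (F (k - int j)) (?us i))))) (at L)"
    by (intro DERIV_sum DERIV_cmult fnl_deriv_along_curve fnl_deriv_partial2_power P F(1) c)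
  then have d: "((\<lambda>l. exp_contraction B (P l) F k (map (c l) vs)) has_real_derivative
    (\<Sum>j\<le>Suc M. a j * (real j * partial2 B R (?A (j - 1) (F (k - int j))) ?ws +
      (\<Sum>i<length vs. ?A j (F (k - int j)) (?us i))))) (at L)"
    by (simp only: fin length_map)
  \<comment> \<open>The term \<open>j = 0\<close> vanishes, and after the shift
    \<open>a (Suc j) * real (Suc j) = - a j\<close>, as for the derivative of the exponential
    series.\<close>
  have "(\<Sum>j\<le>Suc M. a j * (real j * partial2 B R (?A (j - 1) (F (k - int j))) ?ws)) =
      (\<Sum>j\<le>M. a (Suc j) * (real (Suc j) * partial2 B R (?A j (F (k - 1 - int j))) ?ws))"
    unfolding sum.atMost_Suc_shift by (simp add: algebra_simps)
  also have "\<dots> = (\<Sum>j\<le>M. - (a j * partial2 B R (?A j (F (k - 1 - int j))) ?ws))"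
  proof (rule sum.cong)
    fix j
    have "a (Suc j) * real (Suc j) = - a j"
      by (simp add: a_def field_simps del: of_nat_Suc)
    then show "a (Suc j) * (real (Suc j) * partial2 B R (?A j (F (k - 1 - int j))) ?ws) =
        - (a j * partial2 B R (?A j (F (k - 1 - int j))) ?ws)"
      by (metis mult.assoc mult_minus_left)
  qed simp
  also have "\<dots> = - partial2 B R (\<lambda>us. \<Sum>j\<le>M. a j * ?A j (F (k - 1 - int j)) us) ?ws"
    by (simp add: partial2_sum[OF T(1) sym_fnl_partial2_power[OF T(2) F(1)]] sum_negf)
  also have "\<dots> = - partial2 B R (exp_contraction B (P L) F (k - 1)) ?ws"
    by (intro arg_cong[where f = uminus] partial2_cong) (simp add: fin')
  finally have 1: "(\<Sum>j\<le>Suc M. a j * (real j * partial2 B R (?A (j - 1) (F (k - int j))) ?ws)) =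
    - partial2 B R (exp_contraction B (P L) F (k - 1)) ?ws" .
  have 2: "(\<Sum>j\<le>Suc M. a j * (\<Sum>i<length vs. ?A j (F (k - int j)) (?us i))) =
      (\<Sum>i<length vs. exp_contraction B (P L) F k (?us i))"
    unfolding sum_distrib_left by (subst sum.swap) (rule sum.cong, simp, subst fin, auto)
  show ?thesis
    using d unfolding distrib_left sum.distrib 1 2 .
qed

text \<open>Continuity of the partial sum is carried along because additivity of the pairing
  requires it in the induction step.\<close>

lemma tpair_sum:
  assumes "tensor B P" "\<And>i. i \<in> I \<Longrightarrow> \<beta> i \<in> bilinear_forms B" "finite I"
  shows "(\<lambda>x y. \<Sum>i\<in>I. \<beta> i x y) \<in> bilinear_forms B \<and> tpair P (\<lambda>x y. \<Sum>i\<in>I. \<beta> i x y) = (\<Sum>i\<in>I. tpair P (\<beta> i))"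
  using assms(3,2)
proof (induction I rule: finite_induct)
  case empty
  have "(\<lambda>x y. 0) \<in> bilinear_forms B"
    unfolding bilinear_forms_def bilinear_def by (auto simp: linear_zero intro!: exI[of _ "0::real"])
  then show ?case by (simp add: tpair_def)
next
  case (insert i I)
  then show ?case
    using bilinear_forms_add[of "\<beta> i" "\<lambda>x y. \<Sum>i\<in>I. \<beta> i x y"] tpair_add[OF assms(1), of "\<beta> i" "\<lambda>x y. \<Sum>i\<in>I. \<beta> i x y"]
    by simp
qed

end

section \<open>Commutators with the gauge fixing derivation\<close>

context gauge_fixed_bv
begin

lemma QGF_sym_fnl:
  assumes "\<phi> \<in> sym_fnl B"
  shows "QGF B \<phi> \<in> sym_fnl B"
proof -
  have "odd_der \<gamma> qGF \<phi> \<in> sym_fnl B"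
    by (rule sym_fnl_odd_der[OF assms qGF_cont qGF_\<gamma>])
  from sym_fnl_scale[OF this, of "-1"] show ?thesis
    by (simp add: QGF_def)
qed

text \<open>The minus sign in \<open>QGF\<close> cancels the one in
  \<open>odd_der_commutator\<close>.\<close>

lemma laplacian_derivation:
  assumes \<phi>: "\<phi> \<in> sym_fnl B"
  shows "(\<Sum>i<length vs. \<phi> (take i vs @ D (vs ! i) # drop (Suc i) vs)) =
    Qop B (QGF B \<phi>) vs + QGF B (Qop B \<phi>) vs"
proof -
  have "Qop B (QGF B \<phi>) vs = - odd_der \<gamma> q (odd_der \<gamma> qGF \<phi>) vs"
    using odd_der_scale[of \<gamma> q "-1" "odd_der \<gamma> qGF \<phi>" vs] by (simp add: Qop_def QGF_def)
  moreover have "QGF B (Qop B \<phi>) vs = - odd_der \<gamma> qGF (odd_der \<gamma> q \<phi>) vs"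
    by (simp add: Qop_def QGF_def)
  moreover note odd_der_commutator[of \<gamma> q qGF \<phi> vs, OF \<gamma>_linear parity_parity q_linear q_\<gamma>
      qGF_linear qGF_\<gamma> sym_fnlD(1)[OF \<phi>]]
  ultimately show ?thesis
    by (simp add: Dop_def)
qed

text \<open>Symmetry enters twice: for the functional, to exchange its last two entries, and for the
  kernel, to exchange its legs. The remaining signs cancel since \<open>qGF\<close> on one leg makes
  the kernel even.\<close>

lemma odd_tensor_qGF_swap:
  assumes K: "tensor B K" "odd_tensor K" "graded_symmetric B K" and \<phi>: "\<phi> \<in> sym_fnl B"
  shows "tpair K (\<lambda>x y. \<phi> (vs @ [\<gamma> x, qGF y])) = tpair K (\<lambda>x y. \<phi> (vs @ [qGF x, y]))"
proof -
  note ml = multilinearD[OF sym_fnlD(1)[OF \<phi>]] and s = gsymmetricD[OF sym_fnlD(3)[OF \<phi>]]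
  let ?\<beta> = "\<lambda>x y. \<phi> (vs @ [x, y])"
  have \<beta>: "?\<beta> \<in> bilinear_forms B"
    using sym_fnl_form[OF \<phi>, of vs "[]"] by simp
  note bl = bilinear_forms_bilinear[OF \<beta>]
  \<comment> \<open>The Koszul exchange for vectors without pure parity, again through (1 + s + t -
    s t) / 2 for the two parity signs.\<close>
  have key: "?\<beta> u w = (1/2) * (?\<beta> w u + ?\<beta> (\<gamma> w) u + (?\<beta> w (\<gamma> u) + (-1) * ?\<beta> (\<gamma> w) (\<gamma> u)))" for u w
  proof -
    define e where "e = (1/2) *\<^sub>R (w + \<gamma> w)"
    define d where "d = (1/2) *\<^sub>R (w - \<gamma> w)"
    have ed: "\<gamma> e = e" "\<gamma> d = - d" "w = e + d"
      unfolding e_def d_def by (rule parity_parts[OF \<gamma>_linear parity_parity])+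
    have "?\<beta> u w = ?\<beta> e u + ?\<beta> d (\<gamma> u)"
      using ml(1)[of "vs @ [u]" e d "[]"] s(1)[OF ed(1), of vs u "[]"] s(2)[OF ed(2), of vs u "[]"]
      by (simp flip: ed(3))
    also have "\<dots> = (1/2) * (?\<beta> w u + ?\<beta> (\<gamma> w) u + (?\<beta> w (\<gamma> u) + (-1) * ?\<beta> (\<gamma> w) (\<gamma> u)))"
      unfolding e_def d_def bilinear_lmul[OF bl] bilinear_ladd[OF bl] bilinear_lsub[OF bl]
      by (simp add: algebra_simps)
    finally show ?thesis .
  qed
  note lin = cont_linear_id cont_linear_parity qGF_cont cont_linear_compose[OF cont_linear_parity qGF_cont]
  have f: "(\<lambda>x y. ?\<beta> (qGF x) (\<gamma> y)) \<in> bilinear_forms B" "(\<lambda>x y. ?\<beta> (\<gamma> (qGF x)) (\<gamma> y)) \<in> bilinear_forms B"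
    "(\<lambda>x y. ?\<beta> (qGF x) y) \<in> bilinear_forms B" "(\<lambda>x y. ?\<beta> (\<gamma> (qGF x)) y) \<in> bilinear_forms B"
    using bilinear_forms_comp[OF \<beta> lin(3,2)] bilinear_forms_comp[OF \<beta> lin(4,2)]
      bilinear_forms_comp[OF \<beta> lin(3,1)] bilinear_forms_comp[OF \<beta> lin(4,1)] by simp_all
  note f' = f[THEN bilinear_forms_swap]
  have "tpair K (\<lambda>x y. ?\<beta> (\<gamma> x) (qGF y)) = tpair K (\<lambda>x y. (1/2) * (?\<beta> (qGF y) (\<gamma> x) + ?\<beta> (\<gamma> (qGF y)) (\<gamma> x) +
      (?\<beta> (qGF y) x + (-1) * ?\<beta> (\<gamma> (qGF y)) x)))"
    using key[of "\<gamma> _" "qGF _"] by (simp only: parity_parity)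
  also have "\<dots> = (1/2) * (tpair K (\<lambda>x y. ?\<beta> (qGF y) (\<gamma> x)) + tpair K (\<lambda>x y. ?\<beta> (\<gamma> (qGF y)) (\<gamma> x)) +
      (tpair K (\<lambda>x y. ?\<beta> (qGF y) x) + (-1) * tpair K (\<lambda>x y. ?\<beta> (\<gamma> (qGF y)) x)))"
    by (simp only: tpair_scale[OF K(1)] tpair_add[OF K(1)] f' bilinear_forms_add bilinear_forms_scale)
  also have "\<dots> = (1/2) * (tpair K (\<lambda>x y. ?\<beta> (qGF x) (\<gamma> y)) + tpair K (\<lambda>x y. ?\<beta> (\<gamma> (qGF x)) (\<gamma> y)) +
      (tpair K (\<lambda>x y. ?\<beta> (qGF x) y) + (-1) * tpair K (\<lambda>x y. ?\<beta> (\<gamma> (qGF x)) y)))"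
    by (simp only: odd_graded_symmetric[OF K f(1)] odd_graded_symmetric[OF K f(2)]
        odd_graded_symmetric[OF K f(3)] odd_graded_symmetric[OF K f(4)])
  also have "\<dots> = tpair K (\<lambda>x y. ?\<beta> (qGF x) y)"
    using odd_tensor_qGF[OF K(2) \<beta> K(1)]
      odd_tensor_qGF[OF K(2) bilinear_forms_comp[OF \<beta> cont_linear_id cont_linear_parity] K(1)] by simp
  finally show ?thesis .
qed

text \<open>The right-hand side is the contraction with the \<open>L\<close>-derivative of the propagator.\<close>

lemma BV_Laplacian_QGF:
  assumes K: "tensor B K" "odd_tensor K" "graded_symmetric B K" and \<phi>: "\<phi> \<in> sym_fnl B"
  shows "BV_Laplacian B K (QGF B \<phi>) vs + QGF B (BV_Laplacian B K \<phi>) vs =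
    2 * partial2 B (tmap qGF (\<lambda>v. v) K) \<phi> vs"
proof -
  let ?us = "\<lambda>i. take i vs @ [qGF (\<gamma> (vs ! i))] @ map \<gamma> (drop (Suc i) vs)"
  let ?I = "{..<length vs}"
  have f: "(\<lambda>x y. \<phi> (us @ [x, y])) \<in> bilinear_forms B" for us
    using sym_fnl_form[OF \<phi>, of us "[]"] by simp
  \<comment> \<open>The derivation hits either an argument in \<open>vs\<close> or one of the two
    contracted entries; only the latter survive in the commutator.\<close>
  have "odd_der \<gamma> qGF \<phi> (vs @ [\<gamma> x, \<gamma> y]) =
      (\<Sum>i\<in>?I. \<phi> (?us i @ [x, y])) + (\<phi> (vs @ [qGF x, y]) + \<phi> (vs @ [\<gamma> x, qGF y]))" for x y
    unfolding odd_der_append by (simp add: odd_der_Cons odd_der_Nil) (simp add: odd_der_def)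
  moreover have "(\<lambda>x y. \<phi> (vs @ [qGF x, y])) \<in> bilinear_forms B" "(\<lambda>x y. \<phi> (vs @ [\<gamma> x, qGF y])) \<in> bilinear_forms B"
    using bilinear_forms_comp[OF f qGF_cont cont_linear_id] bilinear_forms_comp[OF f cont_linear_parity qGF_cont]
    by simp_all
  ultimately have "tpair K (\<lambda>x y. odd_der \<gamma> qGF \<phi> (vs @ [\<gamma> x, \<gamma> y])) = (\<Sum>i\<in>?I. tpair K (\<lambda>x y. \<phi> (?us i @ [x, y]))) +
      (tpair K (\<lambda>x y. \<phi> (vs @ [qGF x, y])) + tpair K (\<lambda>x y. \<phi> (vs @ [\<gamma> x, qGF y])))"
    using tpair_sum[OF K(1), of ?I "\<lambda>i x y. \<phi> (?us i @ [x, y])", OF f finite_lessThan]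
    by (simp only: tpair_add[OF K(1)] bilinear_forms_add)
  moreover have "BV_Laplacian B K (QGF B \<phi>) vs = (1/2) * tpair K (\<lambda>x y. odd_der \<gamma> qGF \<phi> (vs @ [\<gamma> x, \<gamma> y]))"
  proof -
    have "odd_der \<gamma> qGF \<phi> \<in> sym_fnl B"
      by (rule sym_fnl_odd_der[OF \<phi> qGF_cont qGF_\<gamma>])
    from partial2_scale[OF K(1) this, of "-1" vs] show ?thesis
      by (simp add: BV_Laplacian_def QGF_def) (simp add: partial2_eq)
  qed
  moreover have "QGF B (BV_Laplacian B K \<phi>) vs = - (1/2) * (\<Sum>i\<in>?I. tpair K (\<lambda>x y. \<phi> (?us i @ [x, y])))"
  proof -
    have "QGF B (BV_Laplacian B K \<phi>) vs = odd_der \<gamma> qGF (partial2 B K \<phi>) vs"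
      using odd_der_scale[of \<gamma> qGF "-1" "partial2 B K \<phi>" vs] by (simp add: QGF_def BV_Laplacian_def)
    also have "\<dots> = (\<Sum>i\<in>?I. (1/2) * tpair K (\<lambda>x y. \<phi> (?us i @ [\<gamma> x, \<gamma> y])))"
      unfolding odd_der_def partial2_eq ..
    \<comment> \<open>Removing the parity operators from both legs of the odd kernel costs a sign,
      so these terms cancel those of the other order.\<close>
    also have "\<dots> = (\<Sum>i\<in>?I. (1/2) * - tpair K (\<lambda>x y. \<phi> (?us i @ [x, y])))"
      by (simp only: odd_tensorD[OF K(2) f])
    finally show ?thesis
      by (simp add: sum_distrib_left)
  qed
  moreover have "2 * partial2 B (tmap qGF (\<lambda>v. v) K) \<phi> vs = tpair K (\<lambda>x y. \<phi> (vs @ [qGF x, y]))"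
    unfolding partial2_eq tpair_tmap odd_tensor_qGF[OF K(2) f K(1)] by simp
  \<comment> \<open>The two contracted entries contribute equally, so their halves add up to one
    full pairing.\<close>
  ultimately show ?thesis
    unfolding odd_tensor_qGF_swap[OF K \<phi>] by simp
qed

end

section \<open>The half-time flow on functionals\<close>

context heat_bv
begin

text \<open>At \<open>L > 0\<close> all nearby times are positive, so the derivative within
  \<open>{0..}\<close> becomes two-sided.\<close>

lemma half_flow_vderiv:
  assumes "0 < L"
  shows "has_vderiv (\<lambda>l. U (l / 2) v) (- (1/2) *\<^sub>R D (U (L / 2) v)) L UNIV"
proof -
  have "\<forall>\<^sub>F l in at L. 0 < l"
    using order_tendstoD(1)[OF tendsto_ident_at assms] .
  then have "filterlim (\<lambda>l. l / 2) (at (L / 2) within {0..}) (at L)"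
    by (auto simp: filterlim_at eventually_at_filter intro!: tendsto_eq_intros elim: eventually_mono)
  from vlim_scaleR[OF vlim_compose[OF U_vderiv[of "L / 2" v, unfolded has_vderiv_def] this] tendsto_const, of "1/2"] assms
  have "vlim (\<lambda>l. (1/2) *\<^sub>R (1 / (l / 2 - L / 2)) *\<^sub>R (U (l / 2) v - U (L / 2) v)) ((1/2) *\<^sub>R - D (U (L / 2) v)) (at L)"
    by simp
  moreover have "(1/2) *\<^sub>R (1 / (l / 2 - L / 2)) *\<^sub>R w = (1 / (l - L)) *\<^sub>R w" for l and w :: 'v
  proof -
    have "(1/2) * (1 / (l / 2 - L / 2)) = 1 / (l - L)"
      by (simp add: diff_divide_distrib[symmetric])
    then show ?thesis by (simp only: scaleR_scaleR)
  qed
  ultimately show ?thesis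
    unfolding has_vderiv_def by simp
qed

lemma heat_fnl_odd_der:
  assumes "0 \<le> L"
  shows "Qop B (heat_fnl U L \<phi>) = heat_fnl U L (Qop B \<phi>)" "QGF B (heat_fnl U L \<phi>) = heat_fnl U L (QGF B \<phi>)"
  using odd_der_compose[of "U (L / 2)" \<gamma> q \<phi>] odd_der_compose[of "U (L / 2)" \<gamma> qGF \<phi>] U_commutes[of "L / 2"] assms
  by (simp_all add: Qop_def QGF_def heat_fnl_def[abs_def] fun_eq_iff)

text \<open>\<open>Eplus\<close> is specified only on images of the flow, so \<open>\<phi>\<close>
  is pulled back at both scales. The preimages differ by the flow at time
  \<open>(L' - L) / 2\<close>, and \<open>heat_kernel_flow\<close> transports one kernel to the
  other by the same flow on both legs.\<close>

lemma BV_Laplacian_tilde_independent: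
  assumes K: "is_heat_kernel B U L (K L)" "is_heat_kernel B U L' (K L')" and L: "0 < L" "L \<le> L'"
    and Eplus: "\<And>L \<phi>. 0 < L \<Longrightarrow> \<phi> \<in> sym_fnl B \<Longrightarrow> Eplus L (heat_fnl U L \<phi>) = \<phi>"
    and \<phi>: "\<phi> \<in> heat_fnl U L ` sym_fnl B" "\<phi> \<in> heat_fnl U L' ` sym_fnl B"
  shows "BV_Laplacian_tilde B U Eplus K L \<phi> = BV_Laplacian_tilde B U Eplus K L' \<phi>"
proof -
  obtain \<psi> \<psi>' where \<psi>: "\<psi> \<in> sym_fnl B" "\<phi> = heat_fnl U L \<psi>" and \<psi>': "\<psi>' \<in> sym_fnl B" "\<phi> = heat_fnl U L' \<psi>'"
    using \<phi> by blast
  define t where "t = (L' - L) / 2"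
  have t: "0 \<le> t" "L' = L + 2 * t" using L(2) by (simp_all add: t_def field_simps)
  have UU: "U t (U (L / 2) v) = U (L' / 2) v" for v
    using U_add[of t "L / 2" v] L t by (simp add: add.commute add_divide_distrib)
  \<comment> \<open>Both sides have the same image under \<open>heat_fnl U L\<close>, and the left
    inverse \<open>Eplus L\<close> makes this map injective on symmetric functionals.\<close>
  have \<psi>_eq: "\<psi> = (\<lambda>vs. \<psi>' (map (U t) vs))"
  proof -
    have s: "(\<lambda>vs. \<psi>' (map (U t) vs)) \<in> sym_fnl B"
      by (rule sym_fnl_map[OF \<psi>'(1) U_cont[OF t(1)]]) (simp add: U_commutes t)
    have eq: "heat_fnl U L (\<lambda>vs. \<psi>' (map (U t) vs)) = heat_fnl U L \<psi>"
      unfolding \<psi>(2)[symmetric] \<psi>'(2) by (simp add: heat_fnl_def fun_eq_iff o_def UU)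
    show ?thesis
      using Eplus[OF L(1) s] unfolding eq Eplus[OF L(1) \<psi>(1)] .
  qed
  have L': "0 < L'" using L by simp
  have "BV_Laplacian B (K L) \<psi> ws = BV_Laplacian B (K L') \<psi>' (map (U t) ws)" for ws
    unfolding BV_Laplacian_def partial2_eq \<psi>_eq
      heat_kernel_flow[OF K L(1) t(2,1) partial2_form[OF \<psi>'(1), of "map (U t) ws"]]
    by (simp add: U_commutes[OF t(1)])
  then have "heat_fnl U L (BV_Laplacian B (K L) \<psi>) = heat_fnl U L' (BV_Laplacian B (K L') \<psi>')"
    by (simp add: heat_fnl_def fun_eq_iff o_def UU)
  then show ?thesis
    unfolding BV_Laplacian_tilde_def Eplus[OF L(1) \<psi>(1), folded \<psi>(2)] Eplus[OF L' \<psi>'(1), folded \<psi>'(2)] .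
qed

end

theorem proposition4p4:
  fixes B :: "('m::euclidean_space, 'r::finite, 'v::real_vector) bv"
    and U :: "real \<Rightarrow> 'v \<Rightarrow> 'v"
    and K P :: "real \<Rightarrow> 'v tens"
    and Eplus :: "real \<Rightarrow> 'v fnl \<Rightarrow> 'v fnl"
    and S St :: "real \<Rightarrow> nat \<Rightarrow> 'v fnl"
    and \<epsilon> :: real
  assumes "free_bv_theory B" and "gauge_fixing B"
    and "heat_semigroup B U"
    and "\<And>L. L > 0 \<Longrightarrow> is_heat_kernel B U L (K L)"
    and "\<And>L. L > 0 \<Longrightarrow> graded_symmetric B (K L)"
    and "tensor_differentiable B K"
    and "\<epsilon> > 0"
    and "\<And>L. L \<ge> \<epsilon> \<Longrightarrow> is_propagator B K \<epsilon> L (P L)"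
    and Eplus: "\<And>L \<phi>. L > 0 \<Longrightarrow> \<phi> \<in> sym_fnl B \<Longrightarrow> Eplus L (heat_fnl U L \<phi>) = \<phi>"
    and "\<And>L. L \<ge> \<epsilon> \<Longrightarrow> interaction B (S L)"
    and RGE: "\<And>L. L \<ge> \<epsilon> \<Longrightarrow>
      exp_over_hbar B (S L) = exp_contraction B (P L) (exp_over_hbar B (S \<epsilon>))"
    and QME: "\<And>L. L > \<epsilon> \<Longrightarrow>
      plus_hbar (Qop B) (BV_Laplacian B (K L)) (exp_over_hbar B (S L)) = (\<lambda>k vs. 0)"
    and "\<And>L. L > \<epsilon> \<Longrightarrow> interaction B (St L)"
    and St: "\<And>L. L > \<epsilon> \<Longrightarrow>
      exp_over_hbar B (St L) = (\<lambda>k. heat_fnl U L (exp_over_hbar B (S L) k))"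
  shows "(\<forall>L>\<epsilon>. \<forall>k vs.
      ((\<lambda>l. exp_over_hbar B (St l) k vs) has_real_derivative
        - (1/2) * plus_hbar (Qop B) (BV_Laplacian_tilde B U Eplus K L)
                    (\<lambda>j. QGF B (exp_over_hbar B (St L) j)) k vs) (at L)) \<and>
    (\<forall>L>0. \<forall>L'>0. \<forall>\<phi> \<in> heat_fnl U L ` sym_fnl B \<inter> heat_fnl U L' ` sym_fnl B.
      BV_Laplacian_tilde B U Eplus K L \<phi> = BV_Laplacian_tilde B U Eplus K L' \<phi>)"
proof -
  interpret heat_bv B U
    using assms(1-3) by unfold_locales
  have K: "tensor B (K l)" "odd_tensor (K l)" "graded_symmetric B (K l)" if "0 < l" for l
    using assms(4,5)[OF that] heat_kernel_odd[OF assms(4)[OF that] that] by (simp_all add: is_heat_kernel_def)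
  have exp_flow: "((\<lambda>l. exp_over_hbar B (St l) k vs) has_real_derivative
      - (1/2) * plus_hbar (Qop B) (BV_Laplacian_tilde B U Eplus K L)
        (\<lambda>j. QGF B (exp_over_hbar B (St L) j)) k vs) (at L)" if L: "\<epsilon> < L" for L k vs
  proof -
    have L0: "0 < L" using L assms(7) by simp
    define F where "F = exp_over_hbar B (S L)"
    define ws where "ws = map (U (L / 2)) vs"
    let ?R = "tmap qGF (\<lambda>v. v) (K L)"
    have F: "F j \<in> sym_fnl B" for j
      unfolding F_def using L by (intro exp_over_hbar_sym_fnl assms(10)) simp
    have S\<epsilon>: "interaction B (S \<epsilon>)"
      by (rule assms(10)) simp
    have RGE_L: "exp_contraction B (P L) (exp_over_hbar B (S \<epsilon>)) = F"
      unfolding F_def using RGE[of L] L by simp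
    have even: "even_tensor (P L)"
      using L by (intro even_propagator[OF K(2,1) assms(7) assms(8)]) simp_all
    have P_deriv: "tensor_deriv P ?R L"
      by (rule propagator_deriv[OF assms(6) K(1) assms(7) L assms(8)])
    \<comment> \<open>The exponential of \<open>S \<epsilon>\<close> is fixed, so all dependence on
      \<open>l\<close> sits in the propagator and in the arguments
      \<open>U (l / 2) v\<close>.\<close>
    have flow: "((\<lambda>l. exp_contraction B (P l) (exp_over_hbar B (S \<epsilon>)) k (map (U (l / 2)) vs)) has_real_derivative
        - partial2 B ?R (F (k - 1)) ws + (\<Sum>i<length vs. F k
          (take i ws @ (- (1/2) *\<^sub>R D (U (L / 2) (vs ! i))) # drop (Suc i) ws))) (at L)"
      using exp_contraction_deriv[where F = "exp_over_hbar B (S \<epsilon>)" and k = k and vs = vs, OF P_deriv even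
          exp_over_hbar_sym_fnl[OF S\<epsilon>] exp_over_hbar_zero[OF S\<epsilon>] half_flow_vderiv[OF L0]]
      unfolding RGE_L ws_def .
    have "(\<Sum>i<length vs. F k (take i ws @ (- (1/2) *\<^sub>R D (U (L / 2) (vs ! i))) # drop (Suc i) ws)) =
        - (1/2) * (\<Sum>i<length ws. F k (take i ws @ D (ws ! i) # drop (Suc i) ws))"
      unfolding sum_distrib_left
      by (rule sum.cong) (simp_all only: multilinearD(3)[OF sym_fnlD(1)[OF F]] ws_def length_map nth_map lessThan_iff)
    moreover have "(\<Sum>i<length ws. F k (take i ws @ D (ws ! i) # drop (Suc i) ws)) =
        Qop B (QGF B (F k)) ws - QGF B (BV_Laplacian B (K L) (F (k - 1))) ws"
    proof -
      \<comment> \<open>The master equation at the \<open>k\<close>-th power of \<hbar> trades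
        \<open>Qop\<close> on \<open>F k\<close> for the Laplacian on \<open>F (k - 1)\<close>. As
        an identity of functionals it can be fed to \<open>QGF\<close>.\<close>
      have "Qop B (F k) us = - BV_Laplacian B (K L) (F (k - 1)) us" for us
        using fun_cong[OF fun_cong[OF QME[OF L]], of k us] by (simp add: plus_hbar_def F_def)
      then have "Qop B (F k) = (\<lambda>us. - 1 * BV_Laplacian B (K L) (F (k - 1)) us)"
        by (simp add: fun_eq_iff)
      then have "QGF B (Qop B (F k)) ws = - QGF B (BV_Laplacian B (K L) (F (k - 1))) ws"
        by (simp only: QGF_def odd_der_scale)
      then show ?thesis
        unfolding laplacian_derivation[OF F] by simp
    qed
    moreover have "2 * partial2 B ?R (F (k - 1)) ws =
        BV_Laplacian B (K L) (QGF B (F (k - 1))) ws + QGF B (BV_Laplacian B (K L) (F (k - 1))) ws"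
      by (rule BV_Laplacian_QGF[OF K[OF L0] F, symmetric])
    \<comment> \<open>The terms with \<open>QGF\<close> outermost cancel: one comes from the
      contraction, the other from \<open>D\<close> after the master equation.\<close>
    ultimately have exact: "- partial2 B ?R (F (k - 1)) ws + (\<Sum>i<length vs. F k
          (take i ws @ (- (1/2) *\<^sub>R D (U (L / 2) (vs ! i))) # drop (Suc i) ws)) =
        - (1/2) * (Qop B (QGF B (F k)) ws + BV_Laplacian B (K L) (QGF B (F (k - 1))) ws)"
      by argo
    note deriv = flow[unfolded exact]
    \<comment> \<open>This exhibits the argument of the conjugated Laplacian as the flow of a
      symmetric functional, where \<open>Eplus\<close> can be evaluated.\<close>
    have QGF_St: "QGF B (exp_over_hbar B (St L) j) = heat_fnl U L (QGF B (F j))" for j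
      unfolding St[OF L] F_def using L0 by (simp add: heat_fnl_odd_der)
    have "plus_hbar (Qop B) (BV_Laplacian_tilde B U Eplus K L) (\<lambda>j. QGF B (exp_over_hbar B (St L) j)) k vs =
        Qop B (QGF B (F k)) ws + BV_Laplacian B (K L) (QGF B (F (k - 1))) ws"
      unfolding plus_hbar_def BV_Laplacian_tilde_def QGF_St Eplus[OF L0 QGF_sym_fnl[OF F]]
        heat_fnl_odd_der(1)[OF less_imp_le[OF L0]]
      by (simp add: heat_fnl_def ws_def)
    moreover have "exp_over_hbar B (St l) k vs =
        exp_contraction B (P l) (exp_over_hbar B (S \<epsilon>)) k (map (U (l / 2)) vs)" if "l \<in> {\<epsilon><..}" for l
      using St[of l] RGE[of l] that by (simp add: heat_fnl_def)
    \<comment> \<open>The rewritten exponential agrees with the original only above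
      \<open>\<epsilon>\<close>; this is an open set containing \<open>L\<close>, so the derivative
      is the same.\<close>
    ultimately show ?thesis
      using has_field_derivative_transform_within_open[OF deriv open_greaterThan, of \<epsilon>] L by simp
  qed
  have "BV_Laplacian_tilde B U Eplus K L \<phi> = BV_Laplacian_tilde B U Eplus K L' \<phi>"
    if "0 < L" "0 < L'" "\<phi> \<in> heat_fnl U L ` sym_fnl B" "\<phi> \<in> heat_fnl U L' ` sym_fnl B" for L L' \<phi>
  proof (cases "L \<le> L'")
    case True
    then show ?thesis
      using that Eplus assms(4) by (intro BV_Laplacian_tilde_independent) auto
  next
    case False
    then show ?thesis
      using that Eplus assms(4) by (intro BV_Laplacian_tilde_independent[symmetric]) auto
  qed
  with exp_flow show ?thesis by blast
qed

end
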